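(* Let $\kappa\in\mathbb{R}$ be the dimensionless parameter of an Euler top with distinct moments of inertia, let $I_{\beta_\pm}(h)$ be the scaled, discrete-symmetry-reduced actions and let $I_\alpha(h)$ be the regular action, all as defined in the context. The semi-global symplectic invariant $\sigma(J)$ of the Euler top (reduced by its discrete symmetry) near the hyperbolic equilibrium, i.e. the power series $\sigma$ defined by $$2\pi\,(I_{\beta_\pm}\circ I_\alpha^{-1})(J)=\mathcal{A}_\pm\pm J\log(\pm J)\mp J\mp\sigma(J)$$ (upper signs for $J>0$, lower signs for $J<0$, $|J|$ small, with $\mathcal{A}_\pm=2\pi I_{\beta_\pm}(0)=2\tan^{-1}(\rho^{\mp1})$), is given by $$\begin{aligned}\sigma(J)=\;&\tfrac12\log\!\left(\tfrac{64}{\kappa^2+4}\right)J-\tfrac{3\kappa}{8}J^2-\tfrac{15\kappa^2+32}{96}J^3-\tfrac{5\kappa(11\kappa^2+36)}{512}J^4\\&-\tfrac{945\kappa^4+4200\kappa^2+2672}{10240}J^5-\tfrac{7\kappa(527\kappa^4+2960\kappa^2+3600)}{40960}J^6\\&-\tfrac{65709\kappa^6+446040\kappa^4+801360\kappa^2+241664}{688128}J^7+\mathcal{O}(J^8).\end{aligned}$$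
   Context: The Euler top has principal moments of inertia $0<\Theta_1<\Theta_2<\Theta_3$ satisfying the triangle inequalities. Set $$\rho:=\sqrt{\frac{\Theta_1(\Theta_3-\Theta_2)}{\Theta_3(\Theta_2-\Theta_1)}}>0,\qquad \kappa:=\rho-\rho^{-1}.$$ After scaling, on the sphere of constant angular momentum $\ell$, with canonical coordinates $q=\mathrm{Arg}(L_2+\mathrm{i}L_1)$, $p=L_3/\ell$ and area form $dq\wedge dp$, the Hamiltonian (with value $h$, and $h=0$ at the unstable equilibrium) is $$H(q,p)=\tfrac12\left(-p^2(\rho+\rho^{-1}\sin^2q)+\rho^{-1}\sin^2q\right).$$ The phase space is reduced by the group generated by $(q,p)\mapsto(-q,-p)$ and $(q,p)\mapsto(q+\pi,p)$; a fundamental region is $[0,\pi)\times[0,1)$. Let $w(z)^2=z(z^2+\kappa z-1)=z(z+\rho)(z-\rho^{-1})$ and $\zeta(h)=\frac{\sqrt{2h-z}}{w(z)}\,dz$. The scaled symmetry-reduced actions are $I_{\beta_\pm}(h)=\frac1{4\pi}\oint_{\beta_\pm}\zeta(h)$ for $\pm h>0$, where $\beta_+$ encircles the branch points $2h,\rho^{-1}$ and $\beta_-$ encircles $-\rho,2h$, oriented so that the actions are positive. Explicitly, $$I_{\beta_+}(h)=\frac1{2\pi}\int_{2h}^{\rho^{-1}}\sqrt{\frac{x-2h}{x(x+\rho)(\rho^{-1}-x)}}\,dx\quad(0<2h<\rho^{-1}),$$ $$I_{\beta_-}(h)=\frac1{2\pi}\int_{-\rho}^{2h}\sqrt{\frac{x-2h}{x(x+\rho)(\rho^{-1}-x)}}\,dx\quad(-\rho<2h<0).$$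 $I_{\beta_\pm}(0)$ denotes the limit as $h\to0^\pm$. The regular action is $I_\alpha(h)=\frac{\mathrm{i}}{2\pi}\oint_\alpha\zeta(h)$, where $\alpha$ encircles $z=0$ and $z=2h$ only. With branches fixed so that $I_\alpha(h)=h+\mathcal{O}(h^2)$ this is $$I_\alpha(h)=\frac{\mathrm{i}}{2\pi}\oint_{|z|=\varepsilon}\frac{(1-2h/z)^{1/2}}{(1-\kappa z-z^2)^{1/2}}\,dz$$ for a small fixed $\varepsilon>2|h|$, counterclockwise, with principal branches. It is analytic near $h=0$ and $I_\alpha^{-1}$ is its local inverse. *)

theory Defs
  imports "HOL-Complex_Analysis.Complex_Analysis" "HOL-Library.Landau_Symbols"
begin

text \<open>
  The triangle inequalities are taken non-strictly, so that flat bodies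
  (\<open>\<Theta>\<^sub>3 = \<Theta>\<^sub>1 + \<Theta>\<^sub>2\<close>) are included.
\<close>

definition euler_top :: "real \<Rightarrow> real \<Rightarrow> real \<Rightarrow> bool" where
  "euler_top \<Theta>\<^sub>1 \<Theta>\<^sub>2 \<Theta>\<^sub>3 \<longleftrightarrow>
     0 < \<Theta>\<^sub>1 \<and> \<Theta>\<^sub>1 < \<Theta>\<^sub>2 \<and> \<Theta>\<^sub>2 < \<Theta>\<^sub>3 \<and>
     \<Theta>\<^sub>1 \<le> \<Theta>\<^sub>2 + \<Theta>\<^sub>3 \<and> \<Theta>\<^sub>2 \<le> \<Theta>\<^sub>3 + \<Theta>\<^sub>1 \<and> \<Theta>\<^sub>3 \<le> \<Theta>\<^sub>1 + \<Theta>\<^sub>2"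

definition top_rho :: "real \<Rightarrow> real \<Rightarrow> real \<Rightarrow> real" where
  "top_rho \<Theta>\<^sub>1 \<Theta>\<^sub>2 \<Theta>\<^sub>3 = sqrt ((\<Theta>\<^sub>1 * (\<Theta>\<^sub>3 - \<Theta>\<^sub>2)) / (\<Theta>\<^sub>3 * (\<Theta>\<^sub>2 - \<Theta>\<^sub>1)))"

definition top_kappa :: "real \<Rightarrow> real" where
  "top_kappa \<rho> = \<rho> - inverse \<rho>"

text \<open>
  The symmetry-reduced actions \<open>1/(4\<pi>) \<cdot> \<ointegral> \<zeta>(h)\<close> over the cycles \<open>\<beta>\<^sub>\<plusminus>\<close>, with the cycle collapsed
  onto the real interval between the two encircled branch points.  They are meaningful for
  \<open>0 < 2h < 1/\<rho>\<close> and \<open>-\<rho> < 2h < 0\<close>, respectively.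
\<close>

definition I_beta_plus :: "real \<Rightarrow> real \<Rightarrow> real" where
  "I_beta_plus \<rho> h = 1 / (2 * pi) *
     integral {2 * h .. inverse \<rho>} (\<lambda>x. sqrt ((x - 2 * h) / (x * (x + \<rho>) * (inverse \<rho> - x))))"

definition I_beta_minus :: "real \<Rightarrow> real \<Rightarrow> real" where
  "I_beta_minus \<rho> h = 1 / (2 * pi) *
     integral {- \<rho> .. 2 * h} (\<lambda>x. sqrt ((x - 2 * h) / (x * (x + \<rho>) * (inverse \<rho> - x))))"

definition I_beta_plus_0 :: "real \<Rightarrow> real" where
  "I_beta_plus_0 \<rho> = Lim (at_right 0) (I_beta_plus \<rho>)"

definition I_beta_minus_0 :: "real \<Rightarrow> real" where
  "I_beta_minus_0 \<rho> = Lim (at_left 0) (I_beta_minus \<rho>)"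

text \<open>
  The cycle \<open>\<alpha>\<close> is realised by a circle of fixed radius \<open>\<epsilon>\<close>, which has to satisfy
  \<open>2|h| < \<epsilon> < min \<rho> (1/\<rho>)\<close> in order to enclose exactly the branch points \<open>0\<close> and \<open>2h\<close>.  Under this
  condition neither radicand meets the branch cut of the principal square root: \<open>1 - 2h/z\<close> has
  positive real part, and \<open>1 - \<kappa>z - z\<^sup>2 = (1 + z/\<rho>)(1 - \<rho>z)\<close> is a product of two numbers with
  positive real part.
\<close>

definition I_alpha :: "real \<Rightarrow> real \<Rightarrow> complex \<Rightarrow> complex" where
  "I_alpha \<rho> \<epsilon> h = \<i> / (2 * of_real pi) *
     contour_integral (circlepath 0 \<epsilon>)
       (\<lambda>z. csqrt (1 - 2 * h / z) / csqrt (1 - of_real (top_kappa \<rho>) * z - z\<^sup>2))"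

definition admissible_radius :: "real \<Rightarrow> real \<Rightarrow> bool" where
  "admissible_radius \<rho> \<epsilon> \<longleftrightarrow> 0 < \<epsilon> \<and> \<epsilon> < \<rho> \<and> \<epsilon> < inverse \<rho>"

text \<open>
  A real local inverse at \<open>0\<close> of a function that is analytic at \<open>0\<close>.  Where the function is
  injective near \<open>0\<close>, as the regular action is, continuity together with \<open>g 0 = 0\<close> determines
  \<open>g\<close> near \<open>0\<close>.
\<close>

definition real_local_inverse :: "(complex \<Rightarrow> complex) \<Rightarrow> (real \<Rightarrow> real) \<Rightarrow> bool" where
  "real_local_inverse f g \<longleftrightarrow>
     g 0 = 0 \<and> isCont g 0 \<and> (\<forall>\<^sub>F J in nhds 0. f (of_real (g J)) = of_real J)"

text \<open>
  The defining property of the semi-global symplectic invariant.  The quantification over \<open>\<epsilon>\<close> and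
  \<open>g\<close> only says that the choice of the circle and of a representative of the germ of the inverse
  of the regular action is immaterial.
\<close>

definition semiglobal_invariant :: "real \<Rightarrow> real fps \<Rightarrow> bool" where
  "semiglobal_invariant \<rho> \<sigma> \<longleftrightarrow>
     fps_conv_radius \<sigma> > 0 \<and>
     (\<forall>\<epsilon> g. admissible_radius \<rho> \<epsilon> \<longrightarrow> real_local_inverse (I_alpha \<rho> \<epsilon>) g \<longrightarrow>
        (\<forall>\<^sub>F J in at_right 0.
           2 * pi * I_beta_plus \<rho> (g J) =
             2 * pi * I_beta_plus_0 \<rho> + J * ln J - J - eval_fps \<sigma> J) \<and>
        (\<forall>\<^sub>F J in at_left 0.
           2 * pi * I_beta_minus \<rho> (g J) =
             2 * pi * I_beta_minus_0 \<rho> - J * ln (- J) + J + eval_fps \<sigma> J))"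

end

theory Submission
  imports Defs
begin

text \<open>
  Write \<open>s = 2h\<close>, \<open>Q(x) = 1 - \<kappa>x - x\<^sup>2 = (x + \<rho>)(1/\<rho> - x)\<close>,
  \<open>1/sqrt Q(x) = \<Sum> f\<^sub>n x\<^sup>n\<close> and \<open>sqrt(1 - t) = \<Sum> b\<^sub>k t\<^sup>k\<close>.  Both kinds of action come from expanding
  \<open>sqrt(1 - s/x) = \<Sum> b\<^sub>k (s/x)\<^sup>k\<close> under the integral sign.

  On the circle the expansion leaves only residues, so the regular action is the power series
  \<open>L(s) = - \<Sum> b\<^sub>k f\<^bsub>k-1\<^esub> s\<^sup>k\<close>, the sum being over \<open>k \<ge> 1\<close> (\<open>I_alpha_sums\<close>).  On the real interval
  it leaves the moments \<open>M\<^sub>k(s) = \<integral> x\<^bsup>-k\<^esup>/sqrt Q(x) dx\<close> over \<open>[s, 1/\<rho>]\<close>.  For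
  \<open>k \<ge> 1\<close> such a moment is \<open>- f\<^bsub>k-1\<^esub> ln s\<close> plus a Laurent series in \<open>s\<close>, so the logarithm is
  multiplied by exactly the regular action, and
  \<open>2\<pi> I\<^sub>\<beta>\<^sub>+ = 2 arctan(1/\<rho>) + L(s) ln s + R(s)\<close> with a convergent power series \<open>R\<close>
  (\<open>action_integral\<close>).

  One series serves both signs of \<open>h\<close>.  The substitution \<open>x \<mapsto> -x\<close> turns
  \<open>I\<^sub>\<beta>\<^sub>-\<close> for \<open>\<rho>\<close> into \<open>I\<^sub>\<beta>\<^sub>+\<close> for \<open>1/\<rho>\<close>, that is, it replaces \<open>\<kappa>\<close> by \<open>-\<kappa>\<close> and
  \<open>s\<close> by \<open>-s\<close>; so \<open>L\<close> and \<open>R\<close> have to change sign under this replacement.  For \<open>L\<close> this is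
  the parity of \<open>f\<^sub>n\<close>.  For \<open>R\<close> the point is that integrating the derivative of
  \<open>x\<^bsup>-k\<^esup> sqrt Q(x)\<close> gives a recurrence \<open>k M\<^bsub>k+1\<^esub> = (k - 1/2) \<kappa> M\<^sub>k + (k - 1) M\<^bsub>k-1\<^esub> + s\<^bsup>-k\<^esup> sqrt Q(s)\<close>
  from which \<open>M\<^sub>0\<close> drops out: at \<open>k = 1\<close> its factor vanishes.  All constants of integration in
  \<open>R\<close> therefore go back to the single constant \<open>ln(4/sqrt(\<kappa>\<^sup>2 + 4))\<close> of \<open>M\<^sub>1\<close>, which is even in
  \<open>\<kappa>\<close>; the endpoint \<open>x = s\<close> adds only universal multiples of the \<open>f\<^sub>n\<close>, and
  the constant \<open>2 arctan(1/\<rho>)\<close> of \<open>M\<^sub>0\<close> enters only as the value at \<open>h = 0\<close>.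

  Substituting \<open>J = L(s)\<close> and \<open>ln s = ln J - ln(L(s)/s)\<close> turns the expansion into the required
  form, with \<open>\<sigma>(L(s)) = L(s) ln(L(s)/s) - L(s) - R(s)\<close>.  Hence \<open>\<sigma>\<close> is this series composed with the
  compositional inverse of \<open>L\<close>; the holomorphic inverse function theorem makes it converge, and its
  values to the right of \<open>0\<close> determine it.  Comparing coefficients in \<open>\<sigma> \<circ> L\<close> is a triangular
  linear system, because \<open>L\<close> starts with \<open>s/2\<close>.
\<close>

section \<open>Real and complex power series\<close>

text \<open>
  Through this embedding, composition and inversion of convergent real power series reduce to the
  corresponding facts on germs of holomorphic functions.
\<close>

definition fps_of_real :: "real fps \<Rightarrow> complex fps" where
  "fps_of_real F = Abs_fps (\<lambda>n. of_real (fps_nth F n))"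

lemma fps_nth_fps_of_real [simp]: "fps_nth (fps_of_real F) n = of_real (fps_nth F n)"
  by (simp add: fps_of_real_def)

lemma fps_of_real_compose: "fps_of_real (F oo G) = fps_of_real F oo fps_of_real G"
proof -
  have pow: "fps_of_real (G ^ n) = fps_of_real G ^ n" for n
    by (induction n) (auto simp: fps_eq_iff fps_mult_nth)
  show ?thesis
    by (simp add: fps_eq_iff fps_compose_nth flip: pow)
qed

lemma fps_conv_radius_fps_of_real [simp]: "fps_conv_radius (fps_of_real F) = fps_conv_radius F"
proof -
  have "fps_conv_radius (fps_of_real F) = fps_conv_radius (Abs_fps (\<lambda>n. norm (fps_nth (fps_of_real F) n)))"
    by (simp only: fps_conv_radius_norm)
  also have "\<dots> = fps_conv_radius (Abs_fps (\<lambda>n. norm (fps_nth F n)))"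
    by simp
  finally show ?thesis by (simp only: fps_conv_radius_norm)
qed

lemma eval_fps_of_real:
  assumes "ereal \<bar>x\<bar> < fps_conv_radius F"
  shows "eval_fps (fps_of_real F) (of_real x) = of_real (eval_fps F x)"
proof -
  have "(\<lambda>n. fps_nth F n * x ^ n) sums eval_fps F x"
    using assms by (intro sums_eval_fps) auto
  hence "(\<lambda>n. of_real (fps_nth F n * x ^ n) :: complex) sums of_real (eval_fps F x)"
    by (rule sums_of_real)
  thus ?thesis by (simp add: eval_fps_def sums_iff)
qed

lemma eventually_conv_radius:
  fixes F :: "'a :: {banach, real_normed_field} fps"
  assumes "fps_conv_radius F > 0"
  shows "\<forall>\<^sub>F x in nhds (0::'a). ereal (norm x) < fps_conv_radius F"
proof -
  have "\<forall>\<^sub>F x in nhds (0::'a). x \<in> eball 0 (fps_conv_radius F)"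
    by (rule eventually_nhds_in_open) (use assms in \<open>auto simp: zero_ereal_def\<close>)
  thus ?thesis by (simp only: in_eball_iff dist_0_norm)
qed

lemma tendsto_of_real_nhds_0: "filterlim (of_real :: real \<Rightarrow> complex) (nhds 0) (nhds 0)"
  using tendsto_of_real[OF filterlim_ident[of "nhds 0"], where ?'a = complex] by simp

text \<open>
  The complexified series compose as germs of holomorphic functions; restricting the resulting identity
  to the real axis gives the claim.
\<close>

lemma real_has_fps_expansion_compose:
  fixes f g :: "real \<Rightarrow> real"
  assumes "f has_fps_expansion F" "g has_fps_expansion G" "fps_nth G 0 = 0"
  shows "(\<lambda>x. f (g x)) has_fps_expansion (F oo G)"
proof -
  have rF: "fps_conv_radius F > 0" and rG: "fps_conv_radius G > 0"
    using assms by (auto simp: has_fps_expansion_def)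
  have *: "(eval_fps (fps_of_real F) \<circ> eval_fps (fps_of_real G)) has_fps_expansion fps_of_real (F oo G)"
    unfolding fps_of_real_compose
    by (intro has_fps_expansion_compose eval_fps_has_fps_expansion) (use rF rG assms in auto)
  hence rFG: "fps_conv_radius (F oo G) > 0"
    by (auto simp: has_fps_expansion_def)
  have g0: "filterlim g (nhds 0) (nhds 0)"
  proof -
    have "isCont g 0" using has_fps_expansion_imp_continuous[OF assms(2)] by simp
    moreover have "g 0 = 0"
      using assms(2,3) eventually_nhds_x_imp_x by (fastforce simp: has_fps_expansion_def eval_fps_at_0)
    ultimately show ?thesis by (metis isCont_def tendsto_at_iff_tendsto_nhds)
  qed
  have "\<forall>\<^sub>F x in nhds 0. eval_fps (fps_of_real (F oo G)) (of_real x :: complex)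
           = eval_fps (fps_of_real F) (eval_fps (fps_of_real G) (of_real x))"
    using * eventually_compose_filterlim[OF _ tendsto_of_real_nhds_0]
    by (fastforce simp: has_fps_expansion_def)
  moreover have "\<forall>\<^sub>F x in nhds 0. eval_fps G x = g x" "\<forall>\<^sub>F x in nhds 0. eval_fps F (g x) = f (g x)"
    using assms(1,2) eventually_compose_filterlim[OF _ g0, of "\<lambda>x. eval_fps F x = f x"]
    by (auto simp: has_fps_expansion_def)
  moreover note eventually_conv_radius[OF rG] eventually_conv_radius[OF rFG]
    eventually_compose_filterlim[OF eventually_conv_radius[OF rF] g0]
  ultimately have "\<forall>\<^sub>F x in nhds 0. eval_fps (F oo G) x = f (g x)"
  proof eventually_elim
    case (elim x)
    have "of_real (eval_fps (F oo G) x) = eval_fps (fps_of_real (F oo G)) (of_real x :: complex)"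
      using elim by (subst eval_fps_of_real) auto
    also have "\<dots> = of_real (f (g x))"
      using elim by (simp add: eval_fps_of_real)
    finally show ?case by (simp only: of_real_eq_iff)
  qed
  with rFG show ?thesis by (simp add: has_fps_expansion_def)
qed

text \<open>
  A series with nonvanishing linear coefficient is locally invertible as a holomorphic function, and the
  Taylor series of the local inverse is a compositional left inverse.  Such a left inverse is unique, so
  it is the formal one.
\<close>

lemma fps_conv_radius_fps_inv_pos:
  fixes F :: "real fps"
  assumes F: "fps_conv_radius F > 0" "fps_nth F 0 = 0" "fps_nth F 1 \<noteq> 0"
  shows "fps_conv_radius (fps_inv F) > 0"
proof -
  define H where "H = fps_of_real F"
  define S where "S = (eball 0 (fps_conv_radius H) :: complex set)"
  have H: "fps_conv_radius H > 0" "fps_nth H 0 = 0" "fps_nth H 1 \<noteq> 0"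
    using F by (auto simp: H_def)
  have holS: "eval_fps H holomorphic_on S"
    unfolding S_def by (rule holomorphic_on_eval_fps) auto
  have "0 \<in> S" "open S" using H by (auto simp: S_def zero_ereal_def)
  moreover have "deriv (eval_fps H) 0 \<noteq> 0"
    using H fps_nth_conv_deriv[of H 1] by auto
  ultimately obtain r where r: "r > 0" "ball 0 r \<subseteq> S" "open (eval_fps H ` ball 0 r)"
      "inj_on (eval_fps H) (ball 0 r)"
    using has_complex_derivative_locally_invertible[OF holS] by metis
  have hol: "eval_fps H holomorphic_on ball 0 r"
    using holS r(2) holomorphic_on_subset by blast
  obtain g where g: "g holomorphic_on (eval_fps H ` ball 0 r)"
      "\<And>z. z \<in> ball 0 r \<Longrightarrow> g (eval_fps H z) = z"
    using holomorphic_has_inverse[OF hol _ r(4)] by (metis open_ball)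
  have "eval_fps H 0 \<in> eval_fps H ` ball 0 r" using r(1) by (intro imageI) auto
  hence "0 \<in> eval_fps H ` ball 0 r" using H(2) by (simp add: eval_fps_at_0)
  from has_fps_expansion_fps_expansion[OF r(3) this g(1)]
  have gexp: "g has_fps_expansion fps_expansion g 0" .
  define G where "G = fps_expansion g 0"
  have "(g \<circ> eval_fps H) has_fps_expansion (G oo H)"
    unfolding G_def by (rule has_fps_expansion_compose[OF gexp eval_fps_has_fps_expansion]) (use H in auto)
  moreover have "\<forall>\<^sub>F z in nhds 0. (g \<circ> eval_fps H) z = z"
    using eventually_nhds_in_open[of "ball 0 r" "0::complex"] r(1) g(2)
    by (auto elim!: eventually_mono)
  ultimately have "(\<lambda>z. z) has_fps_expansion (G oo H)"
    using has_fps_expansion_cong[of "g \<circ> eval_fps H" "\<lambda>z. z" "G oo H" "G oo H"] by simp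
  hence "G oo H = fps_X"
    using has_fps_expansion_fps_X fps_expansion_unique_complex by blast
  moreover have "fps_of_real (fps_inv F) oo H = fps_X"
    using fps_inv[OF F(2,3)] unfolding H_def fps_of_real_compose[symmetric]
    by (simp add: fps_eq_iff fps_X_def)
  \<comment> \<open>Composing with the formal inverse from the right shows that left inverses are unique.\<close>
  moreover have "K = fps_inv H" if "K oo H = fps_X" for K
  proof -
    have "(K oo H) oo fps_inv H = K oo (H oo fps_inv H)"
      by (rule fps_compose_assoc[symmetric]) (use H in \<open>auto simp: fps_inv_def\<close>)
    thus ?thesis using that fps_inv_right[OF H(2,3)] by (simp add: fps_inv_def)
  qed
  ultimately have "fps_of_real (fps_inv F) = G" by metis
  moreover have "fps_conv_radius G > 0" using gexp by (simp add: G_def has_fps_expansion_def)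
  ultimately show ?thesis using fps_conv_radius_fps_of_real by metis
qed

text \<open>
  If the difference of the two series were not zero, dividing it by the power of its order would leave a
  continuous function that vanishes to the right of \<open>0\<close> but not at \<open>0\<close>.
\<close>

lemma fps_eq_if_eventually_eq_at_right:
  fixes F G :: "real fps"
  assumes F: "fps_conv_radius F > 0" and G: "fps_conv_radius G > 0"
    and eq: "\<forall>\<^sub>F x in at_right 0. eval_fps F x = eval_fps G x"
  shows "F = G"
proof (rule ccontr)
  assume "F \<noteq> G"
  define C where "C = F - G"
  define n where "n = subdegree C"
  have C0: "fps_nth C n \<noteq> 0" unfolding n_def by (rule nth_subdegree_nonzero) (use \<open>F \<noteq> G\<close> in \<open>simp add: C_def\<close>)
  have rC: "fps_conv_radius C > 0"
    using fps_conv_radius_diff[of F G] F G unfolding C_def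
    by (metis less_le_trans min_less_iff_conj)
  have nh: "eventually P (at_right 0)" if "eventually P (nhds (0::real))" for P
    using that at_within_le_nhds filter_leD by blast
  have "\<forall>\<^sub>F x in at_right 0. eval_fps (fps_shift n C) x = 0"
    using eq nh[OF eventually_conv_radius[OF F]] nh[OF eventually_conv_radius[OF G]]
      nh[OF eventually_conv_radius[OF rC]] eventually_at_right_less[of 0]
  proof eventually_elim
    case (elim x)
    have "eval_fps (fps_shift n C) x = eval_fps C x / x ^ n"
      using elim by (subst eval_fps_shift) (auto simp: n_def)
    also have "eval_fps C x = 0" unfolding C_def using elim by (subst eval_fps_diff) auto
    finally show ?case by simp
  qed
  hence "(eval_fps (fps_shift n C) \<longlongrightarrow> 0) (at_right 0)" by (simp add: tendsto_eventually)
  moreover have "(eval_fps (fps_shift n C) \<longlongrightarrow> fps_nth C n) (at_right 0)"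
    using continuous_eval_fps[of 0 "fps_shift n C" "{0<..}"] rC
    by (simp add: continuous_within eval_fps_at_0 zero_ereal_def)
  ultimately show False using C0 tendsto_unique trivial_limit_at_right_real by blast
qed

lemma fps_conv_radius_geI_bound:
  fixes F :: "real fps"
  assumes t: "t > 0" and le: "\<And>n. \<bar>fps_nth F n\<bar> \<le> C * t ^ n"
  shows "fps_conv_radius F \<ge> ereal (1 / t)"
  unfolding fps_conv_radius_def
proof (rule conv_radius_geI_ex')
  fix r :: real assume r: "0 < r" "ereal r < ereal (1 / t)"
  have "summable (\<lambda>n. C * (t * r) ^ n)"
    using r t by (intro summable_mult summable_geometric) (auto simp: field_simps)
  moreover have "norm (fps_nth F n * of_real r ^ n) \<le> C * (t * r) ^ n" for n
    using mult_right_mono[OF le[of n], of "r ^ n"] r by (simp add: abs_mult power_mult_distrib mult_ac)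
  ultimately show "summable (\<lambda>n. fps_nth F n * of_real r ^ n)"
    by (rule summable_comparison_test'[where N = 0])
qed

text \<open>
  The device by which closed forms are identified with power series throughout: compare derivatives on
  \<open>(0, d)\<close> and the limit at \<open>0\<close>.  One-sided information suffices, so \<open>T\<close> may be arbitrary at
  \<open>0\<close> and to its left.
\<close>

lemma eval_fps_antiderivative:
  fixes P :: "real fps" and T :: "real \<Rightarrow> real"
  assumes d: "ereal d \<le> fps_conv_radius P"
    and der: "\<And>x. 0 < x \<Longrightarrow> x < d \<Longrightarrow> (T has_real_derivative eval_fps (fps_deriv P) x) (at x)"
    and lim: "(T \<longlongrightarrow> fps_nth P 0) (at_right 0)"
    and x: "0 < x" "x < d"
  shows "T x = eval_fps P x"
proof -
  have rad: "ereal (norm y) < fps_conv_radius P" if "0 \<le> y" "y < d" for y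
    using that d by (metis ereal_less_eq(3) less_le_trans less_ereal.simps(1) real_norm_def abs_of_nonneg)
  \<comment> \<open>The value of \<open>T\<close> at \<open>0\<close> is arbitrary, so the difference is redefined there.\<close>
  define D where "D = (\<lambda>y. if y = 0 then 0 else T y - eval_fps P y)"
  have lim0: "((\<lambda>y. T y - eval_fps P y) \<longlongrightarrow> fps_nth P 0 - eval_fps P 0) (at_right 0)"
    using continuous_eval_fps[of 0 P "{0<..}"] rad[of 0] x
    by (intro tendsto_diff lim) (auto simp: continuous_within)
  have "D x = D 0"
  proof (rule DERIV_isconst_end[OF x(1)])
    show "(D has_real_derivative 0) (at y)" if "0 < y" "y < x" for y
    proof -
      have "((\<lambda>y. T y - eval_fps P y) has_real_derivative
               eval_fps (fps_deriv P) y - eval_fps (fps_deriv P) y) (at y)"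
        using that x by (intro DERIV_diff der has_field_derivative_eval_fps rad) auto
      moreover have "\<forall>\<^sub>F z in nhds y. D z = T z - eval_fps P z"
        using eventually_nhds_in_open[of "{0<..}" y] that by (fastforce elim!: eventually_mono simp: D_def)
      ultimately show ?thesis by (subst DERIV_cong_ev[OF refl _ refl]) auto
    qed
    show "continuous_on {0..x} D"
      unfolding continuous_on_def
    proof (safe, goal_cases)
      case (1 y)
      show ?case
      proof (cases "y = 0")
        case True
        have "(D \<longlongrightarrow> 0) (at_right 0)"
          by (rule Lim_transform_eventually[of "\<lambda>y. T y - eval_fps P y"])
             (use lim0 in \<open>auto simp: eval_fps_at_0 D_def eventually_at_filter\<close>)
        hence "(D \<longlongrightarrow> 0) (at 0 within {0..x})"
          using x by (simp add: at_within_Icc_at_right)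
        thus ?thesis by (simp add: True D_def)
      next
        case False
        have "isCont (\<lambda>y. T y - eval_fps P y) y"
          using 1 False x by (intro isCont_diff DERIV_isCont[OF der] continuous_eval_fps rad) auto
        moreover have "\<forall>\<^sub>F z in nhds y. T z - eval_fps P z = D z"
          using eventually_nhds_in_open[of "{0<..}" y] 1 False by (fastforce elim!: eventually_mono simp: D_def)
        ultimately have "isCont D y" by (simp add: isCont_cong)
        thus ?thesis using isContD Lim_at_imp_Lim_at_within by blast
      qed
    qed
  qed
  thus ?thesis using x by (simp add: D_def)
qed

section \<open>The binomial series of the square root\<close>

definition sqrt_coef :: "nat \<Rightarrow> real" where
  "sqrt_coef n = (-1) ^ n * ((1 / 2) gchoose n)"

lemma sqrt_coef_0 [simp]: "sqrt_coef 0 = 1"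
  by (simp add: sqrt_coef_def)

lemma sqrt_coef_Suc: "sqrt_coef (Suc n) = sqrt_coef n * (real n - 1 / 2) / (real n + 1)"
proof -
  from gbinomial_mult_1[of "1/2 :: real" n]
  have *: "((1 / 2 :: real) gchoose Suc n) = ((1 / 2) gchoose n) * (1 / 2 - real n) / (real n + 1)"
    by (simp add: field_simps)
  show ?thesis unfolding sqrt_coef_def * by (simp add: field_simps)
qed

text \<open>
  The partial sums have a closed form because they are, up to sign, the binomial coefficients of
  exponent \<open>-1/2\<close>.  Since all coefficients but the constant one are nonpositive, this bounds the sum of
  their absolute values, which makes the binomial series converge uniformly up to its singularity.
\<close>

lemma sum_sqrt_coef: "(\<Sum>k\<le>n. sqrt_coef k) = (1 - 2 * real n) * sqrt_coef n"
proof (induction n)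
  case (Suc n)
  have "(1 - 2 * x) * c + c * (x - 1 / 2) / (x + 1) = (1 - 2 * (x + 1)) * (c * (x - 1 / 2) / (x + 1))"
    if "x \<ge> 0" for x c :: real
    using that by (simp add: divide_simps) (simp add: algebra_simps)
  from this[of "real n" "sqrt_coef n"] Suc show ?case
    by (simp add: sqrt_coef_Suc add_ac)
qed simp

lemma sqrt_coef_nonpos: "sqrt_coef (Suc n) \<le> 0"
proof (induction n)
  case (Suc n)
  thus ?case
    by (subst sqrt_coef_Suc) (auto intro!: divide_nonpos_pos mult_nonpos_nonneg)
qed (simp add: sqrt_coef_Suc)

lemma sum_abs_sqrt_coef_le: "(\<Sum>k\<le>n. \<bar>sqrt_coef k\<bar>) \<le> 2"
proof -
  have "(\<Sum>k\<le>n. \<bar>sqrt_coef k\<bar>) = 2 - (\<Sum>k\<le>n. sqrt_coef k)"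
    by (induction n) (use sqrt_coef_nonpos in \<open>auto simp: abs_of_nonpos\<close>)
  moreover have "(\<Sum>k\<le>n. sqrt_coef k) \<ge> 0"
    unfolding sum_sqrt_coef
    by (cases n) (use sqrt_coef_nonpos in \<open>auto intro!: mult_nonpos_nonpos\<close>)
  ultimately show ?thesis by simp
qed

lemma summable_abs_sqrt_coef: "summable (\<lambda>k. \<bar>sqrt_coef k\<bar>)"
proof (rule summableI_nonneg_bounded)
  fix n
  show "(\<Sum>k<n. \<bar>sqrt_coef k\<bar>) \<le> 2"
    using sum_abs_sqrt_coef_le[of n] by (simp add: lessThan_Suc_atMost[symmetric])
qed auto

lemma abs_sqrt_coef_le: "\<bar>sqrt_coef n\<bar> \<le> 2"
  using sum_abs_sqrt_coef_le[of n] member_le_sum[of n "{..n}" "\<lambda>k. \<bar>sqrt_coef k\<bar>"] by simp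

lemma Abel_limit_summable:
  fixes a :: "nat \<Rightarrow> real"
  assumes "summable (\<lambda>n. \<bar>a n\<bar>)"
  shows "((\<lambda>t. \<Sum>n. a n * t ^ n) \<longlongrightarrow> (\<Sum>n. a n)) (at_left 1)"
proof -
  have "uniform_limit {0..1} (\<lambda>n t. \<Sum>i<n. a i * t ^ i) (\<lambda>t. \<Sum>i. a i * t ^ i) sequentially"
  proof (rule Weierstrass_m_test[OF _ assms])
    fix n and t :: real assume "t \<in> {0..1}"
    thus "norm (a n * t ^ n) \<le> \<bar>a n\<bar>"
      by (auto simp: abs_mult power_le_one mult_left_le)
  qed
  hence "continuous_on {0..1} (\<lambda>t. \<Sum>i. a i * t ^ i)"
    by (rule uniform_limit_theorem[rotated]) (auto intro!: continuous_intros always_eventually)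
  hence "((\<lambda>t. \<Sum>n. a n * t ^ n) \<longlongrightarrow> (\<Sum>n. a n * 1 ^ n)) (at 1 within {0..1})"
    unfolding continuous_on_def by (rule bspec) simp
  thus ?thesis by (simp add: at_within_Icc_at_left)
qed

lemma sqrt_series_lt_1:
  assumes "\<bar>t\<bar> < (1::real)"
  shows "(\<lambda>k. sqrt_coef k * t ^ k) sums sqrt (1 - t)"
proof -
  have "(\<lambda>k. ((1 / 2) gchoose k) * (- t) ^ k) sums (1 + (- t)) powr (1 / 2)"
    by (rule gen_binomial_real) (use assms in simp)
  also have "(\<lambda>k. ((1 / 2) gchoose k) * (- t) ^ k) = (\<lambda>k. sqrt_coef k * t ^ k)"
    by (simp add: sqrt_coef_def fun_eq_iff power_minus[of t])
  finally show ?thesis using assms by (simp add: powr_half_sqrt)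
qed

text \<open>
  The value of \<open>sqrt (1 - t)\<close> at \<open>t = 1\<close>, by Abel summation.
\<close>

lemma suminf_sqrt_coef: "(\<Sum>k. sqrt_coef k) = 0"
proof -
  have "\<forall>\<^sub>F t in at_left 1. sqrt (1 - t) = (\<Sum>k. sqrt_coef k * t ^ k)"
    using eventually_at_left_real[of 0 "1::real"]
    by (auto elim!: eventually_mono simp: sums_iff dest!: sqrt_series_lt_1[THEN sums_unique, rotated -1])
       (metis abs_of_nonneg less_eq_real_def sqrt_series_lt_1 sums_unique)
  moreover have "((\<lambda>t. sqrt (1 - t)) \<longlongrightarrow> sqrt (1 - 1)) (at_left 1)"
    by (intro tendsto_intros)
  ultimately have "((\<lambda>t. \<Sum>k. sqrt_coef k * t ^ k) \<longlongrightarrow> 0) (at_left 1)"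
    using Lim_transform_eventually by fastforce
  with Abel_limit_summable[OF summable_abs_sqrt_coef] show ?thesis
    using tendsto_unique trivial_limit_at_left_real by blast
qed

lemma sqrt_series:
  assumes "0 \<le> t" "t \<le> (1::real)"
  shows "(\<lambda>k. sqrt_coef k * t ^ k) sums sqrt (1 - t)"
proof (cases "t = 1")
  case True
  thus ?thesis
    using summable_sums[OF summable_rabs_cancel[OF summable_abs_sqrt_coef]] suminf_sqrt_coef by simp
qed (use sqrt_series_lt_1 assms in auto)

text \<open>
  The finite part (the constant term for \<open>X \<rightarrow> \<infinity>\<close>) of \<open>\<integral> sqrt (1 - 1/u) u\<^sup>n du\<close> over
  \<open>[1, X]\<close>.  It is the contribution of the endpoint \<open>x = s\<close> to the coefficient of \<open>s\<^bsup>n+1\<^esup>\<close>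
  in the action.
\<close>

fun edge_const :: "nat \<Rightarrow> real" where
  "edge_const 0 = - (1 / 2 + ln 2)"
| "edge_const (Suc n) =
     ((real n + 1 / 2) * edge_const n - sqrt_coef (Suc n) + sqrt_coef (Suc (Suc n))) / (real n + 2)"

text \<open>
  Summing over \<open>k\<close> the constant terms of \<open>sqrt_coef k\<close> times the antiderivative of \<open>u\<^bsup>n-1-k\<^esup>\<close>
  gives the finite part; the term \<open>k = n\<close> produces the logarithm instead and has no constant term.
\<close>

definition edge_term :: "nat \<Rightarrow> nat \<Rightarrow> real" where
  "edge_term n k = (if k = n then 0 else sqrt_coef k / (real k - real n))"

lemma abs_edge_term_le: "\<bar>edge_term n k\<bar> \<le> \<bar>sqrt_coef k\<bar>"
proof (cases "k = n")
  case False
  hence "\<bar>real k - real n\<bar> \<ge> 1" by linarith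
  hence "\<bar>sqrt_coef k\<bar> / \<bar>real k - real n\<bar> \<le> \<bar>sqrt_coef k\<bar> / 1"
    by (intro divide_left_mono) auto
  thus ?thesis using False by (simp add: edge_term_def)
qed (simp add: edge_term_def)

lemma summable_abs_edge_term: "summable (\<lambda>k. \<bar>edge_term n k\<bar>)"
  using summable_abs_sqrt_coef by (rule summable_comparison_test'[where N = 0]) (use abs_edge_term_le in auto)

lemma summable_edge_term: "summable (edge_term n)"
  using summable_abs_edge_term by (rule summable_rabs_cancel)

text \<open>
  After removing the term \<open>k = 0\<close>, the sum is the value at \<open>t = 1\<close> of a primitive of
  \<open>(sqrt (1 - t) - 1 + t/2) / t\<^sup>2\<close>, which is elementary in \<open>sqrt (1 - t)\<close>; this is where \<open>ln 2\<close> comes from.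
\<close>

lemma edge_const_0_aux: "(\<Sum>k. edge_term 1 k) = - (1 / 2 + ln 2)"
proof -
  define a where "a = (\<lambda>k. if k = 0 then 0 else sqrt_coef (Suc k) / real k)"
  have a_eq: "a k = edge_term 1 (Suc k)" for k
    by (simp add: a_def edge_term_def)
  have sa: "summable (\<lambda>k. \<bar>a k\<bar>)"
    unfolding a_eq by (subst summable_Suc_iff) (rule summable_abs_edge_term)
  define P where "P = Abs_fps a"
  define T where "T = (\<lambda>t::real. 1 / (1 + sqrt (1 - t)) + ln (1 + sqrt (1 - t)) - 1 / 2 - ln 2)"
  have rad: "1 \<le> fps_conv_radius P"
  proof -
    have "\<bar>a n\<bar> \<le> 2 * 1 ^ n" for n
      using abs_edge_term_le[of 1 "Suc n"] abs_sqrt_coef_le[of "Suc n"] by (simp add: a_eq)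
    thus ?thesis using fps_conv_radius_geI_bound[of 1 P 2] by (simp add: P_def one_ereal_def)
  qed
  have eq: "T t = eval_fps P t" if t: "0 < t" "t < 1" for t
  proof (rule eval_fps_antiderivative[where d = 1])
    show "ereal 1 \<le> fps_conv_radius P" using rad by (simp add: one_ereal_def)
    show "(T \<longlongrightarrow> fps_nth P 0) (at_right 0)"
    proof -
      have "(T \<longlongrightarrow> T 0) (at_right 0)" unfolding T_def
        by (intro tendsto_intros) auto
      thus ?thesis by (simp add: T_def P_def a_def)
    qed
    show "(T has_real_derivative eval_fps (fps_deriv P) x) (at x)" if x: "0 < x" "x < 1" for x
    proof -
      define v where "v = sqrt (1 - x)"
      have v: "v > 0" "v < 1" "x = 1 - v ^ 2" using x by (auto simp: v_def)
      have "(\<lambda>k. sqrt_coef k * x ^ k) sums v"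
        using sqrt_series_lt_1[of x] x by (simp add: v_def)
      hence "(\<lambda>k. sqrt_coef (k + 2) * x ^ (k + 2)) sums (v - (\<Sum>k<2. sqrt_coef k * x ^ k))"
        by (rule sums_split_initial_segment)
      hence "(\<lambda>k. sqrt_coef (k + 2) * x ^ (k + 2) / x ^ 2) sums ((v - (\<Sum>k<2. sqrt_coef k * x ^ k)) / x ^ 2)"
        by (rule sums_divide)
      moreover have "(\<lambda>k. sqrt_coef (k + 2) * x ^ (k + 2) / x ^ 2) = (\<lambda>k. fps_nth (fps_deriv P) k * x ^ k)"
        using x by (auto simp: fun_eq_iff P_def a_def power_add numeral_2_eq_2)
      ultimately have "eval_fps (fps_deriv P) x = (v - 1 + x / 2) / x ^ 2"
        by (simp add: eval_fps_def sums_iff numeral_2_eq_2 sqrt_coef_Suc)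
      also have "\<dots> = - 1 / (2 * (1 + v) ^ 2)"
      proof -
        have "x ^ 2 = (1 - v) ^ 2 * (1 + v) ^ 2" unfolding v(3) by (simp add: power2_eq_square algebra_simps)
        moreover have "v - 1 + x / 2 = - ((1 - v) ^ 2) / 2" unfolding v(3) by (simp add: power2_eq_square field_simps)
        ultimately show ?thesis using v by (simp add: divide_simps)
      qed
      finally have "eval_fps (fps_deriv P) x = - 1 / (2 * (1 + v) ^ 2)" .
      moreover have "(T has_real_derivative - 1 / (2 * (1 + v) ^ 2)) (at x)"
      proof -
        have "((\<lambda>t. sqrt (1 - t)) has_real_derivative - 1 / (2 * v)) (at x)"
          using x by (auto intro!: derivative_eq_intros simp: v_def divide_simps)
        moreover have "((\<lambda>u. 1 / (1 + u) + ln (1 + u) - 1 / 2 - ln 2) has_real_derivative v / (1 + v) ^ 2)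
                         (at (sqrt (1 - x)))"
        proof -
          have "((\<lambda>u. 1 / (1 + u) + ln (1 + u) - 1 / 2 - ln 2) has_real_derivative
                   - 1 / (1 + v) ^ 2 + 1 / (1 + v)) (at v)"
            using v(1) by (auto intro!: derivative_eq_intros simp: power2_eq_square)
          moreover have "- 1 / (1 + v) ^ 2 + 1 / (1 + v) = v / (1 + v) ^ 2"
            using v(1) by (simp add: divide_simps power2_eq_square)
          ultimately show ?thesis by (simp only: v_def)
        qed
        ultimately have "(T has_real_derivative v / (1 + v) ^ 2 * (- 1 / (2 * v))) (at x)"
          unfolding T_def by (rule DERIV_chain2[rotated])
        moreover have "v / (1 + v) ^ 2 * (- 1 / (2 * v)) = - 1 / (2 * (1 + v) ^ 2)"
          using v(1) by simp
        ultimately show ?thesis by (simp only:)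
      qed
      ultimately show ?thesis by simp
    qed
  qed (use t in auto)
  have "\<forall>\<^sub>F t in at_left 1. T t = (\<Sum>k. a k * t ^ k)"
    using eventually_at_left_real[of 0 "1::real"]
    by (auto elim!: eventually_mono simp: eq) (simp add: eval_fps_def P_def)
  moreover have "(T \<longlongrightarrow> T 1) (at_left 1)"
    unfolding T_def by (intro tendsto_intros) auto
  ultimately have "((\<lambda>t. \<Sum>k. a k * t ^ k) \<longlongrightarrow> T 1) (at_left 1)"
    by (rule Lim_transform_eventually[rotated])
  hence "(\<Sum>k. a k) = T 1"
    using Abel_limit_summable[OF sa] tendsto_unique trivial_limit_at_left_real by blast
  moreover have "(\<Sum>k. edge_term 1 k) = edge_term 1 0 + (\<Sum>k. a k)"
    unfolding a_eq using suminf_split_head[OF summable_edge_term, of 1] by simp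
  ultimately show ?thesis by (simp add: T_def edge_term_def)
qed

text \<open>
  The recurrence follows from \<open>(k + 1) b\<^bsub>k+1\<^esub> = (k - 1/2) b\<^sub>k\<close> for the coefficients
  \<open>b\<^sub>k\<close> of the square root, after an index shift; the sums \<open>\<Sum> b\<^sub>k\<close> that appear on the way vanish.
\<close>

lemma edge_const_eq: "edge_const n = (\<Sum>k. edge_term (Suc n) k)"
proof (induction n)
  case 0
  thus ?case using edge_const_0_aux by simp
next
  case (Suc n)
  let ?m = "Suc n"
  \<comment> \<open>The conditional summand corrects the term where the denominator on the left vanishes.\<close>
  have step: "real (Suc ?m) * edge_term (Suc ?m) (Suc k)
       = (sqrt_coef k + (real ?m - 1 / 2) * edge_term ?m k - sqrt_coef (Suc k))
          + (if k = ?m then sqrt_coef (Suc ?m) - sqrt_coef ?m else 0)" for k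
  proof (cases "k = ?m")
    case False
    define x y b c where "x = real k" "y = real ?m" "b = sqrt_coef k" "c = sqrt_coef (Suc k)"
    have "c * (x + 1) = b * (x - 1 / 2)"
      by (simp add: x_y_b_c_def sqrt_coef_Suc)
    moreover have "x \<noteq> y" using False by (simp add: x_y_b_c_def del: of_nat_Suc)
    ultimately have "(y + 1) * c = (b - c) * (x - y) + (y - 1 / 2) * b" "x - y \<noteq> 0"
      by (simp_all add: algebra_simps)
    hence "(y + 1) * (c / (x - y)) = b + (y - 1 / 2) * (b / (x - y)) - c"
      by (simp add: add_divide_distrib)
    thus ?thesis using False unfolding x_y_b_c_def edge_term_def by (simp add: algebra_simps)
  qed (simp add: edge_term_def)
  have sb: "sqrt_coef sums 0"
    using summable_sums[OF summable_rabs_cancel[OF summable_abs_sqrt_coef]] suminf_sqrt_coef by simp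
  have sb': "(\<lambda>k. sqrt_coef (Suc k)) sums - 1"
    using sb by (subst sums_Suc_iff) simp
  have se: "edge_term ?m sums edge_const n"
    using Suc summable_sums[OF summable_edge_term, of ?m] by simp
  have "(\<lambda>k. real (Suc ?m) * edge_term (Suc ?m) (Suc k)) sums
      ((0 + (real ?m - 1 / 2) * edge_const n - (- 1)) + (sqrt_coef (Suc ?m) - sqrt_coef ?m))"
    unfolding step using sums_single[of ?m "\<lambda>_. sqrt_coef (Suc ?m) - sqrt_coef ?m"]
    by (intro sums_add sums_diff sums_mult sb sb' se) auto
  moreover have "(\<lambda>k. real (Suc ?m) * edge_term (Suc ?m) (Suc k)) sums
      (real (Suc ?m) * ((\<Sum>k. edge_term (Suc ?m) k) - edge_term (Suc ?m) 0))"
    using summable_sums[OF summable_edge_term, of "Suc ?m"] by (intro sums_mult) (simp add: sums_Suc_iff)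
  ultimately have "real (Suc ?m) * ((\<Sum>k. edge_term (Suc ?m) k) - edge_term (Suc ?m) 0)
     = ((0 + (real ?m - 1 / 2) * edge_const n - (- 1)) + (sqrt_coef (Suc ?m) - sqrt_coef ?m))"
    by (metis sums_unique2)
  moreover have "real (Suc ?m) * edge_term (Suc ?m) 0 = -1"
    by (simp add: edge_term_def field_simps)
  ultimately have "(\<Sum>k. edge_term (Suc ?m) k) = edge_const ?m"
    by (simp add: field_simps)
  thus ?case by simp
qed

section \<open>The coefficient sequences\<close>

text \<open>
  The Taylor coefficients of \<open>1 / sqrt (1 - \<kappa>x - x\<^sup>2)\<close>.  The recursion is the differential equation
  \<open>(1 - \<kappa>x - x\<^sup>2) f' = (\<kappa>/2 + x) f\<close>.
\<close>

fun inv_sqrt_coef :: "real \<Rightarrow> nat \<Rightarrow> real" where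
  "inv_sqrt_coef \<kappa> 0 = 1"
| "inv_sqrt_coef \<kappa> (Suc 0) = \<kappa> / 2"
| "inv_sqrt_coef \<kappa> (Suc (Suc n)) =
     ((real n + 3 / 2) * \<kappa> * inv_sqrt_coef \<kappa> (Suc n) + (real n + 1) * inv_sqrt_coef \<kappa> n) / (real n + 2)"

definition radicand :: "real \<Rightarrow> real \<Rightarrow> real" where
  "radicand \<kappa> x = 1 - \<kappa> * x - x\<^sup>2"

definition radicand_fps :: "real \<Rightarrow> real fps" where
  "radicand_fps \<kappa> = 1 - fps_const \<kappa> * fps_X - fps_X\<^sup>2"

definition inv_sqrt_fps :: "real \<Rightarrow> real fps" where
  "inv_sqrt_fps \<kappa> = Abs_fps (inv_sqrt_coef \<kappa>)"

text \<open>
  The Taylor series of \<open>sqrt (1 - \<kappa>x - x\<^sup>2)\<close>, as the radicand divided by its root.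
\<close>

definition root_fps :: "real \<Rightarrow> real fps" where
  "root_fps \<kappa> = radicand_fps \<kappa> * inv_sqrt_fps \<kappa>"

lemma radicand_fps_nth: "fps_nth (radicand_fps \<kappa> * F) n =
    fps_nth F n - \<kappa> * (if n = 0 then 0 else fps_nth F (n - 1)) - (if n < 2 then 0 else fps_nth F (n - 2))"
proof -
  have "radicand_fps \<kappa> * F = F - fps_const \<kappa> * (fps_X * F) - fps_X ^ 2 * F"
    by (simp add: radicand_fps_def algebra_simps)
  thus ?thesis by (simp add: fps_X_power_mult_nth)
qed

lemma inv_sqrt_coef_rec:
  "real (Suc n) * inv_sqrt_coef \<kappa> (Suc n) =
     (real n + 1 / 2) * \<kappa> * inv_sqrt_coef \<kappa> n + (if n = 0 then 0 else real n * inv_sqrt_coef \<kappa> (n - 1))"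
  by (cases n) (auto simp: field_simps)

lemma fps_of_real_radicand_fps:
  "fps_of_real (radicand_fps \<kappa>) = 1 - fps_const (of_real \<kappa>) * fps_X - fps_X\<^sup>2"
  by (auto simp: radicand_fps_def fps_eq_iff fps_X_power_iff fps_one_nth)

lemma root_fps_nth: "fps_nth (root_fps \<kappa>) n =
    inv_sqrt_coef \<kappa> n - \<kappa> * (if n = 0 then 0 else inv_sqrt_coef \<kappa> (n - 1))
      - (if n < 2 then 0 else inv_sqrt_coef \<kappa> (n - 2))"
  unfolding root_fps_def radicand_fps_nth by (simp add: inv_sqrt_fps_def)

text \<open>
  Differentiating \<open>F\<^sup>2 Q = 1\<close> and cancelling \<open>F\<close> gives the differential equation
  \<open>2 F' Q + F Q' = 0\<close>, which is the recursion of the coefficients.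
\<close>

lemma fps_solution_inv_sqrt:
  fixes F :: "complex fps"
  assumes F0: "fps_nth F 0 = 1" and FQ: "F\<^sup>2 * fps_of_real (radicand_fps \<kappa>) = 1"
  shows "F = fps_of_real (inv_sqrt_fps \<kappa>)"
proof -
  define Q where "Q = fps_of_real (radicand_fps \<kappa>)"
  have Q: "Q = 1 - fps_const (of_real \<kappa>) * fps_X - fps_X\<^sup>2"
    by (simp add: Q_def fps_of_real_radicand_fps)
  have "F * (2 * (fps_deriv F * Q) + F * fps_deriv Q) = fps_deriv (F\<^sup>2 * Q)"
    by (simp add: power2_eq_square algebra_simps)
  also have "\<dots> = 0" using FQ by (simp add: Q_def)
  finally have "2 * (fps_deriv F * Q) + F * fps_deriv Q = 0"
    using F0 by auto
  hence ode: "2 * (fps_deriv F - fps_const (of_real \<kappa>) * (fps_X * fps_deriv F) - fps_X * (fps_X * fps_deriv F))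
     = fps_const (of_real \<kappa>) * F + 2 * (fps_X * F)"
    by (simp add: Q power2_eq_square algebra_simps flip: fps_const_neg)
  have rec: "of_nat (Suc n) * fps_nth F (Suc n) = (of_nat n + 1 / 2) * of_real \<kappa> * fps_nth F n
          + (if n = 0 then 0 else of_nat n * fps_nth F (n - 1))" for n
  proof -
    have "fps_nth (fps_const 2 * (fps_deriv F - fps_const (of_real \<kappa>) * (fps_X * fps_deriv F)
               - fps_X * (fps_X * fps_deriv F))) n
        = fps_nth (fps_const (of_real \<kappa>) * F + fps_const 2 * (fps_X * F)) n"
      using ode by (simp only: fps_numeral_fps_const)
    hence *: "2 * (fps_nth (fps_deriv F) n - of_real \<kappa> * fps_nth (fps_X * fps_deriv F) n
                  - fps_nth (fps_X * (fps_X * fps_deriv F)) n)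
        = of_real \<kappa> * fps_nth F n + 2 * fps_nth (fps_X * F) n"
      by (simp only: fps_mult_left_const_nth fps_sub_nth fps_add_nth)
    have "2 * (of_nat (Suc n) * fps_nth F (Suc n)) = 2 * ((of_nat n + 1 / 2) * of_real \<kappa> * fps_nth F n
          + (if n = 0 then 0 else of_nat n * fps_nth F (n - 1)))"
    proof (cases n)
      case 0
      thus ?thesis using * by (simp add: algebra_simps)
    next
      case (Suc m)
      thus ?thesis using * by (cases m) (simp_all add: algebra_simps)
    qed
    thus ?thesis by (simp only: mult_cancel_left) simp
  qed
  have "fps_nth F n = of_real (inv_sqrt_coef \<kappa> n)" for n
  proof (induction n rule: less_induct)
    case (less n)
    show ?case
    proof (cases n)
      case (Suc m)
      have "of_nat (Suc m) * fps_nth F (Suc m) = of_real ((real m + 1 / 2) * \<kappa> * inv_sqrt_coef \<kappa> m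
              + (if m = 0 then 0 else real m * inv_sqrt_coef \<kappa> (m - 1)))"
        unfolding rec using less.IH[of m] less.IH[of "m - 1"] Suc by simp
      also have "\<dots> = of_real (real (Suc m) * inv_sqrt_coef \<kappa> (Suc m))"
        by (simp only: inv_sqrt_coef_rec)
      also have "\<dots> = of_nat (Suc m) * of_real (inv_sqrt_coef \<kappa> (Suc m))"
        by (simp only: of_real_mult of_real_of_nat_eq)
      finally show ?thesis using Suc by (simp del: of_nat_Suc)
    qed (simp add: F0)
  qed
  thus ?thesis by (simp add: fps_eq_iff inv_sqrt_fps_def)
qed

lemma has_fps_expansion_inv_csqrt:
  "(\<lambda>z. 1 / csqrt (1 - of_real \<kappa> * z - z\<^sup>2)) has_fps_expansion fps_of_real (inv_sqrt_fps \<kappa>)"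
proof -
  let ?\<phi> = "\<lambda>z. 1 / csqrt (1 - of_real \<kappa> * z - z\<^sup>2)"
  let ?q = "\<lambda>z. 1 - of_real \<kappa> * z - z\<^sup>2 :: complex"
  define S where "S = {z. Re (?q z) > 0}"
  have S: "open S" "0 \<in> S"
    unfolding S_def by (auto intro!: open_Collect_less continuous_intros)
  have nz: "?q z \<notin> \<real>\<^sub>\<le>\<^sub>0" if "z \<in> S" for z
    using that by (auto simp: S_def complex_nonpos_Reals_iff)
  have nz': "?q z \<noteq> 0" if "z \<in> S" for z
    using nz[OF that] by (metis nonpos_Reals_zero_I)
  have "?\<phi> holomorphic_on S"
    by (intro holomorphic_intros) (use nz nz' in auto)
  hence \<phi>: "?\<phi> has_fps_expansion fps_expansion ?\<phi> 0" (is "_ has_fps_expansion ?F")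
    using S by blast
  have "?q has_fps_expansion fps_of_real (radicand_fps \<kappa>)"
    unfolding fps_of_real_radicand_fps by (intro fps_expansion_intros)
  hence 1: "(\<lambda>z. ?\<phi> z * ?\<phi> z * ?q z) has_fps_expansion ?F * ?F * fps_of_real (radicand_fps \<kappa>)"
    by (intro has_fps_expansion_mult \<phi>)
  have 2: "\<forall>\<^sub>F z in nhds 0. ?\<phi> z * ?\<phi> z * ?q z = 1"
    using eventually_nhds_in_open[OF S]
  proof eventually_elim
    case (elim z)
    have "csqrt (?q z) * csqrt (?q z) = ?q z" by (metis power2_csqrt power2_eq_square)
    thus ?case using nz'[OF elim] by simp
  qed
  have "(\<lambda>_. 1) has_fps_expansion ?F * ?F * fps_of_real (radicand_fps \<kappa>)"
    by (rule iffD1[OF has_fps_expansion_cong[OF 2 refl] 1])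
  hence "?F * ?F * fps_of_real (radicand_fps \<kappa>) = 1"
    using fps_expansion_unique_complex has_fps_expansion_1 by blast
  moreover have "fps_nth ?F 0 = 1"
    using \<phi> eventually_nhds_x_imp_x by (fastforce simp: has_fps_expansion_def eval_fps_at_0)
  ultimately have "?F = fps_of_real (inv_sqrt_fps \<kappa>)"
    by (intro fps_solution_inv_sqrt) (simp_all add: power2_eq_square)
  with \<phi> show ?thesis by simp
qed

lemma eventually_radicand_pos: "\<forall>\<^sub>F x in nhds 0. radicand \<kappa> x > 0"
proof -
  have "open {x. radicand \<kappa> x > 0}"
    unfolding radicand_def by (intro open_Collect_less continuous_intros)
  from eventually_nhds_in_open[OF this, of 0] show ?thesis by (simp add: radicand_def)
qed

lemma inv_sqrt_radicand_has_fps_expansion: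
  "(\<lambda>x. 1 / sqrt (radicand \<kappa> x)) has_fps_expansion inv_sqrt_fps \<kappa>"
proof -
  have rad: "fps_conv_radius (inv_sqrt_fps \<kappa>) > 0"
    using has_fps_expansion_inv_csqrt[of \<kappa>] by (simp add: has_fps_expansion_def)
  have "\<forall>\<^sub>F x in nhds 0. eval_fps (fps_of_real (inv_sqrt_fps \<kappa>)) (of_real x) =
           1 / csqrt (1 - of_real \<kappa> * of_real x - (of_real x)\<^sup>2)"
    using has_fps_expansion_inv_csqrt[of \<kappa>] eventually_compose_filterlim[OF _ tendsto_of_real_nhds_0]
    by (fastforce simp: has_fps_expansion_def)
  with eventually_radicand_pos[of \<kappa>] eventually_conv_radius[OF rad]
  have "\<forall>\<^sub>F x in nhds 0. eval_fps (inv_sqrt_fps \<kappa>) x = 1 / sqrt (radicand \<kappa> x)"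
  proof eventually_elim
    case (elim x)
    have "complex_of_real (eval_fps (inv_sqrt_fps \<kappa>) x) = 1 / csqrt (of_real (radicand \<kappa> x))"
      using elim by (simp add: eval_fps_of_real radicand_def)
    also have "\<dots> = of_real (1 / sqrt (radicand \<kappa> x))"
      using elim by (simp add: csqrt_of_real_nonneg)
    finally show ?case by (simp only: of_real_eq_iff)
  qed
  with rad show ?thesis by (simp add: has_fps_expansion_def)
qed

text \<open>
  The finite part for \<open>s \<rightarrow> 0\<close> of the moment \<open>\<integral> x\<^bsup>-(n+1)\<^esup> / sqrt (1 - \<kappa>x - x\<^sup>2) dx\<close> over
  \<open>[s, 1/\<rho>]\<close>.  The initial value is the only place where the upper endpoint enters, and it enters through
  \<open>\<rho> + 1/\<rho> = sqrt (\<kappa>\<^sup>2 + 4)\<close>, which is even in \<open>\<kappa>\<close>.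
\<close>

fun reg_moment :: "real \<Rightarrow> nat \<Rightarrow> real" where
  "reg_moment \<kappa> 0 = ln (4 / sqrt (\<kappa>\<^sup>2 + 4))"
| "reg_moment \<kappa> (Suc 0) = \<kappa> / 2 * reg_moment \<kappa> 0 + fps_nth (root_fps \<kappa>) 1"
| "reg_moment \<kappa> (Suc (Suc n)) =
     ((real n + 3 / 2) * \<kappa> * reg_moment \<kappa> (Suc n) + (real n + 1) * reg_moment \<kappa> n
        + fps_nth (root_fps \<kappa>) (Suc (Suc n))) / (real n + 2)"

lemma reg_moment_rec:
  "real (Suc n) * reg_moment \<kappa> (Suc n) =
     (real n + 1 / 2) * \<kappa> * reg_moment \<kappa> n + (if n = 0 then 0 else real n * reg_moment \<kappa> (n - 1))
       + fps_nth (root_fps \<kappa>) (Suc n)"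
  by (cases n) (auto simp: field_simps)

text \<open>
  The nonlogarithmic part of \<open>s\<^sup>k\<close> times the moment of order \<open>k + 1\<close>.  Off the diagonal its
  coefficients come from integrating the Taylor series of \<open>1 / sqrt (1 - \<kappa>x - x\<^sup>2)\<close> term by term; at
  \<open>n = k\<close> that integration yields the logarithm, and the constant of integration takes its place.
\<close>

definition moment_fps :: "real \<Rightarrow> nat \<Rightarrow> real fps" where
  "moment_fps \<kappa> k =
     Abs_fps (\<lambda>n. if n = k then reg_moment \<kappa> k else inv_sqrt_coef \<kappa> n / (real k - real n))"

text \<open>
  The power series form of the recurrence of the moments.  At \<open>k = 0\<close> the truncated index \<open>k - 1\<close> is
  harmless because its factor vanishes, and this is what keeps the moment of order \<open>0\<close> out of the
  recursion.
\<close>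

lemma moment_fps_rec:
  "fps_const (real (Suc k)) * moment_fps \<kappa> (Suc k) =
     fps_const ((real k + 1 / 2) * \<kappa>) * (fps_X * moment_fps \<kappa> k)
       + fps_const (real k) * (fps_X\<^sup>2 * moment_fps \<kappa> (k - 1)) + root_fps \<kappa>"
proof (rule fps_ext)
  fix n
  let ?f = "inv_sqrt_coef \<kappa>"
  show "fps_nth (fps_const (real (Suc k)) * moment_fps \<kappa> (Suc k)) n =
     fps_nth (fps_const ((real k + 1 / 2) * \<kappa>) * (fps_X * moment_fps \<kappa> k)
       + fps_const (real k) * (fps_X\<^sup>2 * moment_fps \<kappa> (k - 1)) + root_fps \<kappa>) n"
  proof (cases "n = Suc k")
    case True
    thus ?thesis
      using reg_moment_rec[of k \<kappa>]
      by (cases k) (auto simp: moment_fps_def fps_X_power_mult_nth)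
  next
    case False
    define d where "d = real (Suc k) - real n"
    have d: "d \<noteq> 0" using False by (auto simp: d_def)
    define a b where "a = (if n = 0 then 0 else ?f (n - 1))" and "b = (if n < 2 then 0 else ?f (n - 2))"
    have root: "fps_nth (root_fps \<kappa>) n = ?f n - \<kappa> * a - b"
      unfolding root_fps_nth by (simp add: a_def b_def)
    have 1: "fps_nth (fps_X * moment_fps \<kappa> k) n = a / d"
      using False by (cases n) (auto simp: moment_fps_def a_def d_def)
    have 2: "real k * fps_nth (fps_X\<^sup>2 * moment_fps \<kappa> (k - 1)) n = real k * b / d"
      using False by (cases k) (auto simp: moment_fps_def b_def d_def fps_X_power_mult_nth of_nat_diff)
    have 3: "real n * ?f n = (real n - 1 / 2) * \<kappa> * a + (real n - 1) * b"
    proof (cases n)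
      case (Suc m)
      thus ?thesis using inv_sqrt_coef_rec[of m \<kappa>] by (cases m) (auto simp: a_def b_def algebra_simps)
    qed (simp add: a_def b_def)
    have "real (Suc k) * ?f n = (real k + 1 / 2) * \<kappa> * a + real k * b + d * (?f n - \<kappa> * a - b)"
      using 3 by (simp add: d_def algebra_simps)
    hence "(real (Suc k) * ?f n) / d
        = ((real k + 1 / 2) * \<kappa> * a + real k * b + d * (?f n - \<kappa> * a - b)) / d" by (rule arg_cong)
    hence "real (Suc k) * (?f n / d) = (real k + 1 / 2) * \<kappa> * (a / d) + real k * b / d + (?f n - \<kappa> * a - b)"
      using d by (simp add: add_divide_distrib del: of_nat_Suc)
    moreover have "fps_nth (moment_fps \<kappa> (Suc k)) n = ?f n / d"
      using False by (simp add: moment_fps_def d_def)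
    ultimately show ?thesis
      by (simp only: fps_mult_left_const_nth fps_add_nth 1 2 root)
  qed
qed

lemma abs_inv_sqrt_coef_le: "\<bar>inv_sqrt_coef \<kappa> n\<bar> \<le> (\<bar>\<kappa>\<bar> + 1) ^ n"
proof (induction n rule: less_induct)
  case (less n)
  let ?f = "inv_sqrt_coef \<kappa>" and ?u = "\<bar>\<kappa>\<bar> + 1"
  consider "n = 0" | "n = 1" | m where "n = Suc (Suc m)" by (metis One_nat_def not0_implies_Suc)
  thus ?case
  proof cases
    case 3
    have "?f n = (real m + 3 / 2) / (real m + 2) * (\<kappa> * ?f (Suc m)) + (real m + 1) / (real m + 2) * ?f m"
    proof -
      have "(a * k * x + b * y) / c = a / c * (k * x) + b / c * y" for a k x b y c :: real
        by (simp add: add_divide_distrib)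
      thus ?thesis unfolding 3 inv_sqrt_coef.simps .
    qed
    also have "\<bar>\<dots>\<bar> \<le> (real m + 3 / 2) / (real m + 2) * (\<bar>\<kappa>\<bar> * \<bar>?f (Suc m)\<bar>) + (real m + 1) / (real m + 2) * \<bar>?f m\<bar>"
      by (rule order_trans[OF abs_triangle_ineq]) (simp add: abs_mult)
    also have "\<dots> \<le> 1 * (\<bar>\<kappa>\<bar> * ?u ^ Suc m) + 1 * ?u ^ m"
      by (intro add_mono mult_mono less.IH) (auto simp: 3)
    also have "\<dots> \<le> \<bar>\<kappa>\<bar> * ?u ^ Suc m + ?u ^ Suc m"
      using power_increasing[of m "Suc m" ?u] by simp
    also have "\<dots> = ?u ^ n" by (simp add: 3 algebra_simps)
    finally show ?thesis .
  qed auto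
qed

text \<open>
  A common geometric rate for all coefficient sequences, so that one radius of convergence serves all of
  them uniformly in \<open>k\<close>.  The sequences satisfy recurrences bounded by
  \<open>a\<^bsub>n+2\<^esub> \<le> |\<kappa>| a\<^bsub>n+1\<^esub> + a\<^sub>n\<close> plus an inhomogeneity growing like \<open>(|\<kappa>| + 1)\<^sup>n\<close>; the summand \<open>3\<close> pays for
  the last two terms.
\<close>

definition growth :: "real \<Rightarrow> real" where "growth \<kappa> = \<bar>\<kappa>\<bar> + 3"

text \<open>
  Large enough for the initial value, and for the inhomogeneity with its factor \<open>3 (|\<kappa>| + 1)\<close> to be
  absorbed in the induction step.
\<close>

definition growth_bound :: "real \<Rightarrow> real" where
  "growth_bound \<kappa> = \<bar>reg_moment \<kappa> 0\<bar> + 3 * (\<bar>\<kappa>\<bar> + 1)"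

lemma growth_ge: "growth \<kappa> \<ge> 3" and growth_bound_ge: "growth_bound \<kappa> \<ge> 3"
  by (auto simp: growth_def growth_bound_def)

lemma abs_inv_sqrt_coef_le_growth: "\<bar>inv_sqrt_coef \<kappa> n\<bar> \<le> growth \<kappa> ^ n"
  using abs_inv_sqrt_coef_le[of \<kappa> n] power_mono[of "\<bar>\<kappa>\<bar> + 1" "growth \<kappa>" n] by (simp add: growth_def)

lemma abs_root_nth_le: "\<bar>fps_nth (root_fps \<kappa>) n\<bar> \<le> 3 * (\<bar>\<kappa>\<bar> + 1) ^ n"
proof -
  let ?f = "inv_sqrt_coef \<kappa>" and ?u = "\<bar>\<kappa>\<bar> + 1"
  have "\<bar>\<kappa>\<bar> * \<bar>if n = 0 then 0 else ?f (n - 1)\<bar> \<le> ?u ^ n"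
  proof (cases n)
    case (Suc m)
    have "\<bar>\<kappa>\<bar> * \<bar>?f m\<bar> \<le> ?u * ?u ^ m"
      by (intro mult_mono abs_inv_sqrt_coef_le) auto
    thus ?thesis by (simp add: Suc)
  qed auto
  moreover have "\<bar>if n < 2 then 0 else ?f (n - 2)\<bar> \<le> ?u ^ n"
    using abs_inv_sqrt_coef_le[of \<kappa> "n - 2"] power_increasing[of "n - 2" n ?u] by auto
  moreover have "\<bar>a - \<kappa> * b - c\<bar> \<le> \<bar>a\<bar> + \<bar>\<kappa>\<bar> * \<bar>b\<bar> + \<bar>c\<bar>" for a b c :: real
    using abs_triangle_ineq4[of "a - \<kappa> * b" c] abs_triangle_ineq4[of a "\<kappa> * b"] by (simp add: abs_mult)
  ultimately show ?thesis using abs_inv_sqrt_coef_le[of \<kappa> n]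
    unfolding root_fps_nth by (smt (verit))
qed

lemma abs_reg_moment_le: "\<bar>reg_moment \<kappa> n\<bar> \<le> growth_bound \<kappa> * growth \<kappa> ^ n"
proof (induction n rule: less_induct)
  case (less n)
  let ?m = "reg_moment \<kappa>" and ?u = "\<bar>\<kappa>\<bar> + 1" and ?C = "growth_bound \<kappa>" and ?t = "growth \<kappa>"
  let ?g = "fps_nth (root_fps \<kappa>)"
  have C: "?C \<ge> 3 * ?u" "?C \<ge> \<bar>?m 0\<bar>" by (auto simp: growth_bound_def)
  consider "n = 0" | "n = 1" | m where "n = Suc (Suc m)" by (metis One_nat_def not0_implies_Suc)
  thus ?case
  proof cases
    case 1
    thus ?thesis using C by simp
  next
    case 2
    have "?g 1 = - \<kappa> / 2" by (simp add: root_fps_nth)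
    hence "\<bar>?m 1\<bar> \<le> \<bar>\<kappa>\<bar> * \<bar>?m 0\<bar> + \<bar>\<kappa>\<bar>"
      using abs_triangle_ineq[of "\<kappa> / 2 * ?m 0" "- \<kappa> / 2"] by (simp add: abs_mult del: reg_moment.simps(1))
    also have "\<dots> \<le> \<bar>\<kappa>\<bar> * ?C + 1 * ?C"
      using C by (intro add_mono mult_left_mono) auto
    also have "\<dots> \<le> ?t * ?C" using growth_bound_ge[of \<kappa>] by (simp add: growth_def algebra_simps)
    finally show ?thesis using 2 by (simp add: mult_ac)
  next
    case 3
    let ?N = "real m + 2"
    have "?m n = (real m + 3 / 2) / ?N * (\<kappa> * ?m (Suc m)) + (real m + 1) / ?N * ?m m + 1 / ?N * ?g n"
    proof -
      have "(a * k * x + b * y + g) / c = a / c * (k * x) + b / c * y + 1 / c * g" for a k x b y c g :: real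
        by (simp add: add_divide_distrib)
      thus ?thesis unfolding 3 reg_moment.simps .
    qed
    also have "\<bar>\<dots>\<bar> \<le> (real m + 3 / 2) / ?N * (\<bar>\<kappa>\<bar> * \<bar>?m (Suc m)\<bar>) + (real m + 1) / ?N * \<bar>?m m\<bar> + 1 / ?N * \<bar>?g n\<bar>"
      by (intro order_trans[OF abs_triangle_ineq] add_mono) (simp_all add: abs_mult)
    also have "\<dots> \<le> 1 * (\<bar>\<kappa>\<bar> * (?C * ?t ^ Suc m)) + 1 * (?C * ?t ^ m) + 1 * (3 * ?u ^ n)"
      using growth_ge[of \<kappa>] growth_bound_ge[of \<kappa>]
      by (intro add_mono mult_mono abs_root_nth_le less.IH) (auto simp: 3 intro!: mult_nonneg_nonneg)
    also have "\<dots> \<le> \<bar>\<kappa>\<bar> * (?C * ?t ^ Suc m) + ?C * ?t ^ Suc m + ?C * ?t ^ Suc m"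
    proof -
      have "?C * ?t ^ m \<le> ?C * ?t ^ Suc m"
        using growth_ge[of \<kappa>] growth_bound_ge[of \<kappa>] power_increasing[of m "Suc m" ?t] by (intro mult_left_mono) auto
      moreover have "3 * ?u ^ n \<le> ?C * ?t ^ Suc m"
      proof -
        have "3 * ?u ^ n = (3 * ?u) * ?u ^ Suc m" by (simp add: 3)
        also have "\<dots> \<le> ?C * ?t ^ Suc m"
          using C by (intro mult_mono power_mono) (auto simp: growth_def)
        finally show ?thesis .
      qed
      ultimately show ?thesis by linarith
    qed
    also have "\<dots> \<le> ?t * (?C * ?t ^ Suc m)"
      using growth_ge[of \<kappa>] growth_bound_ge[of \<kappa>] by (simp add: growth_def distrib_right)
    also have "\<dots> = ?C * ?t ^ n" by (simp add: 3 mult_ac)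
    finally show ?thesis .
  qed
qed

lemma abs_moment_fps_nth_le: "\<bar>fps_nth (moment_fps \<kappa> k) n\<bar> \<le> growth_bound \<kappa> * growth \<kappa> ^ n"
proof (cases "n = k")
  case True
  thus ?thesis using abs_reg_moment_le by (simp add: moment_fps_def)
next
  case False
  hence "\<bar>real k - real n\<bar> \<ge> 1" by linarith
  hence "\<bar>inv_sqrt_coef \<kappa> n\<bar> / \<bar>real k - real n\<bar> \<le> \<bar>inv_sqrt_coef \<kappa> n\<bar> / 1"
    by (intro divide_left_mono) auto
  also have "\<dots> \<le> 1 * growth \<kappa> ^ n" using abs_inv_sqrt_coef_le_growth by simp
  also have "\<dots> \<le> growth_bound \<kappa> * growth \<kappa> ^ n"
    using growth_ge[of \<kappa>] growth_bound_ge[of \<kappa>] by (intro mult_right_mono) auto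
  finally show ?thesis using False by (simp add: moment_fps_def)
qed

lemma fps_conv_radius_moment_fps: "fps_conv_radius (moment_fps \<kappa> k) \<ge> ereal (1 / growth \<kappa>)"
  using growth_ge[of \<kappa>] by (intro fps_conv_radius_geI_bound[where C = "growth_bound \<kappa>"] abs_moment_fps_nth_le) auto

lemma fps_conv_radius_inv_sqrt_fps: "fps_conv_radius (inv_sqrt_fps \<kappa>) \<ge> ereal (1 / growth \<kappa>)"
  using growth_ge[of \<kappa>]
  by (intro fps_conv_radius_geI_bound[where C = 1]) (auto simp: inv_sqrt_fps_def abs_inv_sqrt_coef_le_growth)

text \<open>
  The regular action as a series in \<open>s = 2h\<close>.
\<close>

definition action_fps :: "real \<Rightarrow> real fps" where
  "action_fps \<kappa> = Abs_fps (\<lambda>n. if n = 0 then 0 else - sqrt_coef n * inv_sqrt_coef \<kappa> (n - 1))"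

text \<open>
  The nonlogarithmic part of the singular action at \<open>s = 2h\<close>, apart from its value at \<open>0\<close>.  The coefficient of
  \<open>s\<^sup>n\<close> collects the finite parts at both ends: the diagonal term of the \<open>n\<close>-th moment, and the
  contributions of the endpoint \<open>x = s\<close> from all moments.
\<close>

definition rest_fps :: "real \<Rightarrow> real fps" where
  "rest_fps \<kappa> = Abs_fps (\<lambda>n. if n = 0 then 0 else
     sqrt_coef n * reg_moment \<kappa> (n - 1) + inv_sqrt_coef \<kappa> (n - 1) * edge_const (n - 1))"

lemma abs_edge_const_le: "\<bar>edge_const n\<bar> \<le> 2"
proof -
  have "\<bar>edge_const n\<bar> \<le> (\<Sum>k. \<bar>edge_term (Suc n) k\<bar>)"
    unfolding edge_const_eq by (rule summable_rabs[OF summable_abs_edge_term])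
  also have "\<dots> \<le> (\<Sum>k. \<bar>sqrt_coef k\<bar>)"
    by (rule suminf_le[OF abs_edge_term_le summable_abs_edge_term summable_abs_sqrt_coef])
  also have "\<dots> \<le> 2"
  proof (rule suminf_le_const[OF summable_abs_sqrt_coef])
    show "(\<Sum>k<n. \<bar>sqrt_coef k\<bar>) \<le> 2" for n
      using sum_abs_sqrt_coef_le[of n] by (simp add: lessThan_Suc_atMost[symmetric])
  qed
  finally show ?thesis .
qed

lemma fps_conv_radius_action_fps: "fps_conv_radius (action_fps \<kappa>) \<ge> ereal (1 / growth \<kappa>)"
proof (rule fps_conv_radius_geI_bound)
  fix n
  have "\<bar>inv_sqrt_coef \<kappa> (n - 1)\<bar> \<le> growth \<kappa> ^ n"
    by (rule order_trans[OF abs_inv_sqrt_coef_le_growth power_increasing]) (use growth_ge[of \<kappa>] in auto)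
  hence "\<bar>sqrt_coef n * inv_sqrt_coef \<kappa> (n - 1)\<bar> \<le> 2 * growth \<kappa> ^ n"
    unfolding abs_mult by (intro mult_mono abs_sqrt_coef_le) auto
  thus "\<bar>fps_nth (action_fps \<kappa>) n\<bar> \<le> 2 * growth \<kappa> ^ n"
    using growth_ge[of \<kappa>] by (simp add: action_fps_def)
qed (use growth_ge[of \<kappa>] in auto)

lemma fps_conv_radius_rest_fps: "fps_conv_radius (rest_fps \<kappa>) \<ge> ereal (1 / growth \<kappa>)"
proof (rule fps_conv_radius_geI_bound)
  fix n
  let ?C = "growth_bound \<kappa>" and ?t = "growth \<kappa>"
  have t: "?t ^ (n - 1) \<le> ?t ^ n"
    using power_increasing[of "n - 1" n ?t] growth_ge[of \<kappa>] by auto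
  have "\<bar>sqrt_coef n * reg_moment \<kappa> (n - 1)\<bar> \<le> 2 * (?C * ?t ^ (n - 1))"
    unfolding abs_mult by (intro mult_mono abs_sqrt_coef_le abs_reg_moment_le) auto
  moreover have "\<bar>inv_sqrt_coef \<kappa> (n - 1) * edge_const (n - 1)\<bar> \<le> ?t ^ (n - 1) * 2"
    unfolding abs_mult using growth_ge[of \<kappa>]
    by (intro mult_mono abs_edge_const_le abs_inv_sqrt_coef_le_growth) auto
  moreover have "2 * (?C * ?t ^ (n - 1)) + ?t ^ (n - 1) * 2 \<le> (2 * ?C + 2) * ?t ^ n"
    using mult_left_mono[OF t, of "2 * ?C + 2"] growth_bound_ge[of \<kappa>] by (simp add: algebra_simps)
  moreover have "0 \<le> (2 * ?C + 2) * ?t ^ n"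
    using growth_ge[of \<kappa>] growth_bound_ge[of \<kappa>] by (intro mult_nonneg_nonneg) auto
  ultimately show "\<bar>fps_nth (rest_fps \<kappa>) n\<bar> \<le> (2 * ?C + 2) * ?t ^ n"
    using abs_triangle_ineq[of "sqrt_coef n * reg_moment \<kappa> (n - 1)" "inv_sqrt_coef \<kappa> (n - 1) * edge_const (n - 1)"]
    by (cases "n = 0") (simp_all add: rest_fps_def del: One_nat_def)
qed (use growth_ge[of \<kappa>] in auto)

text \<open>
  Replacing \<open>\<kappa>\<close> by \<open>-\<kappa>\<close> amounts to replacing \<open>x\<close> by \<open>-x\<close> in the radicand.
\<close>

lemma inv_sqrt_coef_uminus: "inv_sqrt_coef (- \<kappa>) n = (-1) ^ n * inv_sqrt_coef \<kappa> n"
  by (induction \<kappa> n rule: inv_sqrt_coef.induct) (simp_all add: algebra_simps)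

lemma root_fps_uminus: "fps_nth (root_fps (- \<kappa>)) n = (-1) ^ n * fps_nth (root_fps \<kappa>) n"
proof -
  consider "n = 0" | "n = 1" | m where "n = Suc (Suc m)" by (metis One_nat_def not0_implies_Suc)
  thus ?thesis
    by cases (simp_all add: root_fps_nth inv_sqrt_coef_uminus algebra_simps del: inv_sqrt_coef.simps(3))
qed

text \<open>
  The recursion respects the parity, and it starts from an even function of \<open>\<kappa>\<close>.
\<close>

lemma reg_moment_uminus: "reg_moment (- \<kappa>) n = (-1) ^ n * reg_moment \<kappa> n"
  by (induction \<kappa> n rule: reg_moment.induct) (simp_all add: root_fps_uminus algebra_simps)

lemma eval_fps_odd_symmetry:
  fixes F G :: "real fps"
  assumes "\<And>n. fps_nth G n = (-1) ^ Suc n * fps_nth F n" and "ereal \<bar>x\<bar> < fps_conv_radius F"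
  shows "eval_fps G (- x) = - eval_fps F x"
proof -
  have "(\<lambda>n. fps_nth F n * x ^ n) sums eval_fps F x"
    using assms by (intro sums_eval_fps) simp
  hence "(\<lambda>n. - (fps_nth F n * x ^ n)) sums - eval_fps F x"
    by (rule sums_minus)
  moreover have "- (fps_nth F n * x ^ n) = fps_nth G n * (- x) ^ n" for n
    by (simp add: assms power_minus[of x])
  ultimately show ?thesis by (simp add: eval_fps_def sums_iff)
qed

lemma action_fps_uminus: "fps_nth (action_fps (- \<kappa>)) n = (-1) ^ Suc n * fps_nth (action_fps \<kappa>) n"
  by (cases n) (simp_all add: action_fps_def inv_sqrt_coef_uminus)

lemma rest_fps_uminus: "fps_nth (rest_fps (- \<kappa>)) n = (-1) ^ Suc n * fps_nth (rest_fps \<kappa>) n"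
  by (cases n) (simp_all add: rest_fps_def inv_sqrt_coef_uminus reg_moment_uminus algebra_simps)

section \<open>Evaluating the moment series\<close>

lemma less_fps_conv_radius_add:
  assumes "ereal (norm x) < fps_conv_radius F" "ereal (norm x) < fps_conv_radius G"
  shows "ereal (norm x) < fps_conv_radius (F + G)"
  using assms fps_conv_radius_add[of F G] by (metis less_le_trans min_less_iff_conj)

lemma less_fps_conv_radius_mult:
  assumes "ereal (norm x) < fps_conv_radius F" "ereal (norm x) < fps_conv_radius G"
  shows "ereal (norm x) < fps_conv_radius (F * G)"
  using assms fps_conv_radius_mult[of F G] by (metis less_le_trans min_less_iff_conj)

lemma eval_radicand_fps: "eval_fps (radicand_fps \<kappa>) x = radicand \<kappa> x"
proof -
  have "radicand_fps \<kappa> = fps_of_poly [:1, - \<kappa>, - 1:]"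
    by (auto simp: radicand_fps_def fps_eq_iff fps_X_power_iff fps_one_nth coeff_pCons split: nat.splits)
  thus ?thesis by (simp add: radicand_def power2_eq_square algebra_simps)
qed

lemma fps_conv_radius_radicand_fps: "fps_conv_radius (radicand_fps \<kappa>) = \<infinity>"
proof -
  have "radicand_fps \<kappa> = fps_of_poly [:1, - \<kappa>, - 1:]"
    by (auto simp: radicand_fps_def fps_eq_iff fps_X_power_iff fps_one_nth coeff_pCons split: nat.splits)
  thus ?thesis by simp
qed

text \<open>
  A radius within which all series converge and the Taylor series of \<open>1 / sqrt (1 - \<kappa>x - x\<^sup>2)\<close> represents
  that function.
\<close>

definition good_radius :: "real \<Rightarrow> real \<Rightarrow> bool" where
  "good_radius \<kappa> d \<longleftrightarrow> 0 < d \<and> d \<le> 1 / growth \<kappa> \<and>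
     (\<forall>x. 0 < x \<longrightarrow> x < d \<longrightarrow> radicand \<kappa> x > 0 \<and> eval_fps (inv_sqrt_fps \<kappa>) x = 1 / sqrt (radicand \<kappa> x))"

lemma good_radius_exists: "\<exists>d. good_radius \<kappa> d"
proof -
  have "\<forall>\<^sub>F x in nhds 0. radicand \<kappa> x > 0 \<and> eval_fps (inv_sqrt_fps \<kappa>) x = 1 / sqrt (radicand \<kappa> x)"
    using eventually_radicand_pos inv_sqrt_radicand_has_fps_expansion[of \<kappa>]
    by (auto simp: has_fps_expansion_def intro: eventually_conj)
  then obtain d where "d > 0" and d: "\<And>x. dist x 0 < d \<Longrightarrow>
      radicand \<kappa> x > 0 \<and> eval_fps (inv_sqrt_fps \<kappa>) x = 1 / sqrt (radicand \<kappa> x)"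
    unfolding eventually_nhds_metric by blast
  have "good_radius \<kappa> (min d (1 / growth \<kappa>))"
    using \<open>d > 0\<close> d growth_ge[of \<kappa>] by (auto simp: good_radius_def)
  thus ?thesis by blast
qed

lemma good_radius_conv:
  assumes "good_radius \<kappa> d" "0 < s" "s < d"
  shows "ereal (norm s) < fps_conv_radius (moment_fps \<kappa> k)"
    and "ereal (norm s) < fps_conv_radius (inv_sqrt_fps \<kappa>)"
    and "ereal (norm s) < fps_conv_radius (action_fps \<kappa>)"
    and "ereal (norm s) < fps_conv_radius (rest_fps \<kappa>)"
proof -
  have "ereal (norm s) < ereal (1 / growth \<kappa>)" using assms by (simp add: good_radius_def)
  thus "ereal (norm s) < fps_conv_radius (moment_fps \<kappa> k)"
    "ereal (norm s) < fps_conv_radius (inv_sqrt_fps \<kappa>)"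
    "ereal (norm s) < fps_conv_radius (action_fps \<kappa>)"
    "ereal (norm s) < fps_conv_radius (rest_fps \<kappa>)"
    using fps_conv_radius_moment_fps fps_conv_radius_inv_sqrt_fps fps_conv_radius_action_fps
      fps_conv_radius_rest_fps less_le_trans by metis+
qed

lemma eval_root_fps:
  assumes "good_radius \<kappa> d" "0 < s" "s < d"
  shows "eval_fps (root_fps \<kappa>) s = sqrt (radicand \<kappa> s)"
proof -
  have "eval_fps (root_fps \<kappa>) s = radicand \<kappa> s * (1 / sqrt (radicand \<kappa> s))"
    using assms good_radius_conv[OF assms]
    by (simp add: root_fps_def eval_fps_mult fps_conv_radius_radicand_fps eval_radicand_fps good_radius_def)
  moreover have "0 \<le> radicand \<kappa> s" using assms by (auto simp: good_radius_def intro: less_imp_le)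
  ultimately show ?thesis by (simp add: real_div_sqrt)
qed

lemma eval_fps_monom_mult:
  fixes F :: "real fps"
  assumes "ereal (norm x) < fps_conv_radius F"
  shows "eval_fps (fps_const c * (fps_X ^ n * F)) x = c * (x ^ n * eval_fps F x)"
proof -
  have "ereal (norm x) < fps_conv_radius (fps_X ^ n * F)"
    by (intro less_fps_conv_radius_mult assms) simp
  thus ?thesis using assms by (simp add: eval_fps_mult)
qed

lemma DERIV_sqrt_radicand:
  assumes "radicand \<kappa> x > 0"
  shows "((\<lambda>x. sqrt (radicand \<kappa> x)) has_real_derivative ((- \<kappa> - 2 * x) / (2 * sqrt (radicand \<kappa> x)))) (at x)"
proof -
  have "(radicand \<kappa> has_real_derivative (- \<kappa> - 2 * x)) (at x)"
    unfolding radicand_def[abs_def] by (auto intro!: derivative_eq_intros)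
  from DERIV_chain2[OF DERIV_real_sqrt[OF assms] this] show ?thesis
    by (simp add: field_simps)
qed

lemma eval_moment_fps_rec:
  assumes "good_radius \<kappa> d" "0 < s" "s < d"
  shows "real (Suc k) * eval_fps (moment_fps \<kappa> (Suc k)) s =
     (real k + 1 / 2) * \<kappa> * (s * eval_fps (moment_fps \<kappa> k) s)
       + real k * (s\<^sup>2 * eval_fps (moment_fps \<kappa> (k - 1)) s) + sqrt (radicand \<kappa> s)"
proof -
  note conv = good_radius_conv[OF assms]
  have root: "ereal (norm s) < fps_conv_radius (root_fps \<kappa>)"
    unfolding root_fps_def
    by (intro less_fps_conv_radius_mult conv) (simp add: fps_conv_radius_radicand_fps)
  note rules = less_fps_conv_radius_mult less_fps_conv_radius_add conv root
  have "eval_fps (fps_const (real (Suc k)) * moment_fps \<kappa> (Suc k)) s =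
     eval_fps (fps_const ((real k + 1 / 2) * \<kappa>) * (fps_X * moment_fps \<kappa> k)
       + fps_const (real k) * (fps_X\<^sup>2 * moment_fps \<kappa> (k - 1)) + root_fps \<kappa>) s"
    by (simp only: moment_fps_rec)
  also have "\<dots> = eval_fps (fps_const ((real k + 1 / 2) * \<kappa>) * (fps_X * moment_fps \<kappa> k)) s
       + eval_fps (fps_const (real k) * (fps_X\<^sup>2 * moment_fps \<kappa> (k - 1))) s + eval_fps (root_fps \<kappa>) s"
    by (subst eval_fps_add, (intro rules; simp), (intro rules; simp), subst eval_fps_add)
       ((intro rules; simp), (intro rules; simp), simp)
  also have "\<dots> = (real k + 1 / 2) * \<kappa> * (s * eval_fps (moment_fps \<kappa> k) s)
       + real k * (s\<^sup>2 * eval_fps (moment_fps \<kappa> (k - 1)) s) + sqrt (radicand \<kappa> s)"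
    using eval_fps_monom_mult[OF conv(1), of _ 1] eval_fps_monom_mult[OF conv(1), of _ 2]
    by (simp add: eval_root_fps[OF assms])
  finally show ?thesis using conv by (simp add: eval_fps_mult)
qed

lemma DERIV_ln_radicand:
  assumes x: "x > 0" and Q: "radicand \<kappa> x > 0"
  shows "((\<lambda>x. ln (2 - \<kappa> * x + 2 * sqrt (radicand \<kappa> x))) has_real_derivative
           (1 - 1 / sqrt (radicand \<kappa> x)) / x) (at x)"
proof -
  define y where "y = sqrt (radicand \<kappa> x)"
  define N where "N = 2 - \<kappa> * x + 2 * y"
  have y: "y > 0" "y * y = 1 - \<kappa> * x - x * x"
    using Q by (auto simp: y_def radicand_def power2_eq_square)
  have N: "N > 0" using y zero_le_square[of x] zero_le_square[of y] unfolding N_def by linarith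
  have "((\<lambda>x. 2 - \<kappa> * x + 2 * sqrt (radicand \<kappa> x)) has_real_derivative
          0 - \<kappa> + 2 * ((- \<kappa> - 2 * x) / (2 * y))) (at x)"
    unfolding y_def
    by (intro DERIV_add DERIV_diff DERIV_const DERIV_cmult_Id DERIV_cmult DERIV_sqrt_radicand Q)
  from DERIV_chain2[OF DERIV_ln this] N
  have "((\<lambda>x. ln (2 - \<kappa> * x + 2 * sqrt (radicand \<kappa> x))) has_real_derivative
          inverse N * (0 - \<kappa> + 2 * ((- \<kappa> - 2 * x) / (2 * y)))) (at x)"
    by (simp add: N_def y_def)
  moreover have "inverse N * (0 - \<kappa> + 2 * ((- \<kappa> - 2 * x) / (2 * y))) = (1 - 1 / y) / x"
  proof -
    have "0 - \<kappa> + 2 * ((- \<kappa> - 2 * x) / (2 * y)) = - (\<kappa> * y + \<kappa> + 2 * x) / y"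
      using y(1) by (simp add: field_simps)
    moreover have "x * (\<kappa> * y + \<kappa> + 2 * x) = (1 - y) * N"
      using y(2) by (simp add: N_def algebra_simps)
    hence "\<kappa> * y + \<kappa> + 2 * x = (1 - y) * N / x" using x by (simp add: field_simps)
    ultimately have "inverse N * (0 - \<kappa> + 2 * ((- \<kappa> - 2 * x) / (2 * y))) = inverse N * (- ((1 - y) * N / x) / y)"
      by (simp only:)
    also have "\<dots> = (1 - 1 / y) / x"
      using N x y(1) by (simp add: field_simps)
    finally show ?thesis .
  qed
  ultimately show ?thesis by (simp add: y_def)
qed

text \<open>
  Both sides are primitives of \<open>(1 - 1 / sqrt (1 - \<kappa>x - x\<^sup>2)) / x\<close>.
\<close>

lemma eval_moment_fps_0:
  assumes d: "good_radius \<kappa> d" "0 < s" "s < d"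
  shows "eval_fps (moment_fps \<kappa> 0) s
    = ln (2 - \<kappa> * s + 2 * sqrt (radicand \<kappa> s)) - ln (sqrt (\<kappa>\<^sup>2 + 4))"
proof -
  define T where "T = (\<lambda>x. ln (2 - \<kappa> * x + 2 * sqrt (radicand \<kappa> x)) - ln (sqrt (\<kappa>\<^sup>2 + 4)))"
  have "T s = eval_fps (moment_fps \<kappa> 0) s"
  proof (rule eval_fps_antiderivative[OF _ _ _ d(2,3)])
    have "ereal d \<le> ereal (1 / growth \<kappa>)" using d by (simp add: good_radius_def)
    thus "ereal d \<le> fps_conv_radius (moment_fps \<kappa> 0)"
      using fps_conv_radius_moment_fps order_trans by blast
    have "(T \<longlongrightarrow> T 0) (at_right 0)"
      unfolding T_def radicand_def by (intro tendsto_intros) auto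
    moreover have "T 0 = fps_nth (moment_fps \<kappa> 0) 0"
    proof -
      have "sqrt (\<kappa>\<^sup>2 + 4) > 0" by (simp add: add_nonneg_pos)
      thus ?thesis by (simp add: T_def radicand_def moment_fps_def ln_div)
    qed
    ultimately show "(T \<longlongrightarrow> fps_nth (moment_fps \<kappa> 0) 0) (at_right 0)" by simp
    fix x assume x: "0 < x" "x < d"
    define y where "y = sqrt (radicand \<kappa> x)"
    have Q: "radicand \<kappa> x > 0" and w: "eval_fps (inv_sqrt_fps \<kappa>) x = 1 / y"
      using d x by (auto simp: good_radius_def y_def)
    have "(T has_real_derivative (1 - 1 / y) / x - 0) (at x)"
      unfolding T_def y_def using x Q by (intro DERIV_diff DERIV_const DERIV_ln_radicand)
    also have "(1 - 1 / y) / x - 0 = - ((1 / y - 1) / x)" by (simp add: diff_divide_distrib)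
    also have "\<dots> = eval_fps (fps_deriv (moment_fps \<kappa> 0)) x"
    proof -
      have "fps_nth (fps_deriv (moment_fps \<kappa> 0)) n * x ^ n = - (inv_sqrt_coef \<kappa> (Suc n) * x ^ Suc n / x)" for n
        using x by (simp add: moment_fps_def divide_simps) (simp add: algebra_simps)
      moreover have "(\<lambda>n. inv_sqrt_coef \<kappa> (Suc n) * x ^ Suc n) sums (1 / y - 1)"
        using sums_eval_fps[OF good_radius_conv(2)[OF d(1) x]] unfolding w
        by (subst sums_Suc_iff) (simp add: inv_sqrt_fps_def)
      hence "(\<lambda>n. - (inv_sqrt_coef \<kappa> (Suc n) * x ^ Suc n / x)) sums (- ((1 / y - 1) / x))"
        by (intro sums_minus sums_divide)
      ultimately show ?thesis by (simp add: eval_fps_def sums_iff)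
    qed
    finally show "(T has_real_derivative eval_fps (fps_deriv (moment_fps \<kappa> 0)) x) (at x)" .
  qed
  thus ?thesis by (simp add: T_def)
qed

section \<open>The moment integrals\<close>

lemma radicand_factor:
  assumes "\<rho> > 0"
  shows "radicand (top_kappa \<rho>) x = (x + \<rho>) * (inverse \<rho> - x)"
  using assms by (simp add: radicand_def top_kappa_def power2_eq_square field_simps)

lemma radicand_pos:
  assumes "\<rho> > 0" "0 < x" "x < inverse \<rho>"
  shows "radicand (top_kappa \<rho>) x > 0"
  using assms by (simp add: radicand_factor)

lemma continuous_on_radicand [continuous_intros]:
  assumes "continuous_on A f" shows "continuous_on A (\<lambda>x. radicand \<kappa> (f x))"
  unfolding radicand_def by (intro continuous_intros assms)

text \<open>
  Up to sign, the primitive behind the moment of order \<open>0\<close>, normalised to vanish at the upper endpoint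
  \<open>1/\<rho>\<close>.
\<close>

lemma DERIV_arctan_sqrt_moebius:
  assumes \<rho>: "\<rho> > 0" and x: "- \<rho> < x" "x < inverse \<rho>"
  shows "((\<lambda>x. 2 * arctan (sqrt ((inverse \<rho> - x) / (x + \<rho>)))) has_real_derivative
           - 1 / sqrt (radicand (top_kappa \<rho>) x)) (at x)"
proof -
  define q where "q = (inverse \<rho> - x) / (x + \<rho>)"
  have q: "q > 0" using x by (simp add: q_def)
  have xr: "x + \<rho> > 0" using x by simp
  have "((\<lambda>x. (inverse \<rho> - x) / (x + \<rho>)) has_real_derivative - (inverse \<rho> + \<rho>) / (x + \<rho>)\<^sup>2) (at x)"
    using xr by (auto intro!: derivative_eq_intros simp: power2_eq_square)
  from DERIV_chain2[OF DERIV_real_sqrt[OF q, unfolded q_def] this]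
  have "((\<lambda>x. sqrt ((inverse \<rho> - x) / (x + \<rho>))) has_real_derivative
          inverse (sqrt q) / 2 * (- (inverse \<rho> + \<rho>) / (x + \<rho>)\<^sup>2)) (at x)"
    by (simp add: q_def)
  from DERIV_cmult[OF DERIV_chain2[OF DERIV_arctan this], of 2]
  have "((\<lambda>x. 2 * arctan (sqrt ((inverse \<rho> - x) / (x + \<rho>)))) has_real_derivative
          2 * (inverse (1 + (sqrt q)\<^sup>2) * (inverse (sqrt q) / 2 * (- (inverse \<rho> + \<rho>) / (x + \<rho>)\<^sup>2)))) (at x)"
    by (simp add: q_def)
  also have "2 * (inverse (1 + (sqrt q)\<^sup>2) * (inverse (sqrt q) / 2 * (- (inverse \<rho> + \<rho>) / (x + \<rho>)\<^sup>2)))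
      = - 1 / ((x + \<rho>) * sqrt q)"
  proof -
    have "1 + q = (inverse \<rho> + \<rho>) / (x + \<rho>)" using xr by (simp add: q_def field_simps)
    hence 1: "1 + (sqrt q)\<^sup>2 = (inverse \<rho> + \<rho>) / (x + \<rho>)" using q by simp
    have 2: "inverse \<rho> + \<rho> > 0" using \<rho> by (simp add: add_pos_pos)
    have "2 * (inverse (c / u) * (inverse r / 2 * (- c / u\<^sup>2))) = - 1 / (u * r)"
      if "c > 0" "u > 0" "r > 0" for c u r :: real
      using that by (simp add: power2_eq_square field_simps)
    from this[OF 2 xr, of "sqrt q"] show ?thesis using q unfolding 1 by simp
  qed
  also have "(x + \<rho>) * sqrt q = sqrt (radicand (top_kappa \<rho>) x)"
  proof -
    have "radicand (top_kappa \<rho>) x = (x + \<rho>)\<^sup>2 * q"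
      using xr by (simp add: radicand_factor[OF \<rho>] q_def power2_eq_square)
    thus ?thesis using xr by (simp add: real_sqrt_mult)
  qed
  finally show ?thesis .
qed

lemma moment_0_has_integral:
  assumes \<rho>: "\<rho> > 0" and s: "0 \<le> s" "s < inverse \<rho>"
  shows "((\<lambda>x. 1 / sqrt (radicand (top_kappa \<rho>) x)) has_integral
           2 * arctan (sqrt ((inverse \<rho> - s) / (s + \<rho>)))) {s..inverse \<rho>}"
proof -
  let ?F = "\<lambda>x. - (2 * arctan (sqrt ((inverse \<rho> - x) / (x + \<rho>))))"
  have "((\<lambda>x. 1 / sqrt (radicand (top_kappa \<rho>) x)) has_integral ?F (inverse \<rho>) - ?F s) {s..inverse \<rho>}"
  proof (rule fundamental_theorem_of_calculus_interior)
    show "continuous_on {s..inverse \<rho>} ?F"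
      using \<rho> s by (intro continuous_intros) auto
    fix x assume x: "x \<in> {s<..<inverse \<rho>}"
    show "(?F has_vector_derivative 1 / sqrt (radicand (top_kappa \<rho>) x)) (at x)"
      using DERIV_minus[OF DERIV_arctan_sqrt_moebius[OF \<rho>, of x]] x s \<rho>
      by (simp add: has_real_derivative_iff_has_vector_derivative)
  qed (use s in auto)
  thus ?thesis by simp
qed

lemma moment_0_expansion:
  assumes \<rho>: "\<rho> > 0" and d: "good_radius (top_kappa \<rho>) d" "d \<le> inverse \<rho>" and s: "0 < s" "s < d"
  shows "2 * arctan (sqrt ((inverse \<rho> - s) / (s + \<rho>)))
    = 2 * arctan (inverse \<rho>) - (\<Sum>n. inv_sqrt_coef (top_kappa \<rho>) n * s ^ Suc n / real (Suc n))"
proof -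
  let ?\<kappa> = "top_kappa \<rho>"
  let ?T = "\<lambda>x. 2 * arctan (sqrt ((inverse \<rho> - x) / (x + \<rho>)))"
  define P where "P = Abs_fps (\<lambda>n. if n = 0 then 2 * arctan (inverse \<rho>)
                                      else - inv_sqrt_coef ?\<kappa> (n - 1) / real n)"
  have dP: "fps_deriv P = - inv_sqrt_fps ?\<kappa>"
    by (simp add: P_def inv_sqrt_fps_def fps_eq_iff del: of_nat_Suc)
  have rad: "fps_conv_radius P \<ge> ereal (1 / growth ?\<kappa>)"
  proof (rule fps_conv_radius_geI_bound[where C = "2 * \<bar>arctan (inverse \<rho>)\<bar> + 1"])
    fix n
    show "\<bar>fps_nth P n\<bar> \<le> (2 * \<bar>arctan (inverse \<rho>)\<bar> + 1) * growth ?\<kappa> ^ n"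
    proof (cases n)
      case (Suc m)
      have "\<bar>inv_sqrt_coef ?\<kappa> m\<bar> / real n \<le> \<bar>inv_sqrt_coef ?\<kappa> m\<bar> / 1"
        unfolding Suc by (intro divide_left_mono) auto
      also have "\<dots> \<le> growth ?\<kappa> ^ m" using abs_inv_sqrt_coef_le_growth by simp
      also have "\<dots> \<le> growth ?\<kappa> ^ n" using growth_ge[of ?\<kappa>] unfolding Suc by (intro power_increasing) auto
      also have "\<dots> \<le> (2 * \<bar>arctan (inverse \<rho>)\<bar> + 1) * growth ?\<kappa> ^ n"
        using growth_ge[of ?\<kappa>] by (simp add: mult_le_cancel_right1)
      finally show ?thesis by (simp add: P_def Suc del: of_nat_Suc)
    qed (simp add: P_def)
  qed (use growth_ge[of ?\<kappa>] in auto)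
  hence radd: "ereal d \<le> fps_conv_radius P"
    using d order_trans[of "ereal d" "ereal (1 / growth ?\<kappa>)"] by (simp add: good_radius_def)
  have "?T s = eval_fps P s"
  proof (rule eval_fps_antiderivative[OF radd _ _ s])
    fix x assume x: "0 < x" "x < d"
    have "eval_fps (fps_deriv P) x = - (1 / sqrt (radicand ?\<kappa> x))"
      unfolding dP using d(1) x good_radius_conv(2)[OF d(1) x] by (simp add: eval_fps_minus good_radius_def)
    thus "(?T has_real_derivative eval_fps (fps_deriv P) x) (at x)"
      using DERIV_arctan_sqrt_moebius[OF \<rho>, of x] x d \<rho> by simp
  next
    have "(?T \<longlongrightarrow> ?T 0) (at_right 0)"
      using \<rho> by (intro tendsto_intros) auto
    moreover have "sqrt (inverse \<rho> / \<rho>) = inverse \<rho>"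
      using \<rho> by (intro real_sqrt_unique) (auto simp: power2_eq_square field_simps)
    ultimately show "(?T \<longlongrightarrow> fps_nth P 0) (at_right 0)" by (simp add: P_def)
  qed
  moreover have "(\<lambda>n. fps_nth P n * s ^ n) sums eval_fps P s"
    using s radd by (intro sums_eval_fps) (metis ereal_less(2) less_ereal.simps(1) less_le_trans norm_of_real real_norm_def abs_of_pos)
  hence "(\<lambda>n. fps_nth P (Suc n) * s ^ Suc n) sums (eval_fps P s - 2 * arctan (inverse \<rho>))"
    by (subst sums_Suc_iff) (simp add: P_def)
  hence "(\<lambda>n. - (fps_nth P (Suc n) * s ^ Suc n)) sums - (eval_fps P s - 2 * arctan (inverse \<rho>))"
    by (rule sums_minus)
  ultimately show ?thesis by (simp add: sums_iff P_def del: of_nat_Suc)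
qed

lemma kappa_sqrt:
  assumes "\<rho> > 0"
  shows "sqrt ((top_kappa \<rho>)\<^sup>2 + 4) = \<rho> + inverse \<rho>"
  using assms by (intro real_sqrt_unique) (auto simp: top_kappa_def power2_eq_square field_simps)

lemma moment_1_has_integral:
  assumes \<rho>: "\<rho> > 0" and s: "0 < s" "s < inverse \<rho>"
  defines "\<kappa> \<equiv> top_kappa \<rho>"
  shows "((\<lambda>x. 1 / sqrt (radicand \<kappa> x) / x) has_integral
           ln (2 - \<kappa> * s + 2 * sqrt (radicand \<kappa> s)) - ln (sqrt (\<kappa>\<^sup>2 + 4)) - ln s) {s..inverse \<rho>}"
proof -
  let ?b = "inverse \<rho>"
  define F where "F = (\<lambda>x. ln x - ln (2 - \<kappa> * x + 2 * sqrt (radicand \<kappa> x)))"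
  have Q0: "radicand \<kappa> x \<ge> 0" if "s \<le> x" "x \<le> ?b" for x
    using that s \<rho> by (simp add: \<kappa>_def radicand_factor)
  have N: "2 - \<kappa> * x + 2 * sqrt (radicand \<kappa> x) > 0" if "s \<le> x" "x \<le> ?b" for x
  proof -
    have "0 \<le> 1 - \<kappa> * x - x\<^sup>2" "0 \<le> sqrt (radicand \<kappa> x)" using Q0[OF that] by (auto simp: radicand_def)
    thus ?thesis using zero_le_power2[of x] by linarith
  qed
  have "((\<lambda>x. 1 / sqrt (radicand \<kappa> x) / x) has_integral F ?b - F s) {s..?b}"
  proof (rule fundamental_theorem_of_calculus_interior)
    show "continuous_on {s..?b} F"
      unfolding F_def using s N by (intro continuous_intros) (auto simp: less_imp_neq[symmetric])
    fix x assume x: "x \<in> {s<..<?b}"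
    define y where "y = sqrt (radicand \<kappa> x)"
    have Q: "radicand \<kappa> x > 0" using x s radicand_pos[OF \<rho>] by (simp add: \<kappa>_def)
    have "(F has_real_derivative 1 / x - (1 - 1 / y) / x) (at x)"
      unfolding F_def y_def using x s Q by (intro DERIV_diff DERIV_ln_divide DERIV_ln_radicand) auto
    also have "1 / x - (1 - 1 / y) / x = 1 / y / x" by (simp add: diff_divide_distrib)
    finally show "(F has_vector_derivative 1 / sqrt (radicand \<kappa> x) / x) (at x)"
      by (simp add: has_real_derivative_iff_has_vector_derivative y_def)
  qed (use s in auto)
  moreover have Fb: "F ?b = - ln (sqrt (\<kappa>\<^sup>2 + 4))"
  proof -
    have "2 - \<kappa> * ?b = ?b * (\<rho> + ?b)" using \<rho> by (simp add: \<kappa>_def top_kappa_def field_simps)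
    hence "F ?b = ln ?b - ln (?b * (\<rho> + ?b))"
      using \<rho> by (simp add: F_def \<kappa>_def radicand_factor)
    also have "ln (?b * (\<rho> + ?b)) = ln ?b + ln (\<rho> + ?b)"
      using \<rho> by (intro ln_mult_pos) (auto simp: add_pos_pos)
    finally show ?thesis using kappa_sqrt[OF \<rho>] by (simp add: \<kappa>_def)
  qed
  have "F ?b - F s = ln (2 - \<kappa> * s + 2 * sqrt (radicand \<kappa> s)) - ln (sqrt (\<kappa>\<^sup>2 + 4)) - ln s"
    unfolding Fb by (simp add: F_def)
  ultimately show ?thesis by (simp only:)
qed

text \<open>
  The integrand is the derivative of \<open>sqrt Q(x) / x\<^bsup>k+1\<^esup>\<close> for \<open>Q(x) = 1 - \<kappa>x - x\<^sup>2\<close>, and \<open>Q\<close>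
  vanishes at \<open>1/\<rho>\<close>.
\<close>

lemma moment_step_has_integral:
  assumes \<rho>: "\<rho> > 0" and s: "0 < s" "s < inverse \<rho>"
  defines "\<kappa> \<equiv> top_kappa \<rho>"
  shows "((\<lambda>x. (real k + 1 / 2) * \<kappa> * (1 / sqrt (radicand \<kappa> x) / x ^ Suc k)
             + real k * (1 / sqrt (radicand \<kappa> x) / x ^ k)
             - real (Suc k) * (1 / sqrt (radicand \<kappa> x) / x ^ Suc (Suc k)))
         has_integral - (sqrt (radicand \<kappa> s) / s ^ Suc k)) {s..inverse \<rho>}"
proof -
  let ?b = "inverse \<rho>"
  let ?F = "\<lambda>x. sqrt (radicand \<kappa> x) / x ^ Suc k"
  let ?f = "\<lambda>x. (real k + 1 / 2) * \<kappa> * (1 / sqrt (radicand \<kappa> x) / x ^ Suc k)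
             + real k * (1 / sqrt (radicand \<kappa> x) / x ^ k)
             - real (Suc k) * (1 / sqrt (radicand \<kappa> x) / x ^ Suc (Suc k))"
  have "(?f has_integral ?F ?b - ?F s) {s..?b}"
  proof (rule fundamental_theorem_of_calculus_interior)
    show "continuous_on {s..?b} ?F"
      using s by (intro continuous_intros) auto
    fix x assume x: "x \<in> {s<..<?b}"
    define y where "y = sqrt (radicand \<kappa> x)"
    have x0: "x > 0" using x s by simp
    have Q: "radicand \<kappa> x > 0" using x s radicand_pos[OF \<rho>] by (simp add: \<kappa>_def)
    have y: "y > 0" "y * y = 1 - \<kappa> * x - x * x" using Q by (auto simp: y_def radicand_def power2_eq_square)
    have "(?F has_real_derivative
       ((- \<kappa> - 2 * x) / (2 * y) * x ^ Suc k - y * (real (Suc k) * x ^ k)) / (x ^ Suc k * x ^ Suc k)) (at x)"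
      using DERIV_divide[OF DERIV_sqrt_radicand[OF Q] DERIV_pow[of "Suc k" x]] x0
      by (simp add: y_def del: of_nat_Suc power_Suc)
    also have "((- \<kappa> - 2 * x) / (2 * y) * x ^ Suc k - y * (real (Suc k) * x ^ k)) / (x ^ Suc k * x ^ Suc k)
       = ?f x"
    proof -
      define p where "p = x ^ k"
      have p: "p > 0" using x0 by (simp add: p_def)
      have "((- \<kappa> - 2 * x) / (2 * y) * (x * p) - y * (K * p)) / (x * p * (x * p))
        = ((- \<kappa> - 2 * x) * x - 2 * K * (y * y)) / (2 * y * x * x * p)" for K
        using x0 y(1) p by (simp add: divide_simps) (simp add: algebra_simps)
      also have "((- \<kappa> - 2 * x) * x - 2 * K * (y * y)) / (2 * y * x * x * p)
        = (K - 1 / 2) * \<kappa> * (1 / y / (x * p)) + (K - 1) * (1 / y / p) - K * (1 / y / (x * (x * p)))" for K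
        unfolding y(2) using x0 y(1) p by (simp add: divide_simps) (simp add: algebra_simps)
      finally show ?thesis by (simp add: p_def y_def)
    qed
    finally show "(?F has_vector_derivative ?f x) (at x)"
      by (simp only: has_real_derivative_iff_has_vector_derivative)
  qed (use s in auto)
  moreover have "?F ?b = 0" using \<rho> by (simp add: \<kappa>_def radicand_factor)
  ultimately show ?thesis by (simp only: diff_0)
qed

text \<open>
  Existence and value of the moments together, by induction along the recurrence: each new
  moment inherits integrability at the singular endpoint \<open>1/\<rho>\<close> from the other terms.
\<close>

lemma moment_has_integral:
  assumes \<rho>: "\<rho> > 0" and d: "good_radius (top_kappa \<rho>) d" "d \<le> inverse \<rho>" and s: "0 < s" "s < d"
  defines "\<kappa> \<equiv> top_kappa \<rho>"
  shows "((\<lambda>x. 1 / sqrt (radicand \<kappa> x) / x ^ Suc k) has_integral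
           (eval_fps (moment_fps \<kappa> k) s - inv_sqrt_coef \<kappa> k * s ^ k * ln s) / s ^ k) {s..inverse \<rho>}"
proof (induction k rule: less_induct)
  case (less k)
  let ?V = "\<lambda>k. (eval_fps (moment_fps \<kappa> k) s - inv_sqrt_coef \<kappa> k * s ^ k * ln s) / s ^ k"
  have sb: "s < inverse \<rho>" using s d by simp
  show ?case
  proof (cases k)
    case 0
    thus ?thesis
      using moment_1_has_integral[OF \<rho> s(1) sb] eval_moment_fps_0[OF d(1) s] by (simp add: \<kappa>_def)
  next
    case (Suc j)
    let ?D = "\<lambda>x. (real j + 1 / 2) * \<kappa> * (1 / sqrt (radicand \<kappa> x) / x ^ Suc j)
             + real j * (1 / sqrt (radicand \<kappa> x) / x ^ j)
             - real (Suc j) * (1 / sqrt (radicand \<kappa> x) / x ^ Suc (Suc j))"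
    have D: "(?D has_integral - (sqrt (radicand \<kappa> s) / s ^ Suc j)) {s..inverse \<rho>}"
      using moment_step_has_integral[OF \<rho> s(1) sb] by (simp only: \<kappa>_def)
    have 1: "((\<lambda>x. (real j + 1 / 2) * \<kappa> * (1 / sqrt (radicand \<kappa> x) / x ^ Suc j)) has_integral
               (real j + 1 / 2) * \<kappa> * ?V j) {s..inverse \<rho>}"
      by (intro has_integral_mult_right less.IH) (simp add: Suc)
    have 2: "((\<lambda>x. real j * (1 / sqrt (radicand \<kappa> x) / x ^ j)) has_integral real j * ?V (j - 1)) {s..inverse \<rho>}"
    proof (cases j)
      case (Suc i)
      thus ?thesis using less.IH[of i] \<open>k = Suc j\<close> by (simp only: Suc diff_Suc_1 has_integral_mult_right)
    qed simp
    have "((\<lambda>x. inverse (real (Suc j)) * ((real j + 1 / 2) * \<kappa> * (1 / sqrt (radicand \<kappa> x) / x ^ Suc j)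
             + real j * (1 / sqrt (radicand \<kappa> x) / x ^ j) - ?D x)) has_integral
            inverse (real (Suc j)) * ((real j + 1 / 2) * \<kappa> * ?V j + real j * ?V (j - 1)
               - (- (sqrt (radicand \<kappa> s) / s ^ Suc j)))) {s..inverse \<rho>}"
      by (intro has_integral_mult_right has_integral_diff has_integral_add 1 2 D)
    also have "(\<lambda>x. inverse (real (Suc j)) * ((real j + 1 / 2) * \<kappa> * (1 / sqrt (radicand \<kappa> x) / x ^ Suc j)
             + real j * (1 / sqrt (radicand \<kappa> x) / x ^ j) - ?D x))
        = (\<lambda>x. 1 / sqrt (radicand \<kappa> x) / x ^ Suc k)"
      by (simp add: Suc fun_eq_iff del: of_nat_Suc power_Suc)
    also have "inverse (real (Suc j)) * ((real j + 1 / 2) * \<kappa> * ?V j + real j * ?V (j - 1)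
               - (- (sqrt (radicand \<kappa> s) / s ^ Suc j))) = ?V k"
    proof -
      have f: "real (Suc j) * inv_sqrt_coef \<kappa> (Suc j) =
         (real j + 1 / 2) * \<kappa> * inv_sqrt_coef \<kappa> j + real j * inv_sqrt_coef \<kappa> (j - 1)"
        using inv_sqrt_coef_rec[of j \<kappa>] by (cases j) auto
      have pj: "real j * (a / s ^ (j - 1)) = real j * (a * s\<^sup>2 / s ^ Suc j)" for a
        using s by (cases j) (auto simp: power2_eq_square)
      have "(real j + 1 / 2) * \<kappa> * ?V j + real j * ?V (j - 1) + sqrt (radicand \<kappa> s) / s ^ Suc j
        = ((real j + 1 / 2) * \<kappa> * (s * (eval_fps (moment_fps \<kappa> j) s - inv_sqrt_coef \<kappa> j * s ^ j * ln s))
           + real j * ((eval_fps (moment_fps \<kappa> (j - 1)) s - inv_sqrt_coef \<kappa> (j - 1) * s ^ (j - 1) * ln s) * s\<^sup>2)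
           + sqrt (radicand \<kappa> s)) / s ^ Suc j"
        unfolding pj using s by (simp add: add_divide_distrib)
      also have "\<dots> = (real (Suc j) * eval_fps (moment_fps \<kappa> (Suc j)) s
            - ((real j + 1 / 2) * \<kappa> * inv_sqrt_coef \<kappa> j * s ^ Suc j
               + real j * inv_sqrt_coef \<kappa> (j - 1) * (s ^ (j - 1) * s\<^sup>2)) * ln s) / s ^ Suc j"
        unfolding eval_moment_fps_rec[OF d(1)[folded \<kappa>_def] s] by (simp add: algebra_simps)
      also have "real j * inv_sqrt_coef \<kappa> (j - 1) * (s ^ (j - 1) * s\<^sup>2) = real j * inv_sqrt_coef \<kappa> (j - 1) * s ^ Suc j"
        by (cases j) (auto simp: power2_eq_square)
      also have "(real j + 1 / 2) * \<kappa> * inv_sqrt_coef \<kappa> j * s ^ Suc j + real j * inv_sqrt_coef \<kappa> (j - 1) * s ^ Suc j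
          = real (Suc j) * inv_sqrt_coef \<kappa> (Suc j) * s ^ Suc j"
        unfolding f by (simp add: algebra_simps)
      also have "(real (Suc j) * eval_fps (moment_fps \<kappa> (Suc j)) s
          - real (Suc j) * inv_sqrt_coef \<kappa> (Suc j) * s ^ Suc j * ln s) / s ^ Suc j = real (Suc j) * ?V (Suc j)"
        by (simp add: algebra_simps del: of_nat_Suc)
      finally have "(real j + 1 / 2) * \<kappa> * ?V j + real j * ?V (j - 1) + sqrt (radicand \<kappa> s) / s ^ Suc j
          = real (Suc j) * ?V (Suc j)" .
      hence "(real j + 1 / 2) * \<kappa> * ?V j + real j * ?V (j - 1) - (- (sqrt (radicand \<kappa> s) / s ^ Suc j))
          = real (Suc j) * ?V (Suc j)" by linarith
      thus ?thesis unfolding Suc by (simp del: of_nat_Suc)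
    qed
    finally show ?thesis .
  qed
qed

section \<open>Expansion of the singular action\<close>

lemma infsum_eq_suminf_real:
  fixes f :: "nat \<Rightarrow> real"
  assumes "summable (\<lambda>n. \<bar>f n\<bar>)"
  shows "infsum f UNIV = suminf f"
  using norm_summable_imp_has_sum[of f "suminf f"] assms summable_rabs_cancel[OF assms]
  by (simp add: infsumI summable_sums)

lemma suminf_swap_dominated:
  fixes a :: "nat \<Rightarrow> nat \<Rightarrow> real"
  assumes u: "summable u" and v: "summable v"
    and le: "\<And>k n. \<bar>a k n\<bar> \<le> u k * v n" and v0: "\<And>n. 0 \<le> v n"
  shows "(\<Sum>k. \<Sum>n. a k n) = (\<Sum>n. \<Sum>k. a k n)" and "summable (\<lambda>k. \<Sum>n. a k n)"
proof -
  have row: "summable (\<lambda>n. \<bar>a k n\<bar>)" for k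
    by (rule summable_comparison_test'[OF summable_mult[OF v, of "u k"], where N = 0]) (simp add: le)
  have col: "summable (\<lambda>k. \<bar>a k n\<bar>)" for n
    by (rule summable_comparison_test'[OF summable_mult2[OF u, of "v n"], where N = 0]) (simp add: le)
  have row_le: "(\<Sum>n. \<bar>a k n\<bar>) \<le> u k * suminf v" for k
    using suminf_le[OF le row summable_mult[OF v], of "k"] suminf_mult[OF v, of "u k"] by simp
  have rows: "summable (\<lambda>k. \<Sum>n. \<bar>a k n\<bar>)"
    by (rule summable_comparison_test'[OF summable_mult2[OF u, of "suminf v"], where N = 0])
       (simp add: row_le suminf_nonneg[OF row])
  have rows': "summable (\<lambda>k. \<bar>\<Sum>n. a k n\<bar>)"
    by (rule summable_comparison_test'[OF rows, where N = 0]) (simp add: summable_rabs[OF row])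
  thus "summable (\<lambda>k. \<Sum>n. a k n)" by (rule summable_rabs_cancel)
  have "(\<lambda>z. norm ((\<lambda>(k, n). a k n) z)) summable_on (UNIV \<times> UNIV)"
    using row rows suminf_nonneg[OF row]
    by (subst Infinite_Sum.abs_summable_on_Sigma_iff) (simp add: summable_on_UNIV_nonneg_real_iff infsum_eq_suminf_real)
  hence summ: "(\<lambda>(k, n). a k n) summable_on (UNIV \<times> UNIV)"
    by (rule Infinite_Sum.abs_summable_summable)
  have "(\<Sum>k. \<Sum>n. a k n) = infsum (\<lambda>k. infsum (a k) UNIV) UNIV"
    using rows' by (simp add: infsum_eq_suminf_real row)
  also have "\<dots> = infsum (\<lambda>n. infsum (\<lambda>k. a k n) UNIV) UNIV"
    by (rule infsum_swap_banach[OF summ])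
  also have "\<dots> = (\<Sum>n. \<Sum>k. a k n)"
  proof -
    have cl: "(\<Sum>k. \<bar>a k n\<bar>) \<le> suminf u * v n" for n
      using suminf_le[OF le col summable_mult2[OF u], of n] suminf_mult2[OF u, of "v n"] by simp
    have "summable (\<lambda>n. \<bar>\<Sum>k. a k n\<bar>)"
    proof (rule summable_comparison_test'[OF summable_mult[OF v, of "suminf u"], where N = 0])
      show "norm \<bar>\<Sum>k. a k n\<bar> \<le> suminf u * v n" for n
        using order_trans[OF summable_rabs[OF col] cl] by simp
    qed
    thus ?thesis by (simp add: infsum_eq_suminf_real col)
  qed
  finally show "(\<Sum>k. \<Sum>n. a k n) = (\<Sum>n. \<Sum>k. a k n)" .
qed

lemma action_fps_nth:
  "fps_nth (action_fps \<kappa>) 0 = 0"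
  "fps_nth (action_fps \<kappa>) (Suc n) = - sqrt_coef (Suc n) * inv_sqrt_coef \<kappa> n"
  by (simp_all add: action_fps_def)

lemma rest_fps_nth:
  "fps_nth (rest_fps \<kappa>) 0 = 0"
  "fps_nth (rest_fps \<kappa>) (Suc n) = sqrt_coef (Suc n) * reg_moment \<kappa> n + inv_sqrt_coef \<kappa> n * edge_const n"
  by (simp_all add: rest_fps_def)

lemma sums_Suc_of_nth_0:
  fixes F :: "real fps"
  assumes "ereal (norm s) < fps_conv_radius F" "fps_nth F 0 = 0"
  shows "(\<lambda>n. fps_nth F (Suc n) * s ^ Suc n) sums eval_fps F s"
  using sums_eval_fps[OF assms(1)] by (subst sums_Suc_iff) (simp add: assms(2))

text \<open>
  Exchanging the two summations groups the contributions of all moments by powers of \<open>s\<close>.  The last sum is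
  the term \<open>k = 0\<close> missing from the finite parts at \<open>x = s\<close>; it cancels against the expansion of the
  moment of order \<open>0\<close>.
\<close>

lemma sum_moments:
  assumes d: "good_radius \<kappa> d" and s: "0 < s" "s < d"
  shows "summable (\<lambda>k. sqrt_coef (Suc k) * eval_fps (moment_fps \<kappa> k) s)"
    and "s * (\<Sum>k. sqrt_coef (Suc k) * eval_fps (moment_fps \<kappa> k) s)
       = eval_fps (rest_fps \<kappa>) s + (\<Sum>n. inv_sqrt_coef \<kappa> n * s ^ Suc n / real (Suc n))"
proof -
  let ?f = "inv_sqrt_coef \<kappa>" and ?t = "growth \<kappa>" and ?C = "growth_bound \<kappa>"
  \<comment> \<open>Dominated by a product of a summable sequence in \<open>k\<close> and a geometric one in \<open>n\<close>.\<close>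
  define a where "a = (\<lambda>k n. sqrt_coef (Suc k) * (fps_nth (moment_fps \<kappa> k) n * s ^ n))"
  have ts: "0 \<le> ?t * s" "?t * s < 1"
  proof -
    have "s < 1 / ?t" using s d by (simp add: good_radius_def)
    thus "?t * s < 1" using growth_ge[of \<kappa>] by (simp add: field_simps)
  qed (use s growth_ge[of \<kappa>] in simp)
  have u: "summable (\<lambda>k. \<bar>sqrt_coef (Suc k)\<bar>)"
    using summable_abs_sqrt_coef by (subst summable_Suc_iff)
  have v: "summable (\<lambda>n. ?C * (?t * s) ^ n)"
    using ts by (intro summable_mult summable_geometric) auto
  have le: "\<bar>a k n\<bar> \<le> \<bar>sqrt_coef (Suc k)\<bar> * (?C * (?t * s) ^ n)" for k n
  proof -
    have "\<bar>fps_nth (moment_fps \<kappa> k) n\<bar> * s ^ n \<le> ?C * ?t ^ n * s ^ n"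
      using s by (intro mult_right_mono abs_moment_fps_nth_le) auto
    thus ?thesis using s
      unfolding a_def abs_mult by (intro mult_left_mono) (simp_all add: power_mult_distrib mult_ac)
  qed
  have v0: "0 \<le> ?C * (?t * s) ^ n" for n
    using ts growth_bound_ge[of \<kappa>] by (intro mult_nonneg_nonneg) auto
  note swap = suminf_swap_dominated[OF u v le v0]
  have row: "(\<Sum>n. a k n) = sqrt_coef (Suc k) * eval_fps (moment_fps \<kappa> k) s" for k
    unfolding a_def eval_fps_def
    by (rule suminf_mult[OF summable_fps]) (rule good_radius_conv(1)[OF d s])
  show "summable (\<lambda>k. sqrt_coef (Suc k) * eval_fps (moment_fps \<kappa> k) s)"
    using swap(2) by (simp only: row)
  have col: "(\<Sum>k. a k n) = (sqrt_coef (Suc n) * reg_moment \<kappa> n + ?f n * edge_const n) * s ^ n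
                + ?f n * s ^ n / real (Suc n)" for n
  proof -
    have a_eq: "a k n = ?f n * s ^ n * edge_term (Suc n) (Suc k)
        + (if k = n then sqrt_coef (Suc n) * reg_moment \<kappa> n * s ^ n else 0)" for k
      by (simp add: a_def moment_fps_def edge_term_def)
    have "(\<lambda>k. edge_term (Suc n) (Suc k)) sums (edge_const n - edge_term (Suc n) 0)"
      using summable_sums[OF summable_edge_term, of "Suc n"] by (subst sums_Suc_iff) (simp add: edge_const_eq)
    hence "(\<lambda>k. a k n) sums (?f n * s ^ n * (edge_const n - edge_term (Suc n) 0)
              + sqrt_coef (Suc n) * reg_moment \<kappa> n * s ^ n)"
      unfolding a_eq using sums_single[of n "\<lambda>_. sqrt_coef (Suc n) * reg_moment \<kappa> n * s ^ n"]
      by (intro sums_add sums_mult)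
    hence "(\<Sum>k. a k n) = ?f n * s ^ n * (edge_const n - edge_term (Suc n) 0)
              + sqrt_coef (Suc n) * reg_moment \<kappa> n * s ^ n" by (rule sums_unique[symmetric])
    moreover have "edge_term (Suc n) 0 = - (1 / real (Suc n))"
      by (simp add: edge_term_def divide_simps)
    ultimately show ?thesis by (simp add: algebra_simps del: of_nat_Suc)
  qed
  have R: "(\<lambda>n. (sqrt_coef (Suc n) * reg_moment \<kappa> n + ?f n * edge_const n) * s ^ Suc n) sums eval_fps (rest_fps \<kappa>) s"
    using sums_Suc_of_nth_0[OF good_radius_conv(4)[OF d s]] by (simp only: rest_fps_nth)
  have fsum: "summable (\<lambda>n. ?f n * s ^ Suc n / real (Suc n))"
  proof (rule summable_comparison_test'[where N = 0])
    show "summable (\<lambda>n. s * norm (fps_nth (inv_sqrt_fps \<kappa>) n * s ^ n))"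
      by (intro summable_mult norm_summable_fps good_radius_conv(2)[OF d s])
    fix n
    have "\<bar>?f n * s ^ Suc n\<bar> / real (Suc n) \<le> \<bar>?f n * s ^ Suc n\<bar> / 1"
      by (intro divide_left_mono) auto
    thus "norm (?f n * s ^ Suc n / real (Suc n)) \<le> s * norm (fps_nth (inv_sqrt_fps \<kappa>) n * s ^ n)"
      using s by (simp add: inv_sqrt_fps_def abs_mult mult_ac)
  qed
  have "s * (\<Sum>k. sqrt_coef (Suc k) * eval_fps (moment_fps \<kappa> k) s) = s * (\<Sum>n. \<Sum>k. a k n)"
    using swap(1) by (simp only: row)
  also have "(\<lambda>n. (sqrt_coef (Suc n) * reg_moment \<kappa> n + ?f n * edge_const n) * s ^ Suc n
       + ?f n * s ^ Suc n / real (Suc n)) sums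
      (eval_fps (rest_fps \<kappa>) s + (\<Sum>n. ?f n * s ^ Suc n / real (Suc n)))"
    by (intro sums_add R summable_sums fsum)
  hence "(\<lambda>n. ((sqrt_coef (Suc n) * reg_moment \<kappa> n + ?f n * edge_const n) * s ^ Suc n
       + ?f n * s ^ Suc n / real (Suc n)) / s) sums
      ((eval_fps (rest_fps \<kappa>) s + (\<Sum>n. ?f n * s ^ Suc n / real (Suc n))) / s)"
    by (rule sums_divide)
  hence "(\<lambda>n. \<Sum>k. a k n) sums ((eval_fps (rest_fps \<kappa>) s + (\<Sum>n. ?f n * s ^ Suc n / real (Suc n))) / s)"
    using s by (simp add: col add_divide_distrib del: of_nat_Suc)
  hence "s * (\<Sum>n. \<Sum>k. a k n) = eval_fps (rest_fps \<kappa>) s + (\<Sum>n. ?f n * s ^ Suc n / real (Suc n))"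
    using s by (simp add: sums_iff)
  finally show "s * (\<Sum>k. sqrt_coef (Suc k) * eval_fps (moment_fps \<kappa> k) s)
       = eval_fps (rest_fps \<kappa>) s + (\<Sum>n. ?f n * s ^ Suc n / real (Suc n))" .
qed

text \<open>
  Integrate the binomial series of \<open>sqrt (1 - s/x)\<close> term by term.  Its partial sums are bounded by \<open>2\<close> on
  the whole interval, the endpoint \<open>x = s\<close> included, and \<open>1 / sqrt (1 - \<kappa>x - x\<^sup>2)\<close> is integrable, so
  dominated convergence applies.
\<close>

lemma action_integral:
  assumes \<rho>: "\<rho> > 0" and d: "good_radius (top_kappa \<rho>) d" "d \<le> inverse \<rho>" and s: "0 < s" "s < d"
  defines "\<kappa> \<equiv> top_kappa \<rho>"
  shows "integral {s..inverse \<rho>} (\<lambda>x. sqrt ((x - s) / (x * (x + \<rho>) * (inverse \<rho> - x))))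
    = 2 * arctan (inverse \<rho>) + eval_fps (action_fps \<kappa>) s * ln s + eval_fps (rest_fps \<kappa>) s"
proof -
  let ?b = "inverse \<rho>" and ?f = "inv_sqrt_coef \<kappa>"
  have sb: "s < ?b" using s d by simp
  define w where "w = (\<lambda>x. 1 / sqrt (radicand \<kappa> x))"
  define M0 where "M0 = 2 * arctan (sqrt ((?b - s) / (s + \<rho>)))"
  define V where "V = (\<lambda>k. (eval_fps (moment_fps \<kappa> k) s - ?f k * s ^ k * ln s) / s ^ k)"
  \<comment> \<open>At the upper endpoint both the integrand and \<open>w\<close> are \<open>0\<close>, by division by zero.\<close>
  define p where "p = (\<lambda>n x. (\<Sum>k<Suc n. sqrt_coef k * (s / x) ^ k) * w x)"
  have w0: "w x \<ge> 0" if "x \<in> {s..?b}" for x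
    using that s \<rho> by (simp add: w_def \<kappa>_def radicand_factor)
  have M: "(w has_integral M0) {s..?b}"
    using moment_0_has_integral[OF \<rho> less_imp_le[OF s(1)] sb] by (simp add: w_def M0_def \<kappa>_def)
  have p_int: "(p n has_integral M0 + (\<Sum>k<n. sqrt_coef (Suc k) * s ^ Suc k * V k)) {s..?b}" for n
  proof -
    have "((\<lambda>x. w x + (\<Sum>k<n. sqrt_coef (Suc k) * s ^ Suc k * (w x / x ^ Suc k))) has_integral
             M0 + (\<Sum>k<n. sqrt_coef (Suc k) * s ^ Suc k * V k)) {s..?b}"
      using moment_has_integral[OF \<rho> d s] unfolding w_def V_def \<kappa>_def
      by (intro has_integral_add has_integral_sum has_integral_mult_right M[unfolded w_def \<kappa>_def]) auto
    also have "(\<lambda>x. w x + (\<Sum>k<n. sqrt_coef (Suc k) * s ^ Suc k * (w x / x ^ Suc k))) = p n"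
      unfolding p_def sum.lessThan_Suc_shift distrib_right sum_distrib_right
      by (simp add: power_divide mult_ac)
    finally show ?thesis .
  qed
  have w_int: "(\<lambda>x. 2 * w x) integrable_on {s..?b}"
    using has_integral_mult_right[OF M, of 2] by (auto simp: integrable_on_def)
  have p_le: "norm (p n x) \<le> 2 * w x" if x: "x \<in> {s..?b}" for n x
  proof -
    have "\<bar>\<Sum>k<Suc n. sqrt_coef k * (s / x) ^ k\<bar> \<le> (\<Sum>k<Suc n. \<bar>sqrt_coef k\<bar>)"
    proof (rule order_trans[OF sum_abs sum_mono])
      fix k
      have "(s / x) ^ k \<le> 1" using x s by (intro power_le_one) auto
      moreover have "0 \<le> (s / x) ^ k" using x s by (intro zero_le_power) auto
      ultimately show "\<bar>sqrt_coef k * (s / x) ^ k\<bar> \<le> \<bar>sqrt_coef k\<bar>"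
        by (simp add: abs_mult mult_left_le)
    qed
    also have "\<dots> \<le> 2" using sum_abs_sqrt_coef_le[of n] by (simp only: lessThan_Suc_atMost)
    finally have "\<bar>\<Sum>k<Suc n. sqrt_coef k * (s / x) ^ k\<bar> * w x \<le> 2 * w x"
      using w0[OF x] by (rule mult_right_mono)
    thus ?thesis using w0[OF x] by (simp only: p_def real_norm_def abs_mult abs_of_nonneg)
  qed
  have p_lim: "(\<lambda>n. p n x) \<longlonglongrightarrow> sqrt ((x - s) / (x * (x + \<rho>) * (?b - x)))" if x: "x \<in> {s..?b}" for x
  proof -
    have "(\<lambda>k. sqrt_coef k * (s / x) ^ k) sums sqrt (1 - s / x)"
      using x s by (intro sqrt_series) auto
    hence "(\<lambda>n. \<Sum>k<Suc n. sqrt_coef k * (s / x) ^ k) \<longlonglongrightarrow> sqrt (1 - s / x)"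
      unfolding sums_def by (rule LIMSEQ_Suc)
    hence "(\<lambda>n. p n x) \<longlonglongrightarrow> sqrt (1 - s / x) * w x"
      unfolding p_def by (intro tendsto_mult tendsto_const)
    also have "sqrt (1 - s / x) * w x = sqrt ((1 - s / x) * (1 / radicand \<kappa> x))"
      by (simp only: w_def real_sqrt_mult real_sqrt_divide real_sqrt_one)
    also have "(1 - s / x) * (1 / radicand \<kappa> x) = (x - s) / (x * (x + \<rho>) * (?b - x))"
      using x s \<rho> unfolding \<kappa>_def radicand_factor[OF \<rho>] by (simp add: diff_divide_distrib[symmetric] field_simps)
    finally show ?thesis .
  qed
  have "(\<lambda>n. M0 + (\<Sum>k<n. sqrt_coef (Suc k) * s ^ Suc k * V k)) \<longlonglongrightarrow>
      M0 + (s * (\<Sum>k. sqrt_coef (Suc k) * eval_fps (moment_fps \<kappa> k) s) + eval_fps (action_fps \<kappa>) s * ln s)"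
  proof -
    have "(\<lambda>k. - sqrt_coef (Suc k) * ?f k * s ^ Suc k) sums eval_fps (action_fps \<kappa>) s"
      using sums_Suc_of_nth_0[OF good_radius_conv(3)[OF d(1)[folded \<kappa>_def] s]] by (simp only: action_fps_nth)
    hence "(\<lambda>k. s * (sqrt_coef (Suc k) * eval_fps (moment_fps \<kappa> k) s) + - sqrt_coef (Suc k) * ?f k * s ^ Suc k * ln s)
        sums (s * (\<Sum>k. sqrt_coef (Suc k) * eval_fps (moment_fps \<kappa> k) s) + eval_fps (action_fps \<kappa>) s * ln s)"
      by (intro sums_add sums_mult sums_mult2 summable_sums sum_moments(1)[OF d(1)[folded \<kappa>_def] s])
    moreover have "s * (sqrt_coef (Suc k) * eval_fps (moment_fps \<kappa> k) s) + - sqrt_coef (Suc k) * ?f k * s ^ Suc k * ln s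
        = sqrt_coef (Suc k) * s ^ Suc k * V k" for k
      using s by (simp add: V_def field_simps)
    ultimately show ?thesis unfolding sums_def by (intro tendsto_add tendsto_const) simp
  qed
  hence "((\<lambda>x. sqrt ((x - s) / (x * (x + \<rho>) * (?b - x)))) has_integral
      M0 + (s * (\<Sum>k. sqrt_coef (Suc k) * eval_fps (moment_fps \<kappa> k) s) + eval_fps (action_fps \<kappa>) s * ln s)) {s..?b}"
    by (rule has_integral_dominated_convergence[OF p_int w_int, rotated 2])
       ((rule ballI, rule p_le, assumption), (rule ballI, rule p_lim, assumption))
  hence "integral {s..?b} (\<lambda>x. sqrt ((x - s) / (x * (x + \<rho>) * (?b - x)))) =
      M0 + (s * (\<Sum>k. sqrt_coef (Suc k) * eval_fps (moment_fps \<kappa> k) s) + eval_fps (action_fps \<kappa>) s * ln s)"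
    by (rule integral_unique)
  thus ?thesis
    using sum_moments(2)[OF d(1)[folded \<kappa>_def] s] moment_0_expansion[OF \<rho> d s]
    by (simp add: M0_def \<kappa>_def)
qed

section \<open>The regular action\<close>

lemma csqrt_series:
  assumes "norm (u :: complex) < 1"
  shows "(\<lambda>k. of_real (sqrt_coef k) * u ^ k) sums csqrt (1 - u)"
proof -
  have "(\<lambda>k. ((1 / 2) gchoose k) * (- u) ^ k) sums (1 + (- u)) powr (1 / 2)"
    by (rule gen_binomial_complex) (use assms in simp)
  moreover have "of_real ((1 / 2 :: real) gchoose k) = (1 / 2 :: complex) gchoose k" for k
    by (simp add: gbinomial_prod_rev)
  hence "((1 / 2 :: complex) gchoose k) * (- u) ^ k = of_real (sqrt_coef k) * u ^ k" for k
    by (simp add: sqrt_coef_def power_minus[of u])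
  moreover have "1 - u \<noteq> 0" using assms by auto
  hence "csqrt (1 - u) = (1 + (- u)) powr (1 / 2)"
    by (simp add: csqrt_exp_Ln powr_def)
  ultimately show ?thesis by simp
qed

lemma complex_radicand_factor:
  fixes z :: complex
  assumes "\<rho> > 0"
  shows "1 - of_real (top_kappa \<rho>) * z - z\<^sup>2 = (1 + z / of_real \<rho>) * (1 - of_real \<rho> * z)"
  using assms by (simp add: top_kappa_def power2_eq_square field_simps)

text \<open>
  The radicand is a product \<open>a b\<close> with \<open>Re a\<close>, \<open>Re b > 0\<close>.  If \<open>a b\<close> were a real \<open>x \<le> 0\<close>, then
  the real part of \<open>x cnj b = a |b|\<^sup>2\<close> would be both nonpositive and positive.
\<close>

lemma complex_radicand_not_nonpos:
  fixes z :: complex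
  assumes \<rho>: "\<rho> > 0" and z: "norm z < \<rho>" "norm z < inverse \<rho>"
  shows "1 - of_real (top_kappa \<rho>) * z - z\<^sup>2 \<notin> \<real>\<^sub>\<le>\<^sub>0"
proof -
  let ?a = "1 + z / of_real \<rho>" and ?b = "1 - of_real \<rho> * z"
  have "norm (z / of_real \<rho>) < 1" "norm (of_real \<rho> * z) < 1"
    using \<rho> z by (auto simp: norm_divide norm_mult field_simps)
  moreover have "\<bar>Re w\<bar> \<le> norm w" for w :: complex by (rule abs_Re_le_cmod)
  ultimately have "Re ?a > 0" "Re ?b > 0"
    by (smt (verit) minus_complex.sel(1) plus_complex.sel(1) one_complex.sel(1))+
  have "?a * ?b \<notin> \<real>\<^sub>\<le>\<^sub>0"
  proof
    assume "?a * ?b \<in> \<real>\<^sub>\<le>\<^sub>0"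
    then obtain x where x: "?a * ?b = of_real x" "x \<le> 0" by (auto elim: nonpos_Reals_cases)
    have "cnj ?b * (?a * ?b) = ?a * of_real ((norm ?b)\<^sup>2)"
      by (simp add: complex_norm_square mult_ac del: of_real_power)
    hence "Re (cnj ?b * of_real x) = Re (?a * of_real ((norm ?b)\<^sup>2))" using x by simp
    hence "Re ?b * x = Re ?a * (norm ?b)\<^sup>2" by simp
    moreover have "Re ?b * x \<le> 0" using \<open>Re ?b > 0\<close> x by (simp add: mult_nonneg_nonpos)
    moreover have "?b \<noteq> 0" using \<open>Re ?b > 0\<close> by (metis less_irrefl zero_complex.sel(1))
    hence "Re ?a * (norm ?b)\<^sup>2 > 0" using \<open>Re ?a > 0\<close> by simp
    ultimately show False by linarith
  qed
  thus ?thesis using complex_radicand_factor[OF \<rho>] by simp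
qed

text \<open>
  On the circle \<open>|2h/z| < 1\<close>, so the binomial series converges uniformly there, and each of its terms is a
  Cauchy integral for a Taylor coefficient of \<open>1 / csqrt (1 - \<kappa>z - z\<^sup>2)\<close> at \<open>0\<close>.
\<close>

lemma I_alpha_sums:
  assumes \<rho>: "\<rho> > 0" and \<epsilon>: "admissible_radius \<rho> \<epsilon>" and h: "2 * norm h < \<epsilon>"
  shows "(\<lambda>k. fps_nth (fps_of_real (action_fps (top_kappa \<rho>))) k * (2 * h) ^ k) sums I_alpha \<rho> \<epsilon> h"
proof -
  let ?\<kappa> = "top_kappa \<rho>"
  define \<phi> where "\<phi> = (\<lambda>z::complex. 1 / csqrt (1 - of_real ?\<kappa> * z - z\<^sup>2))"
  define B where "B = ball (0::complex) (min \<rho> (inverse \<rho>))"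
  have \<epsilon>': "\<epsilon> > 0" "cball 0 \<epsilon> \<subseteq> B"
    using \<epsilon> by (auto simp: admissible_radius_def B_def)
  have "1 - of_real ?\<kappa> * z - z\<^sup>2 \<notin> \<real>\<^sub>\<le>\<^sub>0" if "z \<in> B" for z :: complex
    using complex_radicand_not_nonpos[OF \<rho>, of z] that by (simp add: B_def)
  moreover from this have "1 - of_real ?\<kappa> * z - z\<^sup>2 \<noteq> 0" if "z \<in> B" for z :: complex
    using that by (metis nonpos_Reals_zero_I)
  ultimately have hol: "\<phi> holomorphic_on B"
    unfolding \<phi>_def by (intro holomorphic_intros) auto
  have cont: "continuous_on (cball 0 \<epsilon>) \<phi>"
    using holomorphic_on_imp_continuous_on[OF hol] \<epsilon>' continuous_on_subset by blast
  have hol': "\<phi> holomorphic_on ball 0 \<epsilon>"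
    using holomorphic_on_subset[OF hol] \<epsilon>' ball_subset_cball by (metis order_trans)
  define c where "c = (\<lambda>k. fps_nth (fps_of_real (action_fps ?\<kappa>)) k)"
  define G where "G = (\<lambda>k z. of_real (sqrt_coef k) * (2 * h / z) ^ k * \<phi> z)"
  have G_int: "(G k has_contour_integral (- (2 * of_real pi * \<i>) * (c k * (2 * h) ^ k))) (circlepath 0 \<epsilon>)" for k
  proof (cases k)
    case 0
    have "(\<phi> has_contour_integral 0) (circlepath 0 \<epsilon>)"
      by (rule Cauchy_theorem_convex_simple[OF hol]) (use \<epsilon>' in \<open>auto simp: B_def\<close>)
    thus ?thesis by (simp add: 0 G_def c_def action_fps_def)
  next
    case (Suc n)
    have "(deriv ^^ n) \<phi> 0 / fact n = of_real (inv_sqrt_coef ?\<kappa> n)"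
      using fps_nth_fps_expansion[OF has_fps_expansion_inv_csqrt[of ?\<kappa>], of n]
      by (simp add: \<phi>_def inv_sqrt_fps_def)
    hence der: "2 * of_real pi * \<i> / fact n * (deriv ^^ n) \<phi> 0 = 2 * of_real pi * \<i> * of_real (inv_sqrt_coef ?\<kappa> n)"
      by (metis times_divide_eq_left times_divide_eq_right)
    have "((\<lambda>u. \<phi> u / (u - 0) ^ Suc n) has_contour_integral
             (2 * of_real pi * \<i> / fact n * (deriv ^^ n) \<phi> 0)) (circlepath 0 \<epsilon>)"
      using Cauchy_has_contour_integral_higher_derivative_circlepath[OF cont hol', of 0 n] \<epsilon>'(1) by simp
    from has_contour_integral_lmul[OF this, of "of_real (sqrt_coef k) * (2 * h) ^ k"]
    show ?thesis unfolding der
      by (simp add: G_def c_def action_fps_def Suc power_divide mult_ac)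
  qed
  have sphere_nz: "z \<noteq> 0" "norm (2 * h / z) < 1" "norm z = \<epsilon>" if "z \<in> sphere 0 \<epsilon>" for z :: complex
    using that \<epsilon>'(1) h by (auto simp: norm_divide norm_mult)
  obtain K where K: "norm (\<phi> z) \<le> K" if "z \<in> sphere 0 \<epsilon>" for z :: complex
  proof -
    have "compact (\<phi> ` sphere 0 \<epsilon>)"
      by (intro compact_continuous_image continuous_on_subset[OF cont]) auto
    hence "bounded (\<phi> ` sphere 0 \<epsilon>)" by (rule compact_imp_bounded)
    then obtain K where "\<And>w. w \<in> \<phi> ` sphere 0 \<epsilon> \<Longrightarrow> norm w \<le> K" by (auto simp: bounded_iff)
    thus ?thesis using that by blast
  qed
  have ul: "uniform_limit (sphere 0 \<epsilon>) (\<lambda>n z. \<Sum>k<n. G k z) (\<lambda>z. \<Sum>k. G k z) sequentially"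
  proof (rule Weierstrass_m_test)
    show "summable (\<lambda>k. \<bar>sqrt_coef k\<bar> * K)"
      by (intro summable_mult2 summable_abs_sqrt_coef)
    fix k and z :: complex assume z: "z \<in> sphere 0 \<epsilon>"
    have "norm ((2 * h / z) ^ k) \<le> 1"
      unfolding norm_power using sphere_nz(2)[OF z] by (intro power_le_one) auto
    hence "\<bar>sqrt_coef k\<bar> * norm ((2 * h / z) ^ k) * norm (\<phi> z) \<le> \<bar>sqrt_coef k\<bar> * 1 * K"
      by (intro mult_mono K z) auto
    thus "norm (G k z) \<le> \<bar>sqrt_coef k\<bar> * K" by (simp add: G_def norm_mult)
  qed
  have G_sum: "(\<Sum>k. G k z) = csqrt (1 - 2 * h / z) / csqrt (1 - of_real ?\<kappa> * z - z\<^sup>2)" if "z \<in> sphere 0 \<epsilon>" for z :: complex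
    using sums_mult2[OF csqrt_series[OF sphere_nz(2)[OF that]], of "\<phi> z"]
    by (simp add: G_def \<phi>_def sums_iff)
  have "(\<lambda>n. contour_integral (circlepath 0 \<epsilon>) (\<lambda>z. \<Sum>k<n. G k z))
          \<longlonglongrightarrow> contour_integral (circlepath 0 \<epsilon>) (\<lambda>z. \<Sum>k. G k z)"
  proof (rule contour_integral_uniform_limit_circlepath(2)[OF _ ul])
    show "\<forall>\<^sub>F n in sequentially. (\<lambda>z. \<Sum>k<n. G k z) contour_integrable_on circlepath 0 \<epsilon>"
      using G_int by (intro always_eventually allI contour_integrable_sum) (auto simp: contour_integrable_on_def)
  qed (use \<epsilon>' in auto)
  moreover have "contour_integral (circlepath 0 \<epsilon>) (\<lambda>z. \<Sum>k<n. G k z)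
       = - (2 * of_real pi * \<i>) * (\<Sum>k<n. c k * (2 * h) ^ k)" for n
    unfolding sum_distrib_left
    by (intro contour_integral_unique has_contour_integral_sum G_int) auto
  moreover have "contour_integral (circlepath 0 \<epsilon>) (\<lambda>z. \<Sum>k. G k z)
      = contour_integral (circlepath 0 \<epsilon>) (\<lambda>z. csqrt (1 - 2 * h / z) / csqrt (1 - of_real ?\<kappa> * z - z\<^sup>2))"
    by (rule contour_integral_eq) (use G_sum \<epsilon>'(1) in \<open>auto simp: path_image_circlepath\<close>)
  ultimately have "(\<lambda>n. \<i> / (2 * of_real pi) * (- (2 * of_real pi * \<i>) * (\<Sum>k<n. c k * (2 * h) ^ k))) \<longlonglongrightarrow> I_alpha \<rho> \<epsilon> h"
    unfolding I_alpha_def by (intro tendsto_mult tendsto_const) simp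
  moreover have "\<i> / (2 * of_real pi) * (- (2 * of_real pi * \<i>) * S) = S" for S :: complex
    by (simp add: field_simps)
  ultimately show ?thesis by (simp only: sums_def c_def)
qed

section \<open>The invariant and its uniqueness\<close>

lemma eventually_nhds_imp_at_within: "eventually P (nhds x) \<Longrightarrow> eventually P (at x within A)"
  by (auto simp: eventually_at_filter elim: eventually_mono)

lemma filterlim_double_nhds_0: "filterlim (\<lambda>h::real. 2 * h) (nhds 0) (nhds 0)"
  using tendsto_mult[OF tendsto_const[of 2] filterlim_ident[of "nhds (0::real)"]] by simp

lemma filterlim_uminus_at_left_0: "filterlim (\<lambda>h::real. - h) (at_right 0) (at_left 0)"
  by real_asymp

lemma eventually_conv_radius_double:
  fixes F :: "real fps"
  assumes "fps_conv_radius F > 0"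
  shows "\<forall>\<^sub>F h in nhds (0::real). ereal (norm (2 * h)) < fps_conv_radius F"
  by (rule eventually_compose_filterlim[OF eventually_conv_radius[OF assms] filterlim_double_nhds_0])

lemma fps_ln_real_expansion: "(\<lambda>x::real. ln (1 + x)) has_fps_expansion fps_ln 1"
proof -
  have "\<forall>\<^sub>F x in nhds 0. eval_fps (fps_ln 1) x = ln (1 + x :: real)"
    using eventually_nhds_in_open[of "ball (0::real) 1" 0]
  proof (simp, elim eventually_mono)
    fix x :: real assume x: "\<bar>x\<bar> < 1"
    have sm: "summable (\<lambda>n. fps_nth (fps_ln 1) n * x ^ n)"
      using x by (intro summable_fps) (simp add: one_ereal_def)
    have "ln (1 + x) = (\<Sum>n. (-1) ^ n * (1 / real (n + 1)) * (1 + x - 1) ^ Suc n)"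
      using x by (intro ln_series) auto
    also have "\<dots> = (\<Sum>n. fps_nth (fps_ln 1) (Suc n) * x ^ Suc n)"
      by (simp add: fps_ln_nth)
    also have "\<dots> = eval_fps (fps_ln 1) x"
      using suminf_split_head[OF sm] by (simp add: eval_fps_def)
    finally show "eval_fps (fps_ln 1) x = ln (1 + x)" by simp
  qed
  thus ?thesis by (simp add: has_fps_expansion_def)
qed

text \<open>
  The series of \<open>ln (f x)\<close> for \<open>f\<close> with positive constant coefficient, normalised so that the logarithmic
  series can be composed with a series without constant term.
\<close>

definition fps_log :: "real fps \<Rightarrow> real fps" where
  "fps_log F = fps_const (ln (fps_nth F 0)) + (fps_ln 1 oo (fps_const (1 / fps_nth F 0) * F - 1))"

lemma fps_log_nth_0: "fps_nth (fps_log F) 0 = ln (fps_nth F 0)"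
  by (simp add: fps_log_def)

lemma fps_deriv_log:
  assumes "fps_nth F 0 \<noteq> 0"
  shows "fps_deriv (fps_log F) * F = fps_deriv F"
proof -
  let ?c = "1 / fps_nth F 0"
  let ?B = "fps_const ?c * F - 1"
  have B0: "fps_nth ?B 0 = 0" using assms by simp
  have "fps_deriv (fps_log F) = (inverse (1 + fps_X) oo ?B) * fps_deriv ?B"
    unfolding fps_log_def by (simp add: fps_compose_deriv[OF B0] fps_ln_deriv)
  also have "inverse (1 + fps_X) oo ?B = inverse (fps_const ?c * F)"
    by (subst fps_inverse_compose[OF B0])
       (simp_all add: fps_compose_add_distrib fps_X_fps_compose_startby0[OF B0])
  finally have "fps_deriv (fps_log F) * (fps_const ?c * F)
      = (inverse (fps_const ?c * F) * (fps_const ?c * F)) * (fps_const ?c * fps_deriv F)"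
    by (simp add: mult_ac)
  also have "inverse (fps_const ?c * F) * (fps_const ?c * F) = 1"
    using assms by (intro inverse_mult_eq_1) simp
  finally have "fps_deriv (fps_log F) * (fps_const ?c * F) = fps_const ?c * fps_deriv F" by simp
  hence "fps_const ?c * (fps_deriv (fps_log F) * F - fps_deriv F) = 0"
    by (simp add: algebra_simps)
  thus ?thesis using assms by simp
qed

lemma ln_has_fps_expansion:
  assumes f: "f has_fps_expansion F" and F0: "fps_nth F 0 > 0"
  shows "(\<lambda>x. ln (f x)) has_fps_expansion fps_log F"
proof -
  let ?c = "1 / fps_nth F 0"
  have "(\<lambda>x. ?c * f x - 1) has_fps_expansion (fps_const ?c * F - 1)"
    by (intro fps_expansion_intros f)
  hence "(\<lambda>x. ln (1 + (?c * f x - 1))) has_fps_expansion (fps_ln 1 oo (fps_const ?c * F - 1))"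
    by (rule real_has_fps_expansion_compose[OF fps_ln_real_expansion]) (use F0 in simp)
  hence 1: "(\<lambda>x. ln (fps_nth F 0) + ln (1 + (?c * f x - 1))) has_fps_expansion fps_log F"
    unfolding fps_log_def by (intro fps_expansion_intros)
  have 2: "\<forall>\<^sub>F x in nhds 0. ln (fps_nth F 0) + ln (1 + (?c * f x - 1)) = ln (f x)"
  proof -
    have "isCont f 0" using has_fps_expansion_imp_continuous[OF f] by simp
    moreover have "f 0 = fps_nth F 0"
      using f eventually_nhds_x_imp_x by (fastforce simp: has_fps_expansion_def eval_fps_at_0)
    ultimately have "(f \<longlongrightarrow> fps_nth F 0) (nhds 0)"
      by (metis isCont_def tendsto_at_iff_tendsto_nhds)
    hence "\<forall>\<^sub>F x in nhds 0. f x > 0" using F0 by (rule order_tendstoD)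
    thus ?thesis by eventually_elim (use F0 in \<open>simp add: ln_div\<close>)
  qed
  show ?thesis by (rule iffD1[OF has_fps_expansion_cong[OF 2 refl] 1])
qed

text \<open>
  The quotient of the regular action by \<open>s = 2h\<close>.  Its constant coefficient is positive, so its logarithm is
  a power series, and so the regular action has the sign of \<open>h\<close> near \<open>0\<close>.
\<close>

definition action_quotient_fps :: "real \<Rightarrow> real fps" where
  "action_quotient_fps \<kappa> = fps_shift 1 (action_fps \<kappa>)"

lemma action_quotient_fps_nth:
  "fps_nth (action_quotient_fps \<kappa>) n = - sqrt_coef (Suc n) * inv_sqrt_coef \<kappa> n"
  by (simp add: action_quotient_fps_def action_fps_def)

lemma action_quotient_fps_nth_0: "fps_nth (action_quotient_fps \<kappa>) 0 = 1 / 2"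
  by (simp add: action_quotient_fps_nth sqrt_coef_Suc)

lemma eval_action_fps:
  assumes "ereal (norm s) < fps_conv_radius (action_fps \<kappa>)"
  shows "eval_fps (action_fps \<kappa>) s = s * eval_fps (action_quotient_fps \<kappa>) s"
proof -
  have "action_fps \<kappa> = fps_X * action_quotient_fps \<kappa>"
    by (auto simp: fps_eq_iff action_quotient_fps_def action_fps_def)
  moreover have "ereal (norm s) < fps_conv_radius (action_quotient_fps \<kappa>)"
    using assms by (simp add: action_quotient_fps_def)
  from eval_fps_monom_mult[OF this, of 1 1]
  have "eval_fps (fps_X * action_quotient_fps \<kappa>) s = s * eval_fps (action_quotient_fps \<kappa>) s" by simp
  ultimately show ?thesis by simp
qed

text \<open>
  The invariant as a function of \<open>s = 2h\<close> instead of the regular action.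
\<close>

definition pulled_back_invariant_fps :: "real \<Rightarrow> real fps" where
  "pulled_back_invariant_fps \<kappa> =
     action_fps \<kappa> * fps_log (action_quotient_fps \<kappa>) - action_fps \<kappa> - rest_fps \<kappa>"

definition invariant_fps :: "real \<Rightarrow> real fps" where
  "invariant_fps \<kappa> = pulled_back_invariant_fps \<kappa> oo fps_inv (action_fps \<kappa>)"

lemma action_fps_0: "fps_nth (action_fps \<kappa>) 0 = 0" and action_fps_1: "fps_nth (action_fps \<kappa>) 1 \<noteq> 0"
  by (simp_all add: action_fps_def sqrt_coef_Suc)

lemma conv_radius_pos:
  "fps_conv_radius (action_fps \<kappa>) > 0" "fps_conv_radius (rest_fps \<kappa>) > 0"
  "fps_conv_radius (action_quotient_fps \<kappa>) > 0"
proof -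
  have "0 < ereal (1 / growth \<kappa>)" using growth_ge[of \<kappa>] by simp
  note pos = less_le_trans[OF this]
  show "fps_conv_radius (action_fps \<kappa>) > 0" by (rule pos[OF fps_conv_radius_action_fps])
  thus "fps_conv_radius (action_quotient_fps \<kappa>) > 0" by (simp add: action_quotient_fps_def)
  show "fps_conv_radius (rest_fps \<kappa>) > 0" by (rule pos[OF fps_conv_radius_rest_fps])
qed

lemma pulled_back_invariant_has_fps_expansion:
  "(\<lambda>s. eval_fps (action_fps \<kappa>) s * ln (eval_fps (action_quotient_fps \<kappa>) s)
        - eval_fps (action_fps \<kappa>) s - eval_fps (rest_fps \<kappa>) s)
     has_fps_expansion pulled_back_invariant_fps \<kappa>"
  unfolding pulled_back_invariant_fps_def
  using conv_radius_pos[of \<kappa>]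
  by (intro fps_expansion_intros ln_has_fps_expansion eval_fps_has_fps_expansion)
     (auto simp: action_quotient_fps_nth_0)

lemma invariant_fps_compose: "invariant_fps \<kappa> oo action_fps \<kappa> = pulled_back_invariant_fps \<kappa>"
proof -
  have "invariant_fps \<kappa> oo action_fps \<kappa> =
          pulled_back_invariant_fps \<kappa> oo (fps_inv (action_fps \<kappa>) oo action_fps \<kappa>)"
    unfolding invariant_fps_def
    by (rule fps_compose_assoc[symmetric]) (simp_all add: action_fps_0 fps_inv_def)
  thus ?thesis using fps_inv[OF action_fps_0 action_fps_1] by simp
qed

lemma conv_radius_fps_inv_action: "fps_conv_radius (fps_inv (action_fps \<kappa>)) > 0"
  by (rule fps_conv_radius_fps_inv_pos[OF conv_radius_pos(1) action_fps_0 action_fps_1])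

lemma conv_radius_invariant_fps: "fps_conv_radius (invariant_fps \<kappa>) > 0"
proof -
  have "(\<lambda>x. eval_fps (pulled_back_invariant_fps \<kappa>) (eval_fps (fps_inv (action_fps \<kappa>)) x))
          has_fps_expansion invariant_fps \<kappa>"
    unfolding invariant_fps_def
    using pulled_back_invariant_has_fps_expansion[of \<kappa>] conv_radius_fps_inv_action[of \<kappa>]
    by (intro real_has_fps_expansion_compose eval_fps_has_fps_expansion)
       (auto simp: has_fps_expansion_def fps_inv_def)
  thus ?thesis by (simp add: has_fps_expansion_def)
qed

lemma eventually_invariant_eq:
  "\<forall>\<^sub>F s in nhds 0. eval_fps (invariant_fps \<kappa>) (eval_fps (action_fps \<kappa>) s)
     = eval_fps (action_fps \<kappa>) s * ln (eval_fps (action_quotient_fps \<kappa>) s)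
        - eval_fps (action_fps \<kappa>) s - eval_fps (rest_fps \<kappa>) s"
proof -
  have "(\<lambda>s. eval_fps (invariant_fps \<kappa>) (eval_fps (action_fps \<kappa>) s))
          has_fps_expansion pulled_back_invariant_fps \<kappa>"
    unfolding invariant_fps_compose[symmetric]
    using conv_radius_invariant_fps conv_radius_pos
    by (intro real_has_fps_expansion_compose eval_fps_has_fps_expansion) (auto simp: action_fps_0)
  with pulled_back_invariant_has_fps_expansion[of \<kappa>] show ?thesis
    unfolding has_fps_expansion_def by (auto elim: eventually_elim2)
qed

lemma I_beta_plus_eq:
  assumes \<rho>: "\<rho> > 0" and d: "good_radius (top_kappa \<rho>) d" "d \<le> inverse \<rho>" and h: "0 < h" "2 * h < d"
  shows "2 * pi * I_beta_plus \<rho> h = 2 * arctan (inverse \<rho>)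
     + eval_fps (action_fps (top_kappa \<rho>)) (2 * h) * ln (2 * h) + eval_fps (rest_fps (top_kappa \<rho>)) (2 * h)"
  using action_integral[OF \<rho> d, of "2 * h"] h by (simp add: I_beta_plus_def)

text \<open>
  The substitution \<open>x \<mapsto> -x\<close> exchanges the roots \<open>-\<rho>\<close> and \<open>1/\<rho>\<close> of the radicand up to sign.
\<close>

lemma I_beta_minus_eq_plus: "I_beta_minus \<rho> h = I_beta_plus (inverse \<rho>) (- h)"
proof -
  let ?f = "\<lambda>x. sqrt ((x - 2 * h) / (x * (x + \<rho>) * (inverse \<rho> - x)))"
  have "integral {- \<rho>..2 * h} ?f = integral {- (2 * h)..\<rho>} (\<lambda>x. ?f (- x))"
  proof -
    have "integral {- (2 * h)..- (- \<rho>)} (\<lambda>x. ?f (- x)) = integral {- \<rho>..2 * h} ?f"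
      by (rule Henstock_Kurzweil_Integration.integral_reflect_real[where f = ?f])
    thus ?thesis by (simp only: minus_minus)
  qed
  also have "(\<lambda>x. ?f (- x)) = (\<lambda>x. sqrt ((x - 2 * (- h)) / (x * (x + inverse \<rho>) * (inverse (inverse \<rho>) - x))))"
  proof
    fix x
    have "(- x - 2 * h) / (- x * (- x + \<rho>) * (inverse \<rho> - - x))
        = - (x + 2 * h) / - (x * (x + inverse \<rho>) * (\<rho> - x))"
      by (rule arg_cong2[of _ _ _ _ "(/)"]) (auto simp: algebra_simps)
    also have "\<dots> = (x - 2 * (- h)) / (x * (x + inverse \<rho>) * (inverse (inverse \<rho>) - x))"
      unfolding minus_divide_divide inverse_inverse_eq by simp
    finally show "?f (- x) = sqrt ((x - 2 * (- h)) / (x * (x + inverse \<rho>) * (inverse (inverse \<rho>) - x)))"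
      by (rule arg_cong)
  qed
  finally show ?thesis by (simp add: I_beta_minus_def I_beta_plus_def)
qed

lemma top_kappa_inverse: "top_kappa (inverse \<rho>) = - top_kappa \<rho>"
  by (simp add: top_kappa_def)

lemma good_radius_le:
  assumes "\<rho> > 0"
  obtains d where "good_radius (top_kappa \<rho>) d" "d \<le> inverse \<rho>"
proof -
  obtain d where d: "good_radius (top_kappa \<rho>) d" using good_radius_exists by blast
  hence "good_radius (top_kappa \<rho>) (min d (inverse \<rho>))" using assms by (auto simp: good_radius_def)
  thus ?thesis by (rule that) simp
qed

lemma eventually_I_beta_plus:
  assumes \<rho>: "\<rho> > 0"
  shows "\<forall>\<^sub>F h in at_right 0. 2 * pi * I_beta_plus \<rho> h = 2 * arctan (inverse \<rho>)
     + eval_fps (action_fps (top_kappa \<rho>)) (2 * h) * ln (2 * h) + eval_fps (rest_fps (top_kappa \<rho>)) (2 * h)"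
proof -
  obtain d where d: "good_radius (top_kappa \<rho>) d" "d \<le> inverse \<rho>" using good_radius_le[OF \<rho>] .
  hence "d > 0" by (simp add: good_radius_def)
  hence "\<forall>\<^sub>F h in at_right 0. h \<in> {0<..<d / 2}" by (intro eventually_at_right_real) simp
  thus ?thesis by eventually_elim (rule I_beta_plus_eq[OF \<rho> d], auto)
qed

text \<open>
  The expansion for positive energies with \<open>1/\<rho>\<close> for \<open>\<rho>\<close>; both series are odd under the simultaneous sign
  change of \<open>\<kappa>\<close> and \<open>s\<close>.
\<close>

lemma eventually_I_beta_minus:
  assumes \<rho>: "\<rho> > 0"
  shows "\<forall>\<^sub>F h in at_left 0. 2 * pi * I_beta_minus \<rho> h = 2 * arctan \<rho>
     - eval_fps (action_fps (top_kappa \<rho>)) (2 * h) * ln (- (2 * h)) - eval_fps (rest_fps (top_kappa \<rho>)) (2 * h)"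
proof -
  have \<rho>': "inverse \<rho> > 0" using \<rho> by simp
  have "\<forall>\<^sub>F h in at_left 0. 2 * pi * I_beta_plus (inverse \<rho>) (- h) = 2 * arctan \<rho>
     + eval_fps (action_fps (- top_kappa \<rho>)) (2 * (- h)) * ln (2 * (- h)) + eval_fps (rest_fps (- top_kappa \<rho>)) (2 * (- h))"
    using eventually_compose_filterlim[OF eventually_I_beta_plus[OF \<rho>'] filterlim_uminus_at_left_0]
    unfolding top_kappa_inverse inverse_inverse_eq .
  moreover note eventually_nhds_imp_at_within[OF eventually_conv_radius_double[OF conv_radius_pos(1)[of "top_kappa \<rho>"]]]
    eventually_nhds_imp_at_within[OF eventually_conv_radius_double[OF conv_radius_pos(2)[of "top_kappa \<rho>"]]]
  ultimately show ?thesis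
  proof eventually_elim
    case (elim h)
    have "eval_fps (action_fps (- top_kappa \<rho>)) (- (2 * h)) = - eval_fps (action_fps (top_kappa \<rho>)) (2 * h)"
      "eval_fps (rest_fps (- top_kappa \<rho>)) (- (2 * h)) = - eval_fps (rest_fps (top_kappa \<rho>)) (2 * h)"
      using elim by (auto intro!: eval_fps_odd_symmetry action_fps_uminus rest_fps_uminus)
    thus ?case using elim by (simp add: I_beta_minus_eq_plus)
  qed
qed

lemma eval_fps_tendsto_at_0:
  fixes F :: "real fps"
  assumes "fps_conv_radius F > 0"
  shows "((\<lambda>x. eval_fps F (2 * x)) \<longlongrightarrow> fps_nth F 0) (at 0 within A)"
proof -
  have "isCont (eval_fps F) 0"
    using continuous_eval_fps[of 0 F UNIV] assms by (simp add: zero_ereal_def)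
  moreover have "((\<lambda>x::real. 2 * x) \<longlongrightarrow> 0) (at 0 within A)"
    using tendsto_mult[OF tendsto_const[of 2] tendsto_ident_at[of "0::real" A]] by simp
  ultimately show ?thesis using isCont_tendsto_compose by (fastforce simp: eval_fps_at_0)
qed

lemma I_beta_plus_tendsto:
  assumes \<rho>: "\<rho> > 0"
  shows "(I_beta_plus \<rho> \<longlongrightarrow> arctan (inverse \<rho>) / pi) (at_right 0)"
proof -
  let ?L = "action_fps (top_kappa \<rho>)" and ?R = "rest_fps (top_kappa \<rho>)" and ?Q = "action_quotient_fps (top_kappa \<rho>)"
  have "((\<lambda>x::real. (2 * x) * ln (2 * x)) \<longlongrightarrow> 0) (at_right 0)" by real_asymp
  hence Q_lim: "((\<lambda>h. eval_fps ?Q (2 * h) * ((2 * h) * ln (2 * h))) \<longlongrightarrow> fps_nth ?Q 0 * 0) (at_right 0)"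
    by (intro tendsto_mult eval_fps_tendsto_at_0 conv_radius_pos)
  have "((\<lambda>h. (2 * arctan (inverse \<rho>) + eval_fps ?Q (2 * h) * ((2 * h) * ln (2 * h)) + eval_fps ?R (2 * h)) / (2 * pi))
           \<longlongrightarrow> (2 * arctan (inverse \<rho>) + fps_nth ?Q 0 * 0 + fps_nth ?R 0) / (2 * pi)) (at_right 0)"
    by (intro tendsto_divide tendsto_add tendsto_const Q_lim eval_fps_tendsto_at_0 conv_radius_pos) simp
  hence lim: "((\<lambda>h. (2 * arctan (inverse \<rho>) + eval_fps ?Q (2 * h) * ((2 * h) * ln (2 * h)) + eval_fps ?R (2 * h)) / (2 * pi))
           \<longlongrightarrow> arctan (inverse \<rho>) / pi) (at_right 0)"
    by (simp add: rest_fps_nth)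
  show ?thesis
  proof (rule Lim_transform_eventually[OF lim])
    note eventually_nhds_imp_at_within[OF eventually_conv_radius_double[OF conv_radius_pos(1)[of "top_kappa \<rho>"]]]
    thus "\<forall>\<^sub>F h in at_right 0. (2 * arctan (inverse \<rho>) + eval_fps ?Q (2 * h) * ((2 * h) * ln (2 * h))
            + eval_fps ?R (2 * h)) / (2 * pi) = I_beta_plus \<rho> h"
      using eventually_I_beta_plus[OF \<rho>]
    proof eventually_elim
      case (elim h)
      have "(2 * arctan (inverse \<rho>) + eval_fps ?Q (2 * h) * ((2 * h) * ln (2 * h)) + eval_fps ?R (2 * h)) / (2 * pi)
          = (2 * pi * I_beta_plus \<rho> h) / (2 * pi)"
        unfolding elim(2) eval_action_fps[OF elim(1)] by (simp only: mult_ac)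
      thus ?case by simp
    qed
  qed
qed

lemma I_beta_minus_tendsto:
  assumes \<rho>: "\<rho> > 0"
  shows "(I_beta_minus \<rho> \<longlongrightarrow> arctan \<rho> / pi) (at_left 0)"
proof -
  have "((\<lambda>h. I_beta_plus (inverse \<rho>) (- h)) \<longlongrightarrow> arctan \<rho> / pi) (at_left 0)"
    using filterlim_compose[OF I_beta_plus_tendsto[of "inverse \<rho>"] filterlim_uminus_at_left_0] \<rho> by simp
  thus ?thesis by (simp add: I_beta_minus_eq_plus[abs_def])
qed

lemma I_beta_0:
  assumes "\<rho> > 0"
  shows "I_beta_plus_0 \<rho> = arctan (inverse \<rho>) / pi" "I_beta_minus_0 \<rho> = arctan \<rho> / pi"
  unfolding I_beta_plus_0_def I_beta_minus_0_def
  by (rule tendsto_Lim[OF trivial_limit_at_right_real I_beta_plus_tendsto[OF assms]],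
      rule tendsto_Lim[OF trivial_limit_at_left_real I_beta_minus_tendsto[OF assms]])

lemma I_alpha_eval:
  assumes "\<rho> > 0" "admissible_radius \<rho> \<epsilon>" "2 * norm h < \<epsilon>"
  shows "I_alpha \<rho> \<epsilon> h = eval_fps (fps_of_real (action_fps (top_kappa \<rho>))) (2 * h)"
  using I_alpha_sums[OF assms] by (simp add: eval_fps_def sums_iff)

lemma I_alpha_analytic:
  assumes \<rho>: "\<rho> > 0" and \<epsilon>: "admissible_radius \<rho> \<epsilon>"
  shows "I_alpha \<rho> \<epsilon> analytic_on {0}"
proof -
  let ?F = "fps_of_real (action_fps (top_kappa \<rho>))"
  have "eval_fps ?F analytic_on {0}"
    by (rule analytic_on_eval_fps) (use conv_radius_pos in \<open>auto simp: zero_ereal_def\<close>)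
  hence "(\<lambda>h. eval_fps ?F (2 * h)) analytic_on {0}"
    using analytic_on_compose_gen[of "\<lambda>h::complex. 2 * h" "{0}" "eval_fps ?F" "{0}"]
    by (auto simp: o_def intro!: analytic_intros)
  moreover have "\<forall>\<^sub>F h in nhds 0. I_alpha \<rho> \<epsilon> h = eval_fps ?F (2 * h)"
    using eventually_nhds_in_open[of "ball (0::complex) (\<epsilon> / 2)" 0] \<epsilon> I_alpha_eval[OF \<rho> \<epsilon>]
    by (auto simp: admissible_radius_def elim!: eventually_mono)
  ultimately show ?thesis using analytic_at_cong[of "I_alpha \<rho> \<epsilon>" _ 0 0] by auto
qed

lemma eventually_I_alpha_real:
  assumes \<rho>: "\<rho> > 0" and \<epsilon>: "admissible_radius \<rho> \<epsilon>"
  shows "\<forall>\<^sub>F h in nhds 0. I_alpha \<rho> \<epsilon> (of_real h) = of_real (eval_fps (action_fps (top_kappa \<rho>)) (2 * h))"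
proof -
  note eventually_conv_radius_double[OF conv_radius_pos(1)[of "top_kappa \<rho>"]]
  moreover have "\<forall>\<^sub>F h in nhds (0::real). h \<in> ball 0 (\<epsilon> / 2)"
    using \<epsilon> by (intro eventually_nhds_in_open) (auto simp: admissible_radius_def)
  ultimately show ?thesis
  proof eventually_elim
    case (elim h)
    have "I_alpha \<rho> \<epsilon> (of_real h) = eval_fps (fps_of_real (action_fps (top_kappa \<rho>))) (of_real (2 * h))"
      using elim I_alpha_eval[OF \<rho> \<epsilon>, of "of_real h"] by simp
    also have "\<dots> = of_real (eval_fps (action_fps (top_kappa \<rho>)) (2 * h))"
      using elim by (intro eval_fps_of_real) simp
    finally show ?case .
  qed
qed

text \<open>
  The factor \<open>1/2\<close> undoes the substitution \<open>s = 2h\<close>.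
\<close>

lemma real_local_inverse_exists:
  assumes \<rho>: "\<rho> > 0" and \<epsilon>: "admissible_radius \<rho> \<epsilon>"
  shows "real_local_inverse (I_alpha \<rho> \<epsilon>) (\<lambda>J. eval_fps (fps_inv (action_fps (top_kappa \<rho>))) J / 2)"
proof -
  let ?L = "action_fps (top_kappa \<rho>)" and ?M = "fps_inv (action_fps (top_kappa \<rho>))"
  let ?g = "\<lambda>J. eval_fps ?M J / 2"
  have g0: "?g 0 = 0" by (simp add: eval_fps_at_0 fps_inv_def)
  have "isCont (eval_fps ?M) 0"
    using continuous_eval_fps[of 0 ?M UNIV] conv_radius_fps_inv_action[of "top_kappa \<rho>"] by (simp add: zero_ereal_def)
  hence "isCont (\<lambda>J. eval_fps ?M J * (1 / 2)) 0"
    by (rule isCont_mult) (rule continuous_const)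
  hence cont: "isCont ?g 0" by simp
  have "(\<lambda>J. eval_fps ?L (eval_fps ?M J)) has_fps_expansion (?L oo ?M)"
    using conv_radius_pos conv_radius_fps_inv_action
    by (intro real_has_fps_expansion_compose eval_fps_has_fps_expansion) (auto simp: fps_inv_def)
  hence "\<forall>\<^sub>F J in nhds 0. eval_fps ?L (eval_fps ?M J) = J"
    using fps_inv_right[OF action_fps_0 action_fps_1] by (auto simp: has_fps_expansion_def elim!: eventually_mono)
  moreover have "filterlim ?g (nhds 0) (nhds 0)"
    using cont g0 by (metis (mono_tags, lifting) isCont_def tendsto_at_iff_tendsto_nhds)
  from eventually_compose_filterlim[OF eventually_I_alpha_real[OF \<rho> \<epsilon>] this]
  have "\<forall>\<^sub>F J in nhds 0. I_alpha \<rho> \<epsilon> (of_real (?g J)) = of_real (eval_fps ?L (eval_fps ?M J))"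
    by simp
  ultimately have "\<forall>\<^sub>F J in nhds 0. I_alpha \<rho> \<epsilon> (of_real (?g J)) = of_real J"
    by eventually_elim simp
  thus ?thesis using g0 cont by (simp add: real_local_inverse_def)
qed

text \<open>
  Any local inverse \<open>g\<close> satisfies \<open>J = s q\<close> with \<open>s = 2 g(J)\<close> and \<open>q\<close> the value of the quotient
  series at \<open>s\<close>.  Since \<open>q > 0\<close>, the signs of \<open>J\<close> and \<open>g(J)\<close> agree, so \<open>g\<close> approaches \<open>0\<close> from the same
  side as \<open>J\<close>, and \<open>ln |J| = ln |s| + ln q\<close> turns the expansion in \<open>s\<close> into the required one in \<open>J\<close>.
\<close>

lemma semiglobal_invariant_invariant_fps:
  assumes \<rho>: "\<rho> > 0"
  shows "semiglobal_invariant \<rho> (invariant_fps (top_kappa \<rho>))"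
  unfolding semiglobal_invariant_def
proof (intro conjI allI impI)
  let ?\<kappa> = "top_kappa \<rho>"
  let ?\<sigma> = "invariant_fps ?\<kappa>" and ?L = "action_fps ?\<kappa>" and ?Q = "action_quotient_fps ?\<kappa>" and ?R = "rest_fps ?\<kappa>"
  show "fps_conv_radius ?\<sigma> > 0" by (rule conv_radius_invariant_fps)
  fix \<epsilon> g assume \<epsilon>: "admissible_radius \<rho> \<epsilon>" and g: "real_local_inverse (I_alpha \<rho> \<epsilon>) g"
  have g_lim: "filterlim g (nhds 0) (nhds 0)"
    using g by (metis isCont_def tendsto_at_iff_tendsto_nhds real_local_inverse_def)
  hence s_lim: "filterlim (\<lambda>J. 2 * g J) (nhds 0) (nhds 0)"
    using tendsto_mult[OF tendsto_const[of 2] g_lim] by simp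
  have "\<forall>\<^sub>F J in nhds 0. I_alpha \<rho> \<epsilon> (of_real (g J)) = of_real J"
    using g by (simp add: real_local_inverse_def)
  with eventually_compose_filterlim[OF eventually_I_alpha_real[OF \<rho> \<epsilon>] g_lim]
  have L_g: "\<forall>\<^sub>F J in nhds 0. eval_fps ?L (2 * g J) = J"
    by eventually_elim (metis of_real_eq_iff)
  have "isCont (eval_fps ?Q) 0"
    using continuous_eval_fps[of 0 ?Q UNIV] conv_radius_pos(3)[of ?\<kappa>] by (simp add: zero_ereal_def)
  hence "(eval_fps ?Q \<longlongrightarrow> eval_fps ?Q 0) (nhds 0)"
    unfolding isCont_def tendsto_at_iff_tendsto_nhds .
  hence "\<forall>\<^sub>F s in nhds 0. eval_fps ?Q s > 0"
    by (rule order_tendstoD) (simp add: eval_fps_at_0 action_quotient_fps_nth_0)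
  note Q_pos = eventually_compose_filterlim[OF this s_lim]
  note conv = eventually_compose_filterlim[OF eventually_conv_radius[OF conv_radius_pos(1)[of ?\<kappa>]] s_lim]
  note inv = eventually_compose_filterlim[OF eventually_invariant_eq[of ?\<kappa>] s_lim]
  have main: "\<forall>\<^sub>F J in nhds 0. J = 2 * g J * eval_fps ?Q (2 * g J) \<and> eval_fps ?Q (2 * g J) > 0 \<and>
     eval_fps ?L (2 * g J) = J \<and> eval_fps ?\<sigma> J = J * ln (eval_fps ?Q (2 * g J)) - J - eval_fps ?R (2 * g J)"
    using L_g Q_pos conv inv by eventually_elim (auto simp: eval_action_fps)
  have right: "filterlim g (at_right 0) (at_right 0)"
    unfolding filterlim_at
  proof
    have "\<forall>\<^sub>F J in at_right 0. J = 2 * g J * eval_fps ?Q (2 * g J) \<and> eval_fps ?Q (2 * g J) > 0"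
      by (rule eventually_mono[OF eventually_nhds_imp_at_within[OF main]]) blast
    thus "\<forall>\<^sub>F J in at_right 0. g J \<in> {0<..} \<and> g J \<noteq> 0"
      using eventually_at_right_less[of 0]
    proof eventually_elim
      case (elim J)
      hence "0 < 2 * g J * eval_fps ?Q (2 * g J)" and "eval_fps ?Q (2 * g J) > 0" by metis+
      thus ?case by (simp add: zero_less_mult_iff)
    qed
  qed (use g_lim in \<open>auto intro: tendsto_mono[OF at_within_le_nhds]\<close>)
  have left: "filterlim g (at_left 0) (at_left 0)"
    unfolding filterlim_at
  proof
    have "\<forall>\<^sub>F J in at_left 0. J = 2 * g J * eval_fps ?Q (2 * g J) \<and> eval_fps ?Q (2 * g J) > 0"
      by (rule eventually_mono[OF eventually_nhds_imp_at_within[OF main]]) blast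
    moreover have "\<forall>\<^sub>F J in at_left (0::real). J < 0" by (simp add: eventually_at_filter)
    ultimately show "\<forall>\<^sub>F J in at_left 0. g J \<in> {..<0} \<and> g J \<noteq> 0"
    proof eventually_elim
      case (elim J)
      hence "2 * g J * eval_fps ?Q (2 * g J) < 0" and "eval_fps ?Q (2 * g J) > 0" by metis+
      thus ?case by (simp add: mult_less_0_iff)
    qed
  qed (use g_lim in \<open>auto intro: tendsto_mono[OF at_within_le_nhds]\<close>)
  have pos: "\<forall>\<^sub>F h in at_right (0::real). h > 0" by (rule eventually_at_right_less)
  have neg: "\<forall>\<^sub>F h in at_left (0::real). h < 0" by (simp add: eventually_at_filter)
  have main_r: "eventually P (at_right 0)" "eventually P (at_left 0)" if "eventually P (nhds (0::real))" for P
    using that by (rule eventually_nhds_imp_at_within)+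
  show "\<forall>\<^sub>F J in at_right 0. 2 * pi * I_beta_plus \<rho> (g J) =
          2 * pi * I_beta_plus_0 \<rho> + J * ln J - J - eval_fps ?\<sigma> J"
    using eventually_compose_filterlim[OF eventually_I_beta_plus[OF \<rho>] right]
      eventually_compose_filterlim[OF pos right] main_r(1)[OF main]
  proof eventually_elim
    case (elim J)
    define s where "s = 2 * g J"
    define q where "q = eval_fps ?Q s"
    have "s > 0" using elim(2) by (simp add: s_def)
    moreover have q: "q > 0" "J = s * q" and L: "eval_fps ?L s = J"
      and \<sigma>: "eval_fps ?\<sigma> J = J * ln q - J - eval_fps ?R s"
      using elim(3) unfolding s_def q_def by blast+
    ultimately have ln: "ln J = ln s + ln q" by (simp add: ln_mult_pos)
    show ?case
      unfolding elim(1) \<sigma> ln I_beta_0[OF \<rho>] s_def[symmetric] L by (simp add: algebra_simps)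
  qed
  show "\<forall>\<^sub>F J in at_left 0. 2 * pi * I_beta_minus \<rho> (g J) =
          2 * pi * I_beta_minus_0 \<rho> - J * ln (- J) + J + eval_fps ?\<sigma> J"
    using eventually_compose_filterlim[OF eventually_I_beta_minus[OF \<rho>] left]
      eventually_compose_filterlim[OF neg left] main_r(2)[OF main]
  proof eventually_elim
    case (elim J)
    define s where "s = 2 * g J"
    define q where "q = eval_fps ?Q s"
    have "- s > 0" using elim(2) by (simp add: s_def)
    moreover have q: "q > 0" "J = s * q" and L: "eval_fps ?L s = J"
      and \<sigma>: "eval_fps ?\<sigma> J = J * ln q - J - eval_fps ?R s"
      using elim(3) unfolding s_def q_def by blast+
    moreover from q have "- J = (- s) * q" by simp
    ultimately have ln: "ln (- J) = ln (- s) + ln q" by (simp only: ln_mult_pos)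
    show ?case
      unfolding elim(1) \<sigma> ln I_beta_0[OF \<rho>] s_def[symmetric] L by (simp add: algebra_simps)
  qed
qed

lemma admissible_radius_exists:
  assumes "\<rho> > 0" shows "admissible_radius \<rho> (min \<rho> (inverse \<rho>) / 2)"
  using assms by (cases "\<rho> \<le> inverse \<rho>") (simp_all add: admissible_radius_def)

lemma semiglobal_invariant_unique:
  assumes \<rho>: "\<rho> > 0" and \<sigma>: "semiglobal_invariant \<rho> \<sigma>" and \<tau>: "semiglobal_invariant \<rho> \<tau>"
  shows "\<sigma> = \<tau>"
proof (rule fps_eq_if_eventually_eq_at_right)
  show "fps_conv_radius \<sigma> > 0" "fps_conv_radius \<tau> > 0"
    using \<sigma> \<tau> by (simp_all add: semiglobal_invariant_def)
  note \<epsilon> = admissible_radius_exists[OF \<rho>]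
  note g = real_local_inverse_exists[OF \<rho> \<epsilon>]
  show "\<forall>\<^sub>F x in at_right 0. eval_fps \<sigma> x = eval_fps \<tau> x"
    using \<sigma>[unfolded semiglobal_invariant_def, THEN conjunct2, rule_format, OF \<epsilon> g, THEN conjunct1]
      \<tau>[unfolded semiglobal_invariant_def, THEN conjunct2, rule_format, OF \<epsilon> g, THEN conjunct1]
    by eventually_elim simp
qed

section \<open>The first seven coefficients\<close>

text \<open>
  The coefficients below are indexed by numerals; these equations keep the simplifier from rewriting \<open>1\<close> and
  \<open>2\<close> to successor terms.
\<close>

lemmas nat_norms = One_nat_def[symmetric] Suc_1

lemmas coefficient_simps = nat_norms field_simps power_numeral_reduce[of \<kappa>] for \<kappa> :: real

lemma sqrt_coef_values:
  "sqrt_coef 1 = -1 / 2"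
  "sqrt_coef 2 = -1 / 8"
  "sqrt_coef 3 = -1 / 16"
  "sqrt_coef 4 = -5 / 128"
  "sqrt_coef 5 = -7 / 256"
  "sqrt_coef 6 = -21 / 1024"
  "sqrt_coef 7 = -33 / 2048"
proof -
  show b1: "sqrt_coef 1 = -1 / 2"
    using sqrt_coef_Suc[of 0] by (simp add: nat_norms del: One_nat_def)
  show b2: "sqrt_coef 2 = -1 / 8"
    using sqrt_coef_Suc[of 1] b1 by (simp add: nat_norms del: One_nat_def)
  show b3: "sqrt_coef 3 = -1 / 16"
    using sqrt_coef_Suc[of 2] b2 by (simp add: nat_norms del: One_nat_def)
  show b4: "sqrt_coef 4 = -5 / 128"
    using sqrt_coef_Suc[of 3] b3 by (simp add: nat_norms del: One_nat_def)
  show b5: "sqrt_coef 5 = -7 / 256"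
    using sqrt_coef_Suc[of 4] b4 by (simp add: nat_norms del: One_nat_def)
  show b6: "sqrt_coef 6 = -21 / 1024"
    using sqrt_coef_Suc[of 5] b5 by (simp add: nat_norms del: One_nat_def)
  show b7: "sqrt_coef 7 = -33 / 2048"
    using sqrt_coef_Suc[of 6] b6 by (simp add: nat_norms del: One_nat_def)
qed

lemma inv_sqrt_coef_values:
  "inv_sqrt_coef \<kappa> 1 = \<kappa> / 2"
  "inv_sqrt_coef \<kappa> 2 = (3 * \<kappa>^2 + 4) / 8"
  "inv_sqrt_coef \<kappa> 3 = (5 * \<kappa>^3 + 12 * \<kappa>) / 16"
  "inv_sqrt_coef \<kappa> 4 = (35 * \<kappa>^4 + 120 * \<kappa>^2 + 48) / 128"
  "inv_sqrt_coef \<kappa> 5 = (63 * \<kappa>^5 + 280 * \<kappa>^3 + 240 * \<kappa>) / 256"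
  "inv_sqrt_coef \<kappa> 6 = (231 * \<kappa>^6 + 1260 * \<kappa>^4 + 1680 * \<kappa>^2 + 320) / 1024"
proof -
  show f1: "inv_sqrt_coef \<kappa> 1 = \<kappa> / 2"
    using inv_sqrt_coef_rec[of 0 \<kappa>] by (simp add: coefficient_simps
        del: One_nat_def inv_sqrt_coef.simps(2,3))
  show f2: "inv_sqrt_coef \<kappa> 2 = (3 * \<kappa>^2 + 4) / 8"
    using inv_sqrt_coef_rec[of 1 \<kappa>] f1 by (simp add: coefficient_simps
        del: One_nat_def inv_sqrt_coef.simps(2,3))
  show f3: "inv_sqrt_coef \<kappa> 3 = (5 * \<kappa>^3 + 12 * \<kappa>) / 16"
    using inv_sqrt_coef_rec[of 2 \<kappa>] f2 f1 by (simp add: coefficient_simps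
        del: One_nat_def inv_sqrt_coef.simps(2,3))
  show f4: "inv_sqrt_coef \<kappa> 4 = (35 * \<kappa>^4 + 120 * \<kappa>^2 + 48) / 128"
    using inv_sqrt_coef_rec[of 3 \<kappa>] f3 f2 by (simp add: coefficient_simps
        del: One_nat_def inv_sqrt_coef.simps(2,3))
  show f5: "inv_sqrt_coef \<kappa> 5 = (63 * \<kappa>^5 + 280 * \<kappa>^3 + 240 * \<kappa>) / 256"
    using inv_sqrt_coef_rec[of 4 \<kappa>] f4 f3 by (simp add: coefficient_simps
        del: One_nat_def inv_sqrt_coef.simps(2,3))
  show f6: "inv_sqrt_coef \<kappa> 6 = (231 * \<kappa>^6 + 1260 * \<kappa>^4 + 1680 * \<kappa>^2 + 320) / 1024"
    using inv_sqrt_coef_rec[of 5 \<kappa>] f5 f4 by (simp add: coefficient_simps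
        del: One_nat_def inv_sqrt_coef.simps(2,3))
qed

lemma action_fps_values:
  "fps_nth (action_fps \<kappa>) 0 = 0"
  "fps_nth (action_fps \<kappa>) 1 = 1 / 2"
  "fps_nth (action_fps \<kappa>) 2 = \<kappa> / 16"
  "fps_nth (action_fps \<kappa>) 3 = (3 * \<kappa>^2 + 4) / 128"
  "fps_nth (action_fps \<kappa>) 4 = (25 * \<kappa>^3 + 60 * \<kappa>) / 2048"
  "fps_nth (action_fps \<kappa>) 5 = (245 * \<kappa>^4 + 840 * \<kappa>^2 + 336) / 32768"
  "fps_nth (action_fps \<kappa>) 6 = (1323 * \<kappa>^5 + 5880 * \<kappa>^3 + 5040 * \<kappa>) / 262144"
  "fps_nth (action_fps \<kappa>) 7 = (7623 * \<kappa>^6 + 41580 * \<kappa>^4 + 55440 * \<kappa>^2 + 10560) / 2097152"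
  by (simp_all add: action_fps_def nat_norms sqrt_coef_values inv_sqrt_coef_values field_simps
      del: One_nat_def inv_sqrt_coef.simps(2,3))

lemma edge_const_values:
  "edge_const 0 = -1 * ln 2 + -1 / 2"
  "edge_const 1 = -1 / 4 * ln 2 + 1 / 16"
  "edge_const 2 = -1 / 8 * ln 2 + 5 / 96"
  "edge_const 3 = -5 / 64 * ln 2 + 59 / 1536"
  "edge_const 4 = -7 / 128 * ln 2 + 449 / 15360"
  "edge_const 5 = -21 / 512 * ln 2 + 1417 / 61440"
  "edge_const 6 = -33 / 1024 * ln 2 + 16127 / 860160"
proof -
  show e0: "edge_const 0 = -1 * ln 2 + -1 / 2"
    by (simp add: sqrt_coef_values field_simps)
  show e1: "edge_const 1 = -1 / 4 * ln 2 + 1 / 16"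
    using edge_const.simps(2)[of 0] e0 by (simp add: nat_norms sqrt_coef_values field_simps
        del: One_nat_def edge_const.simps)
  show e2: "edge_const 2 = -1 / 8 * ln 2 + 5 / 96"
    using edge_const.simps(2)[of 1] e1 by (simp add: nat_norms sqrt_coef_values field_simps
        del: One_nat_def edge_const.simps)
  show e3: "edge_const 3 = -5 / 64 * ln 2 + 59 / 1536"
    using edge_const.simps(2)[of 2] e2 by (simp add: nat_norms sqrt_coef_values field_simps
        del: One_nat_def edge_const.simps)
  show e4: "edge_const 4 = -7 / 128 * ln 2 + 449 / 15360"
    using edge_const.simps(2)[of 3] e3 by (simp add: nat_norms sqrt_coef_values field_simps
        del: One_nat_def edge_const.simps)
  show e5: "edge_const 5 = -21 / 512 * ln 2 + 1417 / 61440"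
    using edge_const.simps(2)[of 4] e4 by (simp add: nat_norms sqrt_coef_values field_simps
        del: One_nat_def edge_const.simps)
  show e6: "edge_const 6 = -33 / 1024 * ln 2 + 16127 / 860160"
    using edge_const.simps(2)[of 5] e5 by (simp add: nat_norms sqrt_coef_values field_simps
        del: One_nat_def edge_const.simps)
qed

lemma reg_moment_values:
  "reg_moment \<kappa> 1 = inv_sqrt_coef \<kappa> 1 * reg_moment \<kappa> 0 + (- \<kappa>) / 2"
  "reg_moment \<kappa> 2 = inv_sqrt_coef \<kappa> 2 * reg_moment \<kappa> 0 + (- 7 * \<kappa>^2 - 4) / 16"
  "reg_moment \<kappa> 3 = inv_sqrt_coef \<kappa> 3 * reg_moment \<kappa> 0 + (- 37 * \<kappa>^3 - 60 * \<kappa>) / 96"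
  "reg_moment \<kappa> 4 = inv_sqrt_coef \<kappa> 4 * reg_moment \<kappa> 0 + (- 533 * \<kappa>^4 - 1416 * \<kappa>^2 - 336) / 1536"
  "reg_moment \<kappa> 5 = inv_sqrt_coef \<kappa> 5 * reg_moment \<kappa> 0
      + (- 4881 * \<kappa>^5 - 17960 * \<kappa>^3 - 11280 * \<kappa>) / 15360"
  "reg_moment \<kappa> 6 = inv_sqrt_coef \<kappa> 6 * reg_moment \<kappa> 0
      + (- 18107 * \<kappa>^6 - 85020 * \<kappa>^4 - 90960 * \<kappa>^2 - 11840) / 61440"
proof -
  show m1: "reg_moment \<kappa> 1 = inv_sqrt_coef \<kappa> 1 * reg_moment \<kappa> 0 + (- \<kappa>) / 2"
    using reg_moment_rec[of 0 \<kappa>]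
    by (simp add: coefficient_simps root_fps_nth inv_sqrt_coef_values
        del: One_nat_def reg_moment.simps inv_sqrt_coef.simps(2,3))
  show m2: "reg_moment \<kappa> 2 = inv_sqrt_coef \<kappa> 2 * reg_moment \<kappa> 0 + (- 7 * \<kappa>^2 - 4) / 16"
    using reg_moment_rec[of 1 \<kappa>] m1
    by (simp add: coefficient_simps root_fps_nth inv_sqrt_coef_values
        del: One_nat_def reg_moment.simps inv_sqrt_coef.simps(2,3))
  show m3: "reg_moment \<kappa> 3 = inv_sqrt_coef \<kappa> 3 * reg_moment \<kappa> 0 + (- 37 * \<kappa>^3 - 60 * \<kappa>) / 96"
    using reg_moment_rec[of 2 \<kappa>] m2 m1
    by (simp add: coefficient_simps root_fps_nth inv_sqrt_coef_values
        del: One_nat_def reg_moment.simps inv_sqrt_coef.simps(2,3))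
  show m4: "reg_moment \<kappa> 4 = inv_sqrt_coef \<kappa> 4 * reg_moment \<kappa> 0
      + (- 533 * \<kappa>^4 - 1416 * \<kappa>^2 - 336) / 1536"
    using reg_moment_rec[of 3 \<kappa>] m3 m2
    by (simp add: coefficient_simps root_fps_nth inv_sqrt_coef_values
        del: One_nat_def reg_moment.simps inv_sqrt_coef.simps(2,3))
  show m5: "reg_moment \<kappa> 5 = inv_sqrt_coef \<kappa> 5 * reg_moment \<kappa> 0
      + (- 4881 * \<kappa>^5 - 17960 * \<kappa>^3 - 11280 * \<kappa>) / 15360"
    using reg_moment_rec[of 4 \<kappa>] m4 m3
    by (simp add: coefficient_simps root_fps_nth inv_sqrt_coef_values
        del: One_nat_def reg_moment.simps inv_sqrt_coef.simps(2,3))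
  show m6: "reg_moment \<kappa> 6 = inv_sqrt_coef \<kappa> 6 * reg_moment \<kappa> 0
      + (- 18107 * \<kappa>^6 - 85020 * \<kappa>^4 - 90960 * \<kappa>^2 - 11840) / 61440"
    using reg_moment_rec[of 5 \<kappa>] m5 m4
    by (simp add: coefficient_simps root_fps_nth inv_sqrt_coef_values
        del: One_nat_def reg_moment.simps inv_sqrt_coef.simps(2,3))
qed

text \<open>
  The two logarithmic constants occur only in a multiple of the regular action, because the finite parts and
  the corresponding coefficients of that action satisfy the same homogeneous recurrences.
\<close>

lemma rest_fps_values:
  "fps_nth (rest_fps \<kappa>) 0 = - (reg_moment \<kappa> 0 + 2 * ln 2) * fps_nth (action_fps \<kappa>) 0 + 0"
  "fps_nth (rest_fps \<kappa>) 1 = - (reg_moment \<kappa> 0 + 2 * ln 2) * fps_nth (action_fps \<kappa>) 1 + (- 1) / 2"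
  "fps_nth (rest_fps \<kappa>) 2 = - (reg_moment \<kappa> 0 + 2 * ln 2) * fps_nth (action_fps \<kappa>) 2 + 3 * \<kappa> / 32"
  "fps_nth (rest_fps \<kappa>) 3 = - (reg_moment \<kappa> 0 + 2 * ln 2) * fps_nth (action_fps \<kappa>) 3
      + (9 * \<kappa>^2 + 8) / 192"
  "fps_nth (rest_fps \<kappa>) 4 = - (reg_moment \<kappa> 0 + 2 * ln 2) * fps_nth (action_fps \<kappa>) 4
      + (665 * \<kappa>^3 + 1308 * \<kappa>) / 24576"
  "fps_nth (rest_fps \<kappa>) 5 = - (reg_moment \<kappa> 0 + 2 * ln 2) * fps_nth (action_fps \<kappa>) 5
      + (17185 * \<kappa>^4 + 51720 * \<kappa>^2 + 16656) / 983040"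
  "fps_nth (rest_fps \<kappa>) 6 = - (reg_moment \<kappa> 0 + 2 * ln 2) * fps_nth (action_fps \<kappa>) 6
      + (47943 * \<kappa>^5 + 193480 * \<kappa>^3 + 144240 * \<kappa>) / 3932160"
  "fps_nth (rest_fps \<kappa>) 7 = - (reg_moment \<kappa> 0 + 2 * ln 2) * fps_nth (action_fps \<kappa>) 7
      + (3954027 * \<kappa>^6 + 19979820 * \<kappa>^4 + 24052560 * \<kappa>^2 + 3947840) / 440401920"
  by (simp_all add: rest_fps_def coefficient_simps edge_const_values
      reg_moment_values action_fps_values sqrt_coef_values inv_sqrt_coef_values
      del: One_nat_def reg_moment.simps inv_sqrt_coef.simps(2,3) edge_const.simps)

lemma fps_mult_nth_small:
  fixes F G :: "real fps"
  shows
  "fps_nth (F * G) 0 = fps_nth F 0 * fps_nth G 0"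
  "fps_nth (F * G) 1 = fps_nth F 0 * fps_nth G 1 + fps_nth F 1 * fps_nth G 0"
  "fps_nth (F * G) 2 = fps_nth F 0 * fps_nth G 2 + fps_nth F 1 * fps_nth G 1 + fps_nth F 2 * fps_nth G 0"
  "fps_nth (F * G) 3 = fps_nth F 0 * fps_nth G 3 + fps_nth F 1 * fps_nth G 2 + fps_nth F 2 * fps_nth G 1
      + fps_nth F 3 * fps_nth G 0"
  "fps_nth (F * G) 4 = fps_nth F 0 * fps_nth G 4 + fps_nth F 1 * fps_nth G 3 + fps_nth F 2 * fps_nth G 2
      + fps_nth F 3 * fps_nth G 1 + fps_nth F 4 * fps_nth G 0"
  "fps_nth (F * G) 5 = fps_nth F 0 * fps_nth G 5 + fps_nth F 1 * fps_nth G 4 + fps_nth F 2 * fps_nth G 3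
      + fps_nth F 3 * fps_nth G 2 + fps_nth F 4 * fps_nth G 1 + fps_nth F 5 * fps_nth G 0"
  "fps_nth (F * G) 6 = fps_nth F 0 * fps_nth G 6 + fps_nth F 1 * fps_nth G 5 + fps_nth F 2 * fps_nth G 4
      + fps_nth F 3 * fps_nth G 3 + fps_nth F 4 * fps_nth G 2 + fps_nth F 5 * fps_nth G 1
      + fps_nth F 6 * fps_nth G 0"
  "fps_nth (F * G) 7 = fps_nth F 0 * fps_nth G 7 + fps_nth F 1 * fps_nth G 6 + fps_nth F 2 * fps_nth G 5
      + fps_nth F 3 * fps_nth G 4 + fps_nth F 4 * fps_nth G 3 + fps_nth F 5 * fps_nth G 2
      + fps_nth F 6 * fps_nth G 1 + fps_nth F 7 * fps_nth G 0"
  by (simp_all add: fps_mult_nth numeral_eq_Suc)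

lemma fps_compose_nth_small:
  fixes F G :: "real fps"
  shows
  "fps_nth (F oo G) 0 = fps_nth F 0 * fps_nth (G ^ 0) 0"
  "fps_nth (F oo G) 1 = fps_nth F 0 * fps_nth (G ^ 0) 1 + fps_nth F 1 * fps_nth (G ^ 1) 1"
  "fps_nth (F oo G) 2 = fps_nth F 0 * fps_nth (G ^ 0) 2 + fps_nth F 1 * fps_nth (G ^ 1) 2
      + fps_nth F 2 * fps_nth (G ^ 2) 2"
  "fps_nth (F oo G) 3 = fps_nth F 0 * fps_nth (G ^ 0) 3 + fps_nth F 1 * fps_nth (G ^ 1) 3
      + fps_nth F 2 * fps_nth (G ^ 2) 3 + fps_nth F 3 * fps_nth (G ^ 3) 3"
  "fps_nth (F oo G) 4 = fps_nth F 0 * fps_nth (G ^ 0) 4 + fps_nth F 1 * fps_nth (G ^ 1) 4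
      + fps_nth F 2 * fps_nth (G ^ 2) 4 + fps_nth F 3 * fps_nth (G ^ 3) 4
      + fps_nth F 4 * fps_nth (G ^ 4) 4"
  "fps_nth (F oo G) 5 = fps_nth F 0 * fps_nth (G ^ 0) 5 + fps_nth F 1 * fps_nth (G ^ 1) 5
      + fps_nth F 2 * fps_nth (G ^ 2) 5 + fps_nth F 3 * fps_nth (G ^ 3) 5
      + fps_nth F 4 * fps_nth (G ^ 4) 5 + fps_nth F 5 * fps_nth (G ^ 5) 5"
  "fps_nth (F oo G) 6 = fps_nth F 0 * fps_nth (G ^ 0) 6 + fps_nth F 1 * fps_nth (G ^ 1) 6
      + fps_nth F 2 * fps_nth (G ^ 2) 6 + fps_nth F 3 * fps_nth (G ^ 3) 6
      + fps_nth F 4 * fps_nth (G ^ 4) 6 + fps_nth F 5 * fps_nth (G ^ 5) 6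
      + fps_nth F 6 * fps_nth (G ^ 6) 6"
  "fps_nth (F oo G) 7 = fps_nth F 0 * fps_nth (G ^ 0) 7 + fps_nth F 1 * fps_nth (G ^ 1) 7
      + fps_nth F 2 * fps_nth (G ^ 2) 7 + fps_nth F 3 * fps_nth (G ^ 3) 7
      + fps_nth F 4 * fps_nth (G ^ 4) 7 + fps_nth F 5 * fps_nth (G ^ 5) 7
      + fps_nth F 6 * fps_nth (G ^ 6) 7 + fps_nth F 7 * fps_nth (G ^ 7) 7"
  by (simp_all add: fps_compose_nth numeral_eq_Suc)

lemma action_fps_power_nth_less: "n < i \<Longrightarrow> fps_nth (action_fps \<kappa> ^ i) n = 0"
  using startsby_zero_power_prefix[of "action_fps \<kappa>" i] by (simp add: action_fps_def)

lemma action_fps_power_2_values: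
  "fps_nth (action_fps \<kappa> ^ 2) 2 = 1 / 4"
  "fps_nth (action_fps \<kappa> ^ 2) 3 = \<kappa> / 16"
  "fps_nth (action_fps \<kappa> ^ 2) 4 = (7 * \<kappa>^2 + 8) / 256"
  "fps_nth (action_fps \<kappa> ^ 2) 5 = (31 * \<kappa>^3 + 68 * \<kappa>) / 2048"
  "fps_nth (action_fps \<kappa> ^ 2) 6 = (313 * \<kappa>^4 + 1008 * \<kappa>^2 + 368) / 32768"
  "fps_nth (action_fps \<kappa> ^ 2) 7 = (859 * \<kappa>^5 + 3640 * \<kappa>^3 + 2928 * \<kappa>) / 131072"
proof -
  have power: "action_fps \<kappa> ^ 2 = action_fps \<kappa> * action_fps \<kappa>" by (simp add: power_numeral_reduce)
  show "fps_nth (action_fps \<kappa> ^ 2) 2 = 1 / 4"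
    "fps_nth (action_fps \<kappa> ^ 2) 3 = \<kappa> / 16"
    "fps_nth (action_fps \<kappa> ^ 2) 4 = (7 * \<kappa>^2 + 8) / 256"
    "fps_nth (action_fps \<kappa> ^ 2) 5 = (31 * \<kappa>^3 + 68 * \<kappa>) / 2048"
    "fps_nth (action_fps \<kappa> ^ 2) 6 = (313 * \<kappa>^4 + 1008 * \<kappa>^2 + 368) / 32768"
    "fps_nth (action_fps \<kappa> ^ 2) 7 = (859 * \<kappa>^5 + 3640 * \<kappa>^3 + 2928 * \<kappa>) / 131072"
    unfolding power by (simp_all add: coefficient_simps fps_mult_nth_small action_fps_values
      action_fps_power_nth_less del: One_nat_def)
qed

lemma action_fps_power_3_values:
  "fps_nth (action_fps \<kappa> ^ 3) 3 = 1 / 8"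
  "fps_nth (action_fps \<kappa> ^ 3) 4 = 3 * \<kappa> / 64"
  "fps_nth (action_fps \<kappa> ^ 3) 5 = (3 * \<kappa>^2 + 3) / 128"
  "fps_nth (action_fps \<kappa> ^ 3) 6 = (113 * \<kappa>^3 + 228 * \<kappa>) / 8192"
  "fps_nth (action_fps \<kappa> ^ 3) 7 = (1179 * \<kappa>^4 + 3576 * \<kappa>^2 + 1200) / 131072"
proof -
  have power: "action_fps \<kappa> ^ 3 = action_fps \<kappa> * action_fps \<kappa> ^ 2" by (simp add: power_numeral_reduce)
  show "fps_nth (action_fps \<kappa> ^ 3) 3 = 1 / 8"
    "fps_nth (action_fps \<kappa> ^ 3) 4 = 3 * \<kappa> / 64"
    "fps_nth (action_fps \<kappa> ^ 3) 5 = (3 * \<kappa>^2 + 3) / 128"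
    "fps_nth (action_fps \<kappa> ^ 3) 6 = (113 * \<kappa>^3 + 228 * \<kappa>) / 8192"
    "fps_nth (action_fps \<kappa> ^ 3) 7 = (1179 * \<kappa>^4 + 3576 * \<kappa>^2 + 1200) / 131072"
    unfolding power
        by (simp_all add: coefficient_simps fps_mult_nth_small action_fps_values action_fps_power_2_values
      action_fps_power_nth_less del: One_nat_def)
qed

lemma action_fps_power_4_values:
  "fps_nth (action_fps \<kappa> ^ 4) 4 = 1 / 16"
  "fps_nth (action_fps \<kappa> ^ 4) 5 = \<kappa> / 32"
  "fps_nth (action_fps \<kappa> ^ 4) 6 = (9 * \<kappa>^2 + 8) / 512"
  "fps_nth (action_fps \<kappa> ^ 4) 7 = (45 * \<kappa>^3 + 84 * \<kappa>) / 4096"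
proof -
  have power: "action_fps \<kappa> ^ 4 = action_fps \<kappa> * action_fps \<kappa> ^ 3" by (simp add: power_numeral_reduce)
  show "fps_nth (action_fps \<kappa> ^ 4) 4 = 1 / 16"
    "fps_nth (action_fps \<kappa> ^ 4) 5 = \<kappa> / 32"
    "fps_nth (action_fps \<kappa> ^ 4) 6 = (9 * \<kappa>^2 + 8) / 512"
    "fps_nth (action_fps \<kappa> ^ 4) 7 = (45 * \<kappa>^3 + 84 * \<kappa>) / 4096"
    unfolding power
        by (simp_all add: coefficient_simps fps_mult_nth_small action_fps_values action_fps_power_3_values
      action_fps_power_nth_less del: One_nat_def)
qed

lemma action_fps_power_5_values:
  "fps_nth (action_fps \<kappa> ^ 5) 5 = 1 / 32"
  "fps_nth (action_fps \<kappa> ^ 5) 6 = 5 * \<kappa> / 256"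
  "fps_nth (action_fps \<kappa> ^ 5) 7 = (25 * \<kappa>^2 + 20) / 2048"
proof -
  have power: "action_fps \<kappa> ^ 5 = action_fps \<kappa> * action_fps \<kappa> ^ 4" by (simp add: power_numeral_reduce)
  show "fps_nth (action_fps \<kappa> ^ 5) 5 = 1 / 32"
    "fps_nth (action_fps \<kappa> ^ 5) 6 = 5 * \<kappa> / 256"
    "fps_nth (action_fps \<kappa> ^ 5) 7 = (25 * \<kappa>^2 + 20) / 2048"
    unfolding power
        by (simp_all add: coefficient_simps fps_mult_nth_small action_fps_values action_fps_power_4_values
      action_fps_power_nth_less del: One_nat_def)
qed

lemma action_fps_power_6_values:
  "fps_nth (action_fps \<kappa> ^ 6) 6 = 1 / 64"
  "fps_nth (action_fps \<kappa> ^ 6) 7 = 3 * \<kappa> / 256"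
proof -
  have power: "action_fps \<kappa> ^ 6 = action_fps \<kappa> * action_fps \<kappa> ^ 5" by (simp add: power_numeral_reduce)
  show "fps_nth (action_fps \<kappa> ^ 6) 6 = 1 / 64"
    "fps_nth (action_fps \<kappa> ^ 6) 7 = 3 * \<kappa> / 256"
    unfolding power
        by (simp_all add: coefficient_simps fps_mult_nth_small action_fps_values action_fps_power_5_values
      action_fps_power_nth_less del: One_nat_def)
qed

lemma action_fps_power_7_values:
  "fps_nth (action_fps \<kappa> ^ 7) 7 = 1 / 128"
proof -
  have power: "action_fps \<kappa> ^ 7 = action_fps \<kappa> * action_fps \<kappa> ^ 6" by (simp add: power_numeral_reduce)
  show "fps_nth (action_fps \<kappa> ^ 7) 7 = 1 / 128"
    unfolding power
        by (simp_all add: coefficient_simps fps_mult_nth_small action_fps_values action_fps_power_6_values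
      action_fps_power_nth_less del: One_nat_def)
qed

lemmas action_fps_power_values =
  action_fps_power_nth_less action_fps_power_2_values action_fps_power_3_values
  action_fps_power_4_values action_fps_power_5_values action_fps_power_6_values
  action_fps_power_7_values

text \<open>
  Each coefficient is read off the equation \<open>D' F = F'\<close> for the logarithm \<open>D\<close> of \<open>F\<close>, given the previous ones.
\<close>

lemma fps_log_action_quotient_values:
  "fps_nth (fps_log (action_quotient_fps \<kappa>)) 0 = - ln 2"
  "fps_nth (fps_log (action_quotient_fps \<kappa>)) 1 = \<kappa> / 8"
  "fps_nth (fps_log (action_quotient_fps \<kappa>)) 2 = (5 * \<kappa>^2 + 8) / 128"
  "fps_nth (fps_log (action_quotient_fps \<kappa>)) 3 = (59 * \<kappa>^3 + 156 * \<kappa>) / 3072"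
  "fps_nth (fps_log (action_quotient_fps \<kappa>)) 4 = (47 * \<kappa>^4 + 172 * \<kappa>^2 + 76) / 4096"
  "fps_nth (fps_log (action_quotient_fps \<kappa>)) 5 = (2507 * \<kappa>^5 + 11700 * \<kappa>^3 + 10720 * \<kappa>) / 327680"
  "fps_nth (fps_log (action_quotient_fps \<kappa>)) 6 = (34445 * \<kappa>^6 + 195336 * \<kappa>^4 + 273744 * \<kappa>^2 + 55808) / 6291456"
proof -
  let ?D = "fps_log (action_quotient_fps \<kappa>)" and ?Q = "action_quotient_fps \<kappa>"
  have Q: "fps_nth ?Q n = fps_nth (action_fps \<kappa>) (Suc n)" for n by (simp add: action_quotient_fps_def)
  have ode: "fps_nth (fps_deriv ?D * ?Q) n = fps_nth (fps_deriv ?Q) n" for n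
    using fps_deriv_log[of ?Q] by (simp add: action_quotient_fps_nth_0)
  show d0: "fps_nth ?D 0 = - ln 2" by (simp add: fps_log_nth_0 action_quotient_fps_nth_0 ln_div)
  show d1: "fps_nth ?D 1 = \<kappa> / 8"
    using ode[of 0]
    by (simp add: coefficient_simps fps_mult_nth_small Q action_fps_values del: One_nat_def)
  show d2: "fps_nth ?D 2 = (5 * \<kappa>^2 + 8) / 128"
    using ode[of 1] d1
    by (simp add: coefficient_simps fps_mult_nth_small Q action_fps_values del: One_nat_def)
  show d3: "fps_nth ?D 3 = (59 * \<kappa>^3 + 156 * \<kappa>) / 3072"
    using ode[of 2] d1 d2
    by (simp add: coefficient_simps fps_mult_nth_small Q action_fps_values del: One_nat_def)
  show d4: "fps_nth ?D 4 = (47 * \<kappa>^4 + 172 * \<kappa>^2 + 76) / 4096"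
    using ode[of 3] d1 d2 d3
    by (simp add: coefficient_simps fps_mult_nth_small Q action_fps_values del: One_nat_def)
  show d5: "fps_nth ?D 5 = (2507 * \<kappa>^5 + 11700 * \<kappa>^3 + 10720 * \<kappa>) / 327680"
    using ode[of 4] d1 d2 d3 d4
    by (simp add: coefficient_simps fps_mult_nth_small Q action_fps_values del: One_nat_def)
  show d6: "fps_nth ?D 6 = (34445 * \<kappa>^6 + 195336 * \<kappa>^4 + 273744 * \<kappa>^2 + 55808) / 6291456"
    using ode[of 5] d1 d2 d3 d4 d5
    by (simp add: coefficient_simps fps_mult_nth_small Q action_fps_values del: One_nat_def)
qed

lemma pulled_back_invariant_fps_values:
  fixes \<kappa> :: real
  defines "c \<equiv> reg_moment \<kappa> 0 + ln 2"
  shows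
  "fps_nth (pulled_back_invariant_fps \<kappa>) 0 = (c - 1) * fps_nth (action_fps \<kappa>) 0 + 0"
  "fps_nth (pulled_back_invariant_fps \<kappa>) 1 = (c - 1) * fps_nth (action_fps \<kappa>) 1 + 1 / 2"
  "fps_nth (pulled_back_invariant_fps \<kappa>) 2 = (c - 1) * fps_nth (action_fps \<kappa>) 2 + (- \<kappa>) / 32"
  "fps_nth (pulled_back_invariant_fps \<kappa>) 3 = (c - 1) * fps_nth (action_fps \<kappa>) 3 + (- 15 * \<kappa>^2 - 8) / 768"
  "fps_nth (pulled_back_invariant_fps \<kappa>) 4 = (c - 1) * fps_nth (action_fps \<kappa>) 4
      + (- 99 * \<kappa>^3 - 164 * \<kappa>) / 8192"
  "fps_nth (pulled_back_invariant_fps \<kappa>) 5 = (c - 1) * fps_nth (action_fps \<kappa>) 5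
      + (- 2655 * \<kappa>^4 - 7240 * \<kappa>^2 - 1872) / 327680"
  "fps_nth (pulled_back_invariant_fps \<kappa>) 6 = (c - 1) * fps_nth (action_fps \<kappa>) 6
      + (- 22761 * \<kappa>^5 - 85820 * \<kappa>^3 - 56880 * \<kappa>) / 3932160"
  "fps_nth (pulled_back_invariant_fps \<kappa>) 7 = (c - 1) * fps_nth (action_fps \<kappa>) 7
      + (- 1909719 * \<kappa>^6 - 9166500 * \<kappa>^4 - 10206000 * \<kappa>^2 - 1456960) / 440401920"
 
      by (simp_all add: pulled_back_invariant_fps_def c_def coefficient_simps fps_mult_nth_small action_fps_values rest_fps_values
        fps_log_action_quotient_values del: One_nat_def reg_moment.simps)

text \<open>
  In the \<open>n\<close>-th coefficient of the composition the unknown \<open>n\<close>-th coefficient of the invariant occurs with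
  the factor \<open>1/2\<^sup>n\<close>, and all others are already known.
\<close>

lemma invariant_fps_values:
  "fps_nth (invariant_fps \<kappa>) 0 = 0"
  "fps_nth (invariant_fps \<kappa>) 1 = reg_moment \<kappa> 0 + ln 2"
  "fps_nth (invariant_fps \<kappa>) 2 = (- 3 * \<kappa>) / 8"
  "fps_nth (invariant_fps \<kappa>) 3 = (- 15 * \<kappa>^2 - 32) / 96"
  "fps_nth (invariant_fps \<kappa>) 4 = (- 55 * \<kappa>^3 - 180 * \<kappa>) / 512"
  "fps_nth (invariant_fps \<kappa>) 5 = (- 945 * \<kappa>^4 - 4200 * \<kappa>^2 - 2672) / 10240"
  "fps_nth (invariant_fps \<kappa>) 6 = (- 3689 * \<kappa>^5 - 20720 * \<kappa>^3 - 25200 * \<kappa>) / 40960"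
  "fps_nth (invariant_fps \<kappa>) 7 = (- 65709 * \<kappa>^6 - 446040 * \<kappa>^4 - 801360 * \<kappa>^2 - 241664) / 688128"
proof -
  let ?\<sigma> = "invariant_fps \<kappa>"
  have eq: "fps_nth (?\<sigma> oo action_fps \<kappa>) n = fps_nth (pulled_back_invariant_fps \<kappa>) n" for n
      by (simp only: invariant_fps_compose)
  show s0: "fps_nth ?\<sigma> 0 = 0"
    using eq[of 0]
   
        by (simp add: coefficient_simps fps_compose_nth_small pulled_back_invariant_fps_values action_fps_values action_fps_power_values
          del: One_nat_def reg_moment.simps)
  show s1: "fps_nth ?\<sigma> 1 = reg_moment \<kappa> 0 + ln 2"
    using eq[of 1] s0
   
        by (simp add: coefficient_simps fps_compose_nth_small pulled_back_invariant_fps_values action_fps_values action_fps_power_values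
          del: One_nat_def reg_moment.simps)
  show s2: "fps_nth ?\<sigma> 2 = (- 3 * \<kappa>) / 8"
    using eq[of 2] s0 s1
   
        by (simp add: coefficient_simps fps_compose_nth_small pulled_back_invariant_fps_values action_fps_values action_fps_power_values
          del: One_nat_def reg_moment.simps)
  show s3: "fps_nth ?\<sigma> 3 = (- 15 * \<kappa>^2 - 32) / 96"
    using eq[of 3] s0 s1 s2
   
        by (simp add: coefficient_simps fps_compose_nth_small pulled_back_invariant_fps_values action_fps_values action_fps_power_values
          del: One_nat_def reg_moment.simps)
  show s4: "fps_nth ?\<sigma> 4 = (- 55 * \<kappa>^3 - 180 * \<kappa>) / 512"
    using eq[of 4] s0 s1 s2 s3
   
        by (simp add: coefficient_simps fps_compose_nth_small pulled_back_invariant_fps_values action_fps_values action_fps_power_values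
          del: One_nat_def reg_moment.simps)
  show s5: "fps_nth ?\<sigma> 5 = (- 945 * \<kappa>^4 - 4200 * \<kappa>^2 - 2672) / 10240"
    using eq[of 5] s0 s1 s2 s3 s4
   
        by (simp add: coefficient_simps fps_compose_nth_small pulled_back_invariant_fps_values action_fps_values action_fps_power_values
          del: One_nat_def reg_moment.simps)
  show s6: "fps_nth ?\<sigma> 6 = (- 3689 * \<kappa>^5 - 20720 * \<kappa>^3 - 25200 * \<kappa>) / 40960"
    using eq[of 6] s0 s1 s2 s3 s4 s5
   
        by (simp add: coefficient_simps fps_compose_nth_small pulled_back_invariant_fps_values action_fps_values action_fps_power_values
          del: One_nat_def reg_moment.simps)
  show s7: "fps_nth ?\<sigma> 7 = (- 65709 * \<kappa>^6 - 446040 * \<kappa>^4 - 801360 * \<kappa>^2 - 241664) / 688128"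
    using eq[of 7] s0 s1 s2 s3 s4 s5 s6
   
        by (simp add: coefficient_simps fps_compose_nth_small pulled_back_invariant_fps_values action_fps_values action_fps_power_values
          del: One_nat_def reg_moment.simps)
qed

section \<open>The semi-global symplectic invariant\<close>

lemma reg_moment_0_plus_ln_2: "reg_moment \<kappa> 0 + ln 2 = 1 / 2 * ln (64 / (\<kappa>\<^sup>2 + 4))"
proof -
  have pos: "\<kappa>\<^sup>2 + 4 > 0" by (simp add: add_nonneg_pos)
  have "ln (4::real) = 2 * ln 2" "ln (64::real) = 6 * ln 2"
    using ln_realpow[of "2::real" 2] ln_realpow[of "2::real" 6] by simp_all
  thus ?thesis using pos by (simp add: ln_div ln_sqrt field_simps)
qed

text \<open>
  The quotient by \<open>x\<^sup>n\<close> is the shifted series, which is continuous at \<open>0\<close>.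
\<close>

lemma eval_fps_minus_truncation_bigo:
  fixes F :: "real fps"
  assumes "fps_conv_radius F > 0"
  shows "(\<lambda>x. eval_fps F x - (\<Sum>k<n. fps_nth F k * x ^ k)) \<in> O[at 0](\<lambda>x. x ^ n)"
proof (rule bigoI_tendsto)
  have "\<forall>\<^sub>F x in at 0. (eval_fps F x - (\<Sum>k<n. fps_nth F k * x ^ k)) / x ^ n = eval_fps (fps_shift n F) x"
    using eventually_nhds_imp_at_within[OF eventually_conv_radius[OF assms]] eventually_neq_at_within[of 0 0 UNIV]
  proof eventually_elim
    case (elim x)
    have "(\<lambda>k. fps_nth F (k + n) * x ^ (k + n)) sums (eval_fps F x - (\<Sum>k<n. fps_nth F k * x ^ k))"
      by (rule sums_split_initial_segment[OF sums_eval_fps]) (rule elim)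
    from sums_divide[OF this, of "x ^ n"] elim(2)
    have "(\<lambda>k. fps_nth (fps_shift n F) k * x ^ k) sums ((eval_fps F x - (\<Sum>k<n. fps_nth F k * x ^ k)) / x ^ n)"
      by (simp add: power_add)
    thus ?case by (simp add: eval_fps_def sums_iff)
  qed
  moreover have "(eval_fps (fps_shift n F) \<longlongrightarrow> eval_fps (fps_shift n F) 0) (at 0)"
    using continuous_eval_fps[of 0 "fps_shift n F" UNIV] assms by (simp add: zero_ereal_def isCont_def)
  ultimately show "((\<lambda>x. (eval_fps F x - (\<Sum>k<n. fps_nth F k * x ^ k)) / x ^ n) \<longlongrightarrow> eval_fps (fps_shift n F) 0) (at 0)"
    by (simp add: tendsto_cong)
  show "\<forall>\<^sub>F x in at 0. x ^ n \<noteq> (0::real)"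
    using eventually_neq_at_within[of 0 0 UNIV] by eventually_elim simp
qed

lemma top_rho_pos: "euler_top \<Theta>\<^sub>1 \<Theta>\<^sub>2 \<Theta>\<^sub>3 \<Longrightarrow> top_rho \<Theta>\<^sub>1 \<Theta>\<^sub>2 \<Theta>\<^sub>3 > 0"
  by (simp add: euler_top_def top_rho_def)

theorem theorem4p1:
  fixes \<Theta>\<^sub>1 \<Theta>\<^sub>2 \<Theta>\<^sub>3 \<rho> \<kappa> :: real
  assumes "euler_top \<Theta>\<^sub>1 \<Theta>\<^sub>2 \<Theta>\<^sub>3"
    and "\<rho> = top_rho \<Theta>\<^sub>1 \<Theta>\<^sub>2 \<Theta>\<^sub>3"
    and "\<kappa> = top_kappa \<rho>"
  shows "(\<exists>\<epsilon>. admissible_radius \<rho> \<epsilon>) \<and>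
    (\<forall>\<epsilon>. admissible_radius \<rho> \<epsilon> \<longrightarrow>
       I_alpha \<rho> \<epsilon> analytic_on {0} \<and> (\<exists>g. real_local_inverse (I_alpha \<rho> \<epsilon>) g)) \<and>
    (I_beta_plus \<rho> \<longlongrightarrow> I_beta_plus_0 \<rho>) (at_right 0) \<and>
    (I_beta_minus \<rho> \<longlongrightarrow> I_beta_minus_0 \<rho>) (at_left 0) \<and>
    2 * pi * I_beta_plus_0 \<rho> = 2 * arctan (inverse \<rho>) \<and>
    2 * pi * I_beta_minus_0 \<rho> = 2 * arctan \<rho> \<and>
    (\<exists>!\<sigma>. semiglobal_invariant \<rho> \<sigma>) \<and>
    (\<forall>\<sigma>. semiglobal_invariant \<rho> \<sigma> \<longrightarrow>
       (\<lambda>J. eval_fps \<sigma> J -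
          (1 / 2 * ln (64 / (\<kappa>^2 + 4)) * J
           - 3 * \<kappa> / 8 * J^2
           - (15 * \<kappa>^2 + 32) / 96 * J^3
           - 5 * \<kappa> * (11 * \<kappa>^2 + 36) / 512 * J^4
           - (945 * \<kappa>^4 + 4200 * \<kappa>^2 + 2672) / 10240 * J^5
           - 7 * \<kappa> * (527 * \<kappa>^4 + 2960 * \<kappa>^2 + 3600) / 40960 * J^6
           - (65709 * \<kappa>^6 + 446040 * \<kappa>^4 + 801360 * \<kappa>^2 + 241664) / 688128 * J^7))
       \<in> O[at 0](\<lambda>J. J^8))"
proof (intro conjI allI impI)
  have \<rho>: "\<rho> > 0" using top_rho_pos assms(1,2) by simp
  show "\<exists>\<epsilon>. admissible_radius \<rho> \<epsilon>" using admissible_radius_exists[OF \<rho>] by blast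
  show "I_alpha \<rho> \<epsilon> analytic_on {0}" if "admissible_radius \<rho> \<epsilon>" for \<epsilon>
    using I_alpha_analytic[OF \<rho> that] .
  show "\<exists>g. real_local_inverse (I_alpha \<rho> \<epsilon>) g" if "admissible_radius \<rho> \<epsilon>" for \<epsilon>
    using real_local_inverse_exists[OF \<rho> that] by blast
  show "(I_beta_plus \<rho> \<longlongrightarrow> I_beta_plus_0 \<rho>) (at_right 0)"
    using I_beta_plus_tendsto[OF \<rho>] by (simp add: I_beta_0[OF \<rho>])
  show "(I_beta_minus \<rho> \<longlongrightarrow> I_beta_minus_0 \<rho>) (at_left 0)"
    using I_beta_minus_tendsto[OF \<rho>] by (simp add: I_beta_0[OF \<rho>])
  show "2 * pi * I_beta_plus_0 \<rho> = 2 * arctan (inverse \<rho>)" "2 * pi * I_beta_minus_0 \<rho> = 2 * arctan \<rho>"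
    by (simp_all add: I_beta_0[OF \<rho>])
  have inv: "semiglobal_invariant \<rho> (invariant_fps \<kappa>)"
    using semiglobal_invariant_invariant_fps[OF \<rho>] assms(3) by simp
  thus "\<exists>!\<sigma>. semiglobal_invariant \<rho> \<sigma>"
    using semiglobal_invariant_unique[OF \<rho>] by blast
  fix \<sigma> assume "semiglobal_invariant \<rho> \<sigma>"
  hence \<sigma>: "\<sigma> = invariant_fps \<kappa>" using inv semiglobal_invariant_unique[OF \<rho>] by blast
  have "(\<Sum>k<8. fps_nth \<sigma> k * J ^ k) =
     1 / 2 * ln (64 / (\<kappa>^2 + 4)) * J
       - 3 * \<kappa> / 8 * J^2
       - (15 * \<kappa>^2 + 32) / 96 * J^3
       - 5 * \<kappa> * (11 * \<kappa>^2 + 36) / 512 * J^4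
       - (945 * \<kappa>^4 + 4200 * \<kappa>^2 + 2672) / 10240 * J^5
       - 7 * \<kappa> * (527 * \<kappa>^4 + 2960 * \<kappa>^2 + 3600) / 40960 * J^6
       - (65709 * \<kappa>^6 + 446040 * \<kappa>^4 + 801360 * \<kappa>^2 + 241664) / 688128 * J^7" (is "_ = ?P J") for J
  proof -
    have "(\<Sum>k<8. fps_nth \<sigma> k * J ^ k) = fps_nth \<sigma> 0 + fps_nth \<sigma> 1 * J + fps_nth \<sigma> 2 * J ^ 2 + fps_nth \<sigma> 3 * J ^ 3
       + fps_nth \<sigma> 4 * J ^ 4 + fps_nth \<sigma> 5 * J ^ 5 + fps_nth \<sigma> 6 * J ^ 6 + fps_nth \<sigma> 7 * J ^ 7"
      by (simp add: numeral_eq_Suc)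
    also have "\<dots> = ?P J"
      unfolding \<sigma> invariant_fps_values reg_moment_0_plus_ln_2 by (simp add: field_simps power_numeral_reduce[of \<kappa>])
    finally show ?thesis .
  qed
  moreover have "fps_conv_radius \<sigma> > 0" unfolding \<sigma> by (rule conv_radius_invariant_fps)
  ultimately show "(\<lambda>J. eval_fps \<sigma> J - ?P J) \<in> O[at 0](\<lambda>J. J ^ 8)"
    using eval_fps_minus_truncation_bigo[of \<sigma> 8] by simp
qed

end
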